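(* Let $G$ be a finite simple graph and let $I_G$ be its cut ideal. Then $I_G$ is generated by quadrics (that is, $I_G$ is generated by polynomials of degree at most $2$; equivalently $\mu(G)\le 2$) if and only if $G$ has no $K_4$-minor.
   Context: Let $\mathbb{K}$ be a field and $G$ a finite simple graph. A cut $A\mid B=B\mid A$ of $G$ is an unordered partition of $V(G)$ into two (possibly empty) parts $A,B$. An edge $ij$ is in $A\mid B$ if its endpoints lie in different parts. The cut ideal $I_G$ is the kernel of the $\mathbb{K}$-algebra homomorphism $\phi_G:\mathbb{K}[q_{A\mid B} : A\mid B \text{ a cut of } G]\to \mathbb{K}[s_{ij},t_{ij} : ij\in E(G)]$ given by $q_{A\mid B}\mapsto \prod_{ij \text{ in } A\mid B}s_{ij}\prod_{ij\text{ not in }A\mid B}t_{ij}$. $\mu(G)$ denotes the largest degree of a minimal generator of $I_G$, i.e. the least $d\ge 0$ such that $I_G$ is generated by polynomials of degree at most $d$ (so $\mu(G)=0$ if $I_G=0$). $G$ has a $K_4$-minor if the complete graph $K_4$ can be obtained from $G$ by deleting vertices, deleting edges and contracting edges. *)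

theory Defs
  imports
    "HOL-Algebra.Ideal"
    "HOL-Library.Poly_Mapping"
    "HOL-Library.Ramsey"
    "HOL-Library.Extended_Nat"
begin

section \<open>Multivariate polynomials\<close>

text \<open>
  A monomial in variables of type \<open>'x\<close> is a finitely supported exponent function, a polynomial
  is a finitely supported coefficient function on monomials; the ring operations are those of
  \<open>HOL-Library.Poly_Mapping\<close>.
\<close>

type_synonym ('x, 'k) mpoly = "('x \<Rightarrow>\<^sub>0 nat) \<Rightarrow>\<^sub>0 'k"

definition Const :: "'k::field \<Rightarrow> ('x, 'k) mpoly" where
  "Const c = Poly_Mapping.single 0 c"

definition Var :: "'x \<Rightarrow> ('x, 'k::field) mpoly" where
  "Var x = Poly_Mapping.single (Poly_Mapping.single x 1) 1"

text \<open>The polynomial ring over \<open>'k\<close> whose variables are the elements of the set \<open>X\<close>.\<close>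

definition poly_ring :: "'x set \<Rightarrow> ('x, 'k::field) mpoly ring" where
  "poly_ring X = \<lparr>carrier = {p. \<forall>m\<in>Poly_Mapping.keys p. Poly_Mapping.keys m \<subseteq> X},
                  monoid.mult = (*), one = 1, zero = 0, add = (+)\<rparr>"

definition total_degree :: "('x, 'k::field) mpoly \<Rightarrow> nat" where
  "total_degree p =
     Max (insert 0 ((\<lambda>m. \<Sum>x\<in>Poly_Mapping.keys m. Poly_Mapping.lookup m x) ` Poly_Mapping.keys p))"

text \<open>The \<open>'k\<close>-algebra homomorphism that sends each variable \<open>x\<close> to \<open>f x\<close>.\<close>

definition subst_hom :: "('x \<Rightarrow> ('y, 'k::field) mpoly) \<Rightarrow> ('x, 'k) mpoly \<Rightarrow> ('y, 'k) mpoly" where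
  "subst_hom f p = (\<Sum>m\<in>Poly_Mapping.keys p. Const (Poly_Mapping.lookup p m) *
                      (\<Prod>x\<in>Poly_Mapping.keys m. f x ^ Poly_Mapping.lookup m x))"

definition generated_in_degree :: "'x set \<Rightarrow> ('x, 'k::field) mpoly set \<Rightarrow> nat \<Rightarrow> bool" where
  "generated_in_degree X I d \<longleftrightarrow>
     (\<exists>F \<subseteq> carrier (poly_ring X). (\<forall>p\<in>F. total_degree p \<le> d) \<and> I = Idl\<^bsub>poly_ring X\<^esub> F)"

lemma cring_poly_ring: "cring (poly_ring X :: ('x, 'k::field) mpoly ring)"
proof -
  let ?R = "poly_ring X :: ('x, 'k) mpoly ring"
  have add: "p + q \<in> carrier ?R" if "p \<in> carrier ?R" "q \<in> carrier ?R" for p q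
    using that Poly_Mapping.keys_add[of p q] by (auto simp: poly_ring_def)
  have mult: "p * q \<in> carrier ?R" if pq: "p \<in> carrier ?R" "q \<in> carrier ?R" for p q
  proof -
    have "Poly_Mapping.keys m \<subseteq> X" if "m \<in> Poly_Mapping.keys (p * q)" for m
    proof -
      obtain a b where "m = a + b" "a \<in> Poly_Mapping.keys p" "b \<in> Poly_Mapping.keys q"
        using keys_mult[of p q] \<open>m \<in> _\<close> by blast
      then show ?thesis
        using pq Poly_Mapping.keys_add[of a b] by (fastforce simp: poly_ring_def)
    qed
    then show ?thesis by (simp add: poly_ring_def)
  qed
  have uminus: "- p \<in> carrier ?R" if "p \<in> carrier ?R" for p
    using that by (simp add: poly_ring_def)
  have ops: "\<zero>\<^bsub>?R\<^esub> = 0" "\<one>\<^bsub>?R\<^esub> = 1" "(\<oplus>\<^bsub>?R\<^esub>) = (+)" "(\<otimes>\<^bsub>?R\<^esub>) = (*)"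
    by (simp_all add: poly_ring_def)
  have zero_one: "0 \<in> carrier ?R" "1 \<in> carrier ?R"
    by (simp_all add: poly_ring_def)
  show ?thesis
  proof (rule cringI)
    show "abelian_group ?R"
      by (rule abelian_groupI) (auto simp: ops zero_one add algebra_simps intro: uminus
          intro!: bexI[of _ "- _"])
    show "comm_monoid ?R"
      by (rule comm_monoidI) (auto simp: ops zero_one mult algebra_simps)
  qed (simp add: ops algebra_simps)
qed

lemma subst_hom_superset:
  assumes "finite A" "Poly_Mapping.keys p \<subseteq> A"
  shows "subst_hom f p = (\<Sum>m\<in>A. Const (Poly_Mapping.lookup p m) *
           (\<Prod>x\<in>Poly_Mapping.keys m. f x ^ Poly_Mapping.lookup m x))"
  unfolding subst_hom_def using assms
  by (intro sum.mono_neutral_left) (auto simp: Const_def in_keys_iff)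

lemma subst_hom_add: "subst_hom f (p + q) = subst_hom f p + subst_hom f q"
proof -
  let ?A = "Poly_Mapping.keys p \<union> Poly_Mapping.keys q"
  have "Poly_Mapping.keys (p + q) \<subseteq> ?A" by (rule Poly_Mapping.keys_add)
  then show ?thesis
    by (simp add: subst_hom_superset[of ?A] lookup_add Const_def single_add distrib_right
        sum.distrib)
qed

lemma subst_hom_single:
  "subst_hom f (Poly_Mapping.single m c) =
     Const c * (\<Prod>x\<in>Poly_Mapping.keys m. f x ^ Poly_Mapping.lookup m x)"
  by (simp add: subst_hom_superset[of "{m}"])

lemma subst_hom_Const: "subst_hom f (Const c) = Const c"
  by (simp add: Const_def subst_hom_single)

lemma subst_hom_Var: "subst_hom f (Var x) = f x"
  by (simp add: Var_def subst_hom_single Const_def)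

lemma subst_hom_mult:
  fixes f :: "'x \<Rightarrow> ('y, 'k::field) mpoly"
  shows "subst_hom f (p * q) = subst_hom f p * subst_hom f q"
proof -
  have mono: "(\<Prod>x\<in>Poly_Mapping.keys m. f x ^ Poly_Mapping.lookup m x) =
      (\<Prod>x\<in>A. f x ^ Poly_Mapping.lookup m x)"
    if "finite A" "Poly_Mapping.keys m \<subseteq> A" for m A
    using that by (intro prod.mono_neutral_left) (auto simp: in_keys_iff)
  have single: "subst_hom f (Poly_Mapping.single m c * Poly_Mapping.single n d) =
      subst_hom f (Poly_Mapping.single m c) * subst_hom f (Poly_Mapping.single n d)" for m n c d
  proof -
    let ?A = "Poly_Mapping.keys m \<union> Poly_Mapping.keys n"
    have "Const (c * d) = (Const c * Const d :: ('y, 'k) mpoly)"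
      by (simp add: Const_def mult_single)
    moreover have "Poly_Mapping.keys (m + n) = ?A"
      by (auto simp: in_keys_iff lookup_add)
    ultimately show ?thesis
      by (simp add: mult_single subst_hom_single mono[of ?A] lookup_add power_add prod.distrib
          algebra_simps)
  qed
  have zero: "subst_hom f 0 = 0" by (simp add: subst_hom_def)
  have upd: "Poly_Mapping.update a b p = p + Poly_Mapping.single a b"
    if "a \<notin> Poly_Mapping.keys p" for a b and p :: "('x, 'k) mpoly"
    using that
    by (intro poly_mapping_eqI)
       (auto simp: lookup_add lookup_update lookup_single when_def in_keys_iff)
  show ?thesis
  proof (induction p rule: update_induct)
    case const
    show ?case by (simp add: zero)
  next
    case (update p a b)
    have "subst_hom f (Poly_Mapping.single a b * q) =
        subst_hom f (Poly_Mapping.single a b) * subst_hom f q"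
      by (induction q rule: update_induct)
         (simp_all add: zero upd subst_hom_add distrib_left single)
    with update show ?case
      by (simp add: upd subst_hom_add distrib_right)
  qed
qed

section \<open>Graphs and minors\<close>

definition simple_graph :: "'v set \<Rightarrow> 'v set set \<Rightarrow> bool" where
  "simple_graph V E \<longleftrightarrow> finite V \<and> E \<subseteq> [V]\<^bsup>2\<^esup>"

text \<open>
  Contracting the edge \<open>{u, v}\<close> keeps \<open>u\<close> as the name of the merged vertex; the loop that
  arises is dropped and parallel edges are identified.
\<close>

inductive minor_step :: "'v set \<times> 'v set set \<Rightarrow> 'v set \<times> 'v set set \<Rightarrow> bool" where
  delete_vertex: "v \<in> V \<Longrightarrow> minor_step (V, E) (V - {v}, {e \<in> E. v \<notin> e})"
| delete_edge: "e \<in> E \<Longrightarrow> minor_step (V, E) (V, E - {e})"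
| contract_edge: "{u, v} \<in> E \<Longrightarrow> u \<noteq> v \<Longrightarrow>
    minor_step (V, E) (V - {v}, (\<lambda>e. (\<lambda>x. if x = v then u else x) ` e) ` (E - {{u, v}}))"

definition has_K4_minor :: "'v set \<Rightarrow> 'v set set \<Rightarrow> bool" where
  "has_K4_minor V E \<longleftrightarrow> (\<exists>W. card W = 4 \<and> minor_step\<^sup>*\<^sup>* (V, E) (W, [W]\<^bsup>2\<^esup>))"

section \<open>Cut ideals\<close>

text \<open>The unordered partition \<open>A | B\<close> is the set \<open>{A, B}\<close>.\<close>

definition cuts :: "'v set \<Rightarrow> 'v set set set" where
  "cuts V = {{A, B} | A B. A \<union> B = V \<and> A \<inter> B = {}}"

definition edge_in_cut :: "'v set \<Rightarrow> 'v set set \<Rightarrow> bool" where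
  "edge_in_cut e c \<longleftrightarrow> (\<exists>i j. \<exists>A\<in>c. \<exists>B\<in>c. e = {i, j} \<and> A \<noteq> B \<and> i \<in> A \<and> j \<in> B)"

text \<open>\<open>S e\<close> and \<open>T e\<close> index the variables \<open>s\<^sub>i\<^sub>j\<close> and \<open>t\<^sub>i\<^sub>j\<close> for \<open>e = {i, j}\<close>.\<close>

datatype 'v edge_var = S "'v set" | T "'v set"

definition cut_map :: "'v set set \<Rightarrow> ('v set set, 'k::field) mpoly \<Rightarrow> ('v edge_var, 'k) mpoly" where
  "cut_map E = subst_hom (\<lambda>c. (\<Prod>e\<in>{e \<in> E. edge_in_cut e c}. Var (S e)) *
                              (\<Prod>e\<in>{e \<in> E. \<not> edge_in_cut e c}. Var (T e)))"

definition cut_ideal :: "'v set \<Rightarrow> 'v set set \<Rightarrow> ('v set set, 'k::field) mpoly set" where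
  "cut_ideal V E = a_kernel (poly_ring (cuts V)) (poly_ring (S ` E \<union> T ` E)) (cut_map E)"

text \<open>
  The least \<open>d\<close> such that the cut ideal over \<open>'k\<close> is generated in degree at most \<open>d\<close>; taken in
  \<open>enat\<close> so that the value would be \<open>\<infinity>\<close> if no such \<open>d\<close> existed.
\<close>

definition mu :: "'k::field itself \<Rightarrow> 'v set \<Rightarrow> 'v set set \<Rightarrow> enat" where
  "mu _ V E = Inf (enat ` {d. generated_in_degree (cuts V) (cut_ideal V E :: ('v set set, 'k) mpoly set) d})"

end

theory Submission
  imports Defs
begin

text \<open>
  A monomial of degree \<open>d\<close> in the cut variables is a \<open>d\<close>-row matrix of two-colourings of the
  vertices, and its image records, for every edge, in how many rows the edge is cut. So \<open>I\<^sub>G\<close> is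
  generated by quadrics iff any two matrices with the same counts are joined by steps that change
  at most two rows and keep the counts.

  A graph without \<open>K\<^sub>4\<close>-minor is a subgraph of a 2-tree. For a 2-tree the steps are found by
  induction, attaching one vertex at a time. For a subgraph \<open>H\<close> of a 2-tree \<open>R\<close>, two matrices with
  the same counts on \<open>H\<close> may have different counts on \<open>R\<close>; if so, a two-row step that preserves the
  counts on \<open>H\<close> brings those on \<open>R\<close> closer together. Such a step is built along the 2-tree: moving
  the count of one side of a triangle is possible with the other two sides fixed, unless a triangle
  inequality is tight, and then a second side has to move in the right direction as well.

  Conversely, let four connected vertex sets form a \<open>K\<^sub>4\<close>-model. The quartic relation between the
  cuts of \<open>K\<^sub>4\<close> pulls back to \<open>G\<close>, and it is not generated by quadrics: one of its two monomials
  contains a trivial cut, and no exchange of two cuts can destroy this property, because both sides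
  of every cut of \<open>K\<^sub>4\<close> are connected.
\<close>

section \<open>Matrices of two-colourings\<close>

text \<open>In every row the number of separated sides of a triangle \<open>p\<close>,
  \<open>q\<close>, \<open>v\<close> is even, so the colour of \<open>v\<close> relative to
  \<open>q\<close> follows from its colour relative to \<open>p\<close> and from the status of
  \<open>p, q\<close>. Attaching a vertex to a 2-tree is therefore a matter of matching rows with
  equal status of \<open>p, q\<close>.

  For a subgraph two obstacles arise. Counts on the 2-tree are moved by two at a time, so their
  parities have to be right beforehand. Moreover, a step on the old vertices designates two rows,
  while the pattern that \<open>v\<close> should have in these rows may occur elsewhere in the
  matrix. For this reason a step need not start at the given matrix \<open>x\<close>: it may start
  at a rearrangement \<open>z\<close> with the same counts on the whole 2-tree, which is reachable
  by the 2-tree case.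

  In the converse direction the generators need not be binomials. A linear functional that takes
  equal values on monomials with equal image replaces the tracing of single exchanges.\<close>

definition sep_count :: "nat \<Rightarrow> (nat \<Rightarrow> 'v \<Rightarrow> bool) \<Rightarrow> 'v \<Rightarrow> 'v \<Rightarrow> nat" where
  "sep_count d x u v = (\<Sum>k<d. of_bool (x k u \<noteq> x k v))"

definition quad_step ::
    "('v \<times> 'v) set \<Rightarrow> nat \<Rightarrow> (nat \<Rightarrow> 'v \<Rightarrow> bool) \<Rightarrow> (nat \<Rightarrow> 'v \<Rightarrow> bool) \<Rightarrow> bool" where
  "quad_step H d x y \<longleftrightarrow> card {k. k < d \<and> x k \<noteq> y k} \<le> 2 \<and>
     (\<forall>(u, v)\<in>H. sep_count d x u v = sep_count d y u v)"

text \<open>The loops in \<open>R\<close> allow \<open>p = q\<close>, that is, attaching a vertex to a single vertex.\<close>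

inductive two_tree :: "'v set \<Rightarrow> ('v \<times> 'v) set \<Rightarrow> bool" where
  root: "two_tree {r} {(r, r)}"
| attach: "two_tree V R \<Longrightarrow> (p, q) \<in> R \<Longrightarrow> v \<notin> V \<Longrightarrow>
    two_tree (insert v V) (R \<union> {(p, v), (q, v), (v, v)})"

lemma two_tree_subset: "two_tree V R \<Longrightarrow> R \<subseteq> V \<times> V"
  by (induction rule: two_tree.induct) auto

lemma two_tree_finite: "two_tree V R \<Longrightarrow> finite R"
  by (induction rule: two_tree.induct) auto

lemma two_tree_refl: "two_tree V R \<Longrightarrow> v \<in> V \<Longrightarrow> (v, v) \<in> R"
  by (induction rule: two_tree.induct) auto

lemma sep_count_commute: "sep_count d x u v = sep_count d x v u"
  unfolding sep_count_def by (intro sum.cong) auto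

lemma sep_count_self [simp]: "sep_count d x u u = 0"
  by (simp add: sep_count_def)

lemma sep_count_fun_upd:
  assumes "u \<noteq> v" "w \<noteq> v"
  shows "sep_count d (\<lambda>k. (x k)(v := \<beta> k)) u w = sep_count d x u w"
  using assms by (simp add: sep_count_def)

lemma quad_step_mono: "quad_step R d x y \<Longrightarrow> H \<subseteq> R \<Longrightarrow> quad_step H d x y"
  by (auto simp: quad_step_def)

lemma quad_steps_mono: "(quad_step R d)\<^sup>*\<^sup>* x y \<Longrightarrow> H \<subseteq> R \<Longrightarrow> (quad_step H d)\<^sup>*\<^sup>* x y"
  by (induction rule: rtranclp_induct) (auto intro: rtranclp.rtrancl_into_rtrancl quad_step_mono)

text \<open>Every mixture of rows of \<open>x\<close> and \<open>y\<close> has the same counts on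
  \<open>H\<close>, so the rows are replaced one by one. In particular a cut that separates no pair
  of \<open>H\<close> may be added to a row.\<close>

lemma quad_steps_rowwise:
  assumes "\<And>k u v. k < d \<Longrightarrow> (u, v) \<in> H \<Longrightarrow> (x k u \<noteq> x k v) = (y k u \<noteq> y k v)"
  shows "(quad_step H d)\<^sup>*\<^sup>* x y"
proof -
  define z where "z n = (\<lambda>k. if k < n then y k else x k)" for n
  have same: "sep_count d w u v = sep_count d w' u v"
    if "(u, v) \<in> H" "\<And>k. w k = x k \<or> w k = y k" "\<And>k. w' k = x k \<or> w' k = y k" for w w' u v
    unfolding sep_count_def
  proof (intro sum.cong refl)
    fix k assume "k \<in> {..<d}"
    then show "(of_bool (w k u \<noteq> w k v) :: nat) = of_bool (w' k u \<noteq> w' k v)"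
      using assms[of k u v] that(1) that(2)[of k] that(3)[of k] by auto
  qed
  have zxy: "z n k = x k \<or> z n k = y k" for n k by (simp add: z_def)
  have chain: "(quad_step H d)\<^sup>*\<^sup>* x (z n)" for n
  proof (induction n)
    case 0
    show ?case by (simp add: z_def)
  next
    case (Suc n)
    have "{k. k < d \<and> z n k \<noteq> z (Suc n) k} \<subseteq> {n}" by (auto simp: z_def less_Suc_eq)
    then have "card {k. k < d \<and> z n k \<noteq> z (Suc n) k} \<le> card {n}" by (rule card_mono[rotated]) simp
    then have "quad_step H d (z n) (z (Suc n))"
      using same[OF _ zxy zxy] by (auto simp: quad_step_def)
    with Suc show ?case by simp
  qed
  \<comment> \<open>\<open>z d\<close> and \<open>y\<close> agree on the rows below \<open>d\<close>
    but perhaps not beyond; steps ignore the rows from \<open>d\<close> on.\<close>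
  have "quad_step H d (z d) y"
  proof -
    have eq: "{k. k < d \<and> z d k \<noteq> y k} = {}" by (auto simp: z_def)
    have "card {k. k < d \<and> z d k \<noteq> y k} \<le> 2" unfolding eq by simp
    moreover have "sep_count d (z d) u v = sep_count d y u v" if "(u, v) \<in> H" for u v
      by (rule same[OF that]) (simp_all add: zxy)
    ultimately show ?thesis unfolding quad_step_def by blast
  qed
  with chain[of d] show ?thesis
    by (rule rtranclp.rtrancl_into_rtrancl[of "quad_step H d" x "z d" y])
qed

section \<open>Matching of rows and transport of a column\<close>

lemma bij_betw_matching:
  assumes "finite A" "finite B" "card A = card B"
    and "card {k\<in>A. f k} = card {k\<in>B. g k}"
  obtains \<sigma> where "bij_betw \<sigma> A B" "\<And>k. k \<in> A \<Longrightarrow> g (\<sigma> k) = f k"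
proof -
  obtain \<sigma>1 where s1: "bij_betw \<sigma>1 {k\<in>A. f k} {k\<in>B. g k}"
    using assms finite_same_card_bij[of "{k\<in>A. f k}" "{k\<in>B. g k}"] by auto
  have "{k\<in>A. \<not> f k} = A - {k\<in>A. f k}" "{k\<in>B. \<not> g k} = B - {k\<in>B. g k}" by auto
  then have "card {k\<in>A. \<not> f k} = card {k\<in>B. \<not> g k}"
    using assms by (simp add: card_Diff_subset)
  then obtain \<sigma>2 where s2: "bij_betw \<sigma>2 {k\<in>A. \<not> f k} {k\<in>B. \<not> g k}"
    using assms finite_same_card_bij[of "{k\<in>A. \<not> f k}" "{k\<in>B. \<not> g k}"] by auto
  define \<sigma> where "\<sigma> k = (if f k then \<sigma>1 k else \<sigma>2 k)" for k
  have b1: "bij_betw \<sigma> {k\<in>A. f k} {k\<in>B. g k}"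
    using s1 by (rule bij_betw_cong[THEN iffD1, rotated]) (simp add: \<sigma>_def)
  have b2: "bij_betw \<sigma> {k\<in>A. \<not> f k} {k\<in>B. \<not> g k}"
    using s2 by (rule bij_betw_cong[THEN iffD1, rotated]) (simp add: \<sigma>_def)
  have "bij_betw \<sigma> ({k\<in>A. f k} \<union> {k\<in>A. \<not> f k}) ({k\<in>B. g k} \<union> {k\<in>B. \<not> g k})"
    using b1 b2 by (rule bij_betw_combine) auto
  moreover have "{k\<in>A. f k} \<union> {k\<in>A. \<not> f k} = A" "{k\<in>B. g k} \<union> {k\<in>B. \<not> g k} = B" by auto
  ultimately have "bij_betw \<sigma> A B" by simp
  moreover have "g (\<sigma> k) = f k" if "k \<in> A" for k
    using that b1 b2 unfolding bij_betw_def by blast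
  ultimately show thesis by (rule that)
qed

lemma sum_of_bool_card: "finite A \<Longrightarrow> (\<Sum>k\<in>A. of_bool (f k) :: nat) = card {k\<in>A. f k}"
  by (simp add: of_bool_def sum.If_cases Int_def)

text \<open>The row permutation carries the colour of \<open>v\<close> relative to \<open>p\<close>
  from \<open>x\<close> to \<open>z\<close>. The colour relative to \<open>q\<close> comes along,
  since the statuses of \<open>p, v\<close> and \<open>p, q\<close> determine that of
  \<open>q, v\<close>.\<close>

lemma transport_column:
  assumes \<tau>: "bij_betw \<tau> {..<d} {..<d}"
    and pq: "\<And>k. k < d \<Longrightarrow> (z (\<tau> k) p \<noteq> z (\<tau> k) q) = (x k p \<noteq> x k q)"
    and v: "v \<noteq> p" "v \<noteq> q"
  obtains \<beta> where "\<And>k. k < d \<Longrightarrow> (\<beta> (\<tau> k) \<noteq> z (\<tau> k) p) = (x k v \<noteq> x k p)"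
    "sep_count d (\<lambda>k. (z k)(v := \<beta> k)) p v = sep_count d x p v"
    "sep_count d (\<lambda>k. (z k)(v := \<beta> k)) q v = sep_count d x q v"
proof -
  define \<rho> where "\<rho> = the_inv_into {..<d} \<tau>"
  have \<rho>: "\<rho> (\<tau> k) = k" if "k < d" for k
    using that \<tau> by (simp add: \<rho>_def bij_betw_def the_inv_into_f_f)
  define \<beta> where "\<beta> k = ((x (\<rho> k) v \<noteq> x (\<rho> k) p) \<noteq> z k p)" for k
  have 1: "(\<beta> (\<tau> k) \<noteq> z (\<tau> k) p) = (x k v \<noteq> x k p)" if "k < d" for k
    unfolding \<beta>_def \<rho>[OF that] by blast
  have 2: "(\<beta> (\<tau> k) \<noteq> z (\<tau> k) q) = (x k v \<noteq> x k q)" if "k < d" for k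
    using 1[OF that] pq[OF that] by argo
  have re: "(\<Sum>k<d. of_bool (h k) :: nat) = (\<Sum>k<d. of_bool (h (\<tau> k)))" for h
    using sum.reindex_bij_betw[OF \<tau>, of "\<lambda>k. of_bool (h k)"] by (rule sym)
  have sep: "sep_count d (\<lambda>k. (z k)(v := \<beta> k)) w v = sep_count d x w v"
    if w: "v \<noteq> w" and eq: "\<And>k. k < d \<Longrightarrow> (\<beta> (\<tau> k) \<noteq> z (\<tau> k) w) = (x k v \<noteq> x k w)" for w
  proof -
    have "sep_count d (\<lambda>k. (z k)(v := \<beta> k)) w v = (\<Sum>k<d. of_bool (\<beta> k \<noteq> z k w))"
      unfolding sep_count_def using w by (intro sum.cong) auto
    also have "\<dots> = (\<Sum>k<d. of_bool (\<beta> (\<tau> k) \<noteq> z (\<tau> k) w))"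
      by (rule re)
    also have "\<dots> = (\<Sum>k<d. of_bool (x k v \<noteq> x k w))"
      by (intro sum.cong refl) (simp only: eq lessThan_iff)
    also have "\<dots> = sep_count d x w v"
      unfolding sep_count_def by (intro sum.cong) auto
    finally show ?thesis .
  qed
  show thesis
    by (rule that[OF 1 sep[OF v(1) 1] sep[OF v(2) 2]])
qed

text \<open>Lets the new vertex follow a step on the old ones. On unchanged rows the column is
  copied. Among the changed rows, equally many separate \<open>p, q\<close> before and after, so
  these rows can be matched with each other and no further row changes.\<close>

lemma lift_column:
  assumes "sep_count d x p q = sep_count d x' p q" and v: "v \<noteq> p" "v \<noteq> q"
  obtains \<beta> where "\<And>k. k < d \<Longrightarrow> x k = x' k \<Longrightarrow> \<beta> k = x k v"
    "sep_count d (\<lambda>k. (x' k)(v := \<beta> k)) p v = sep_count d x p v"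
    "sep_count d (\<lambda>k. (x' k)(v := \<beta> k)) q v = sep_count d x q v"
proof -
  define K where "K = {k. k < d \<and> x k \<noteq> x' k}"
  have split: "sum f {..<d} = sum f K + sum f ({..<d} - K)" for f :: "nat \<Rightarrow> nat"
    by (subst sum.subset_diff[of K "{..<d}"]) (auto simp: K_def)
  have "(\<Sum>k\<in>{..<d} - K. of_bool (x k p \<noteq> x k q) :: nat)
      = (\<Sum>k\<in>{..<d} - K. of_bool (x' k p \<noteq> x' k q))"
    by (intro sum.cong) (auto simp: K_def)
  then have "(\<Sum>k\<in>K. of_bool (x k p \<noteq> x k q) :: nat) = (\<Sum>k\<in>K. of_bool (x' k p \<noteq> x' k q))"
    using assms(1) unfolding sep_count_def split by simp
  then have "card {k\<in>K. x k p \<noteq> x k q} = card {k\<in>K. x' k p \<noteq> x' k q}"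
    by (subst (asm) (1 2) sum_of_bool_card) (auto simp: K_def)
  then obtain \<sigma> where \<sigma>: "bij_betw \<sigma> K K"
    "\<And>k. k \<in> K \<Longrightarrow> (x' (\<sigma> k) p \<noteq> x' (\<sigma> k) q) = (x k p \<noteq> x k q)"
    using bij_betw_matching[of K K "\<lambda>k. x k p \<noteq> x k q" "\<lambda>k. x' k p \<noteq> x' k q"]
    by (auto simp: K_def)
  define \<tau> where "\<tau> k = (if k \<in> K then \<sigma> k else k)" for k
  have "bij_betw \<tau> (K \<union> ({..<d} - K)) (K \<union> ({..<d} - K))"
  proof (rule bij_betw_combine)
    show "bij_betw \<tau> K K"
      using \<sigma>(1) by (rule bij_betw_cong[THEN iffD1, rotated]) (simp add: \<tau>_def)
    show "bij_betw \<tau> ({..<d} - K) ({..<d} - K)"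
      by (rule bij_betw_cong[THEN iffD1, of _ id]) (auto simp: \<tau>_def)
  qed auto
  moreover have "K \<union> ({..<d} - K) = {..<d}" by (auto simp: K_def)
  ultimately have \<tau>: "bij_betw \<tau> {..<d} {..<d}" by simp
  have pq: "(x' (\<tau> k) p \<noteq> x' (\<tau> k) q) = (x k p \<noteq> x k q)" if "k < d" for k
    using \<sigma>(2)[of k] that by (auto simp: \<tau>_def K_def)
  obtain \<beta> where \<beta>: "\<And>k. k < d \<Longrightarrow> (\<beta> (\<tau> k) \<noteq> x' (\<tau> k) p) = (x k v \<noteq> x k p)"
    "sep_count d (\<lambda>k. (x' k)(v := \<beta> k)) p v = sep_count d x p v"
    "sep_count d (\<lambda>k. (x' k)(v := \<beta> k)) q v = sep_count d x q v"
    by (rule transport_column[where z = x' and x = x, OF \<tau> pq v]) blast+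
  show thesis
  proof (rule that[OF _ \<beta>(2,3)])
    fix k assume "k < d" "x k = x' k"
    then show "\<beta> k = x k v" using \<beta>(1)[of k] by (auto simp: \<tau>_def K_def)
  qed
qed

lemma exists_partner:
  assumes "finite A" "card {k\<in>A. f k} = card {k\<in>A. g k}" "i \<in> A" "f i" "\<not> g i"
  obtains j where "j \<in> A" "\<not> f j" "g j"
proof (rule ccontr)
  assume "\<not> thesis"
  with that have "{k\<in>A. g k} \<subset> {k\<in>A. f k}" using assms(3-5) by blast
  then have "card {k\<in>A. g k} < card {k\<in>A. f k}" using assms(1) by (intro psubset_card_mono) auto
  with assms(2) show False by simp
qed

text \<open>With the other columns fixed, the two counts at \<open>v\<close> determine how often
  \<open>p, v\<close> is separated within the rows of each status of \<open>p, q\<close>. So every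
  row in which \<open>\<beta>\<close> has to change has a partner of the same status that has to
  change in the opposite sense, and both are corrected together.\<close>

lemma column_steps:
  fixes y :: "nat \<Rightarrow> 'v \<Rightarrow> bool"
  assumes v: "v \<notin> V" and R: "R \<subseteq> V \<times> V" and pq: "p \<in> V" "q \<in> V"
    and p: "sep_count d (\<lambda>k. (y k)(v := \<beta> k)) p v = sep_count d (\<lambda>k. (y k)(v := \<gamma> k)) p v"
    and q: "sep_count d (\<lambda>k. (y k)(v := \<beta> k)) q v = sep_count d (\<lambda>k. (y k)(v := \<gamma> k)) q v"
  shows "(quad_step (R \<union> {(p, v), (q, v), (v, v)}) d)\<^sup>*\<^sup>*
           (\<lambda>k. (y k)(v := \<beta> k)) (\<lambda>k. (y k)(v := \<gamma> k))"
  using p q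
proof (induction "card {k. k < d \<and> \<beta> k \<noteq> \<gamma> k}" arbitrary: \<beta> rule: less_induct)
  case less
  let ?R = "R \<union> {(p, v), (q, v), (v, v)}"
  let ?u = "\<lambda>\<beta> k. (y k)(v := \<beta> k)"
  have neq: "p \<noteq> v" "q \<noteq> v" using v pq by auto
  have Rv: "a \<noteq> v" "b \<noteq> v" if "(a, b) \<in> R" for a b using that R v by auto
  show ?case
  proof (cases "\<exists>i<d. \<beta> i \<noteq> \<gamma> i")
    case False
    then show ?thesis by (intro quad_steps_rowwise) auto
  next
    case True
    then obtain i where i: "i < d" "\<beta> i \<noteq> \<gamma> i" by auto
    define A where "A = {k. k < d \<and> (y k p \<noteq> y k q) = (y i p \<noteq> y i q)}"
    define B where "B = {k. k < d \<and> (y k p \<noteq> y k q) \<noteq> (y i p \<noteq> y i q)}"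
    have fin: "finite A" "finite B" by (auto simp: A_def B_def)
    have AB: "{..<d} = A \<union> B" "A \<inter> B = {}" by (auto simp: A_def B_def)
    have split: "sum f {..<d} = sum f A + sum f B" for f :: "nat \<Rightarrow> nat"
      unfolding AB(1) using fin AB(2) by (rule sum.union_disjoint)
    define s where "s C \<beta> = (\<Sum>k\<in>C. of_bool (y k p \<noteq> \<beta> k) :: nat)" for C and \<beta> :: "nat \<Rightarrow> bool"
    define t where "t C \<beta> = (\<Sum>k\<in>C. of_bool (y k q \<noteq> \<beta> k) :: nat)" for C and \<beta> :: "nat \<Rightarrow> bool"
    have sc: "s C \<beta> + (\<Sum>k\<in>C. of_bool (y k p = \<beta> k)) = card C" if "finite C" for C \<beta>
      unfolding s_def using that by (simp flip: sum.distrib add: of_bool_def if_distrib cong: sum.cong)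
        (subst sum.cong[where h = "\<lambda>_. 1"], auto)
    \<comment> \<open>Where \<open>p\<close> and \<open>q\<close> have equal colours,
      \<open>v\<close> is separated from both or from neither; where they differ, from exactly one.
      Together with the two totals this fixes the count within each class.\<close>
    have st: "(\<forall>\<beta>. s A \<beta> = t A \<beta> \<and> s B \<beta> + t B \<beta> = card B) \<or>
        (\<forall>\<beta>. s B \<beta> = t B \<beta> \<and> s A \<beta> + t A \<beta> = card A)"
    proof (cases "y i p = y i q")
      case True
      have "s A \<beta> = t A \<beta>" for \<beta>
        unfolding s_def t_def using True by (intro sum.cong) (auto simp: A_def)
      moreover have "t B \<beta> = (\<Sum>k\<in>B. of_bool (y k p = \<beta> k))" for \<beta>
        unfolding t_def using True by (intro sum.cong) (auto simp: B_def)
      ultimately show ?thesis using sc[OF fin(2)] by simp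
    next
      case False
      have "s B \<beta> = t B \<beta>" for \<beta>
        unfolding s_def t_def using False by (intro sum.cong) (auto simp: B_def)
      moreover have "t A \<beta> = (\<Sum>k\<in>A. of_bool (y k p = \<beta> k))" for \<beta>
        unfolding t_def using False by (intro sum.cong) (auto simp: A_def)
      ultimately show ?thesis using sc[OF fin(1)] by simp
    qed
    have "s A \<beta> = s A \<gamma>"
      if "s A \<beta> + s B \<beta> = s A \<gamma> + s B \<gamma>" "t A \<beta> + t B \<beta> = t A \<gamma> + t B \<gamma>"
      using st
    proof
      assume *: "\<forall>\<beta>. s A \<beta> = t A \<beta> \<and> s B \<beta> + t B \<beta> = card B"
      from *[rule_format, of \<beta>] *[rule_format, of \<gamma>] that show ?thesis by linarith
    next
      assume *: "\<forall>\<beta>. s B \<beta> = t B \<beta> \<and> s A \<beta> + t A \<beta> = card A"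
      from *[rule_format, of \<beta>] *[rule_format, of \<gamma>] that show ?thesis by linarith
    qed
    moreover have "s A \<beta> + s B \<beta> = s A \<gamma> + s B \<gamma>" "t A \<beta> + t B \<beta> = t A \<gamma> + t B \<gamma>"
      using less.prems neq unfolding sep_count_def s_def t_def split by simp_all
    ultimately have "s A \<beta> = s A \<gamma>" by blast
    then have eq: "card {k\<in>A. y k p \<noteq> \<beta> k} = card {k\<in>A. y k p \<noteq> \<gamma> k}"
      unfolding s_def sum_of_bool_card[OF fin(1)] .
    have iA: "i \<in> A" using i by (simp add: A_def)
    obtain j where j: "j \<in> A" "\<beta> j \<noteq> \<gamma> j" "(y j p \<noteq> \<beta> j) \<noteq> (y i p \<noteq> \<beta> i)"
    proof (cases "y i p \<noteq> \<beta> i")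
      case True
      then show ?thesis
        using exists_partner[OF fin(1) eq iA] i that by (metis (full_types))
    next
      case False
      then show ?thesis
        using exists_partner[OF fin(1) eq[symmetric] iA] i that by (metis (full_types))
    qed
    have ij: "i \<noteq> j" "j < d" using j by (auto simp: A_def)
    \<comment> \<open>The status of \<open>p, v\<close> differs between rows \<open>i\<close> and
      \<open>j\<close> and flips in both, so its count is kept; as the two rows lie in the same
      class, the same holds for \<open>q, v\<close>.\<close>
    define \<beta>' where "\<beta>' = \<beta>(i := \<gamma> i, j := \<gamma> j)"
    have split2: "sum f {..<d} = f i + f j + sum f ({..<d} - {i, j})" for f :: "nat \<Rightarrow> nat"
      using i ij sum.subset_diff[of "{i, j}" "{..<d}" f] by simp
    have rest: "(\<Sum>k\<in>{..<d} - {i, j}. of_bool (y k w \<noteq> \<beta> k) :: nat)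
        = (\<Sum>k\<in>{..<d} - {i, j}. of_bool (y k w \<noteq> \<beta>' k))" for w
      by (intro sum.cong) (auto simp: \<beta>'_def)
    have p': "sep_count d (?u \<beta>') p v = sep_count d (?u \<beta>) p v"
      using neq rest[of p] i ij j unfolding sep_count_def split2 by (auto simp: \<beta>'_def)
    have q': "sep_count d (?u \<beta>') q v = sep_count d (?u \<beta>) q v"
      using neq rest[of q] i ij j unfolding sep_count_def split2 by (auto simp: \<beta>'_def A_def)
    have "{k. k < d \<and> ?u \<beta> k \<noteq> ?u \<beta>' k} \<subseteq> {i, j}" by (auto simp: \<beta>'_def)
    then have "card {k. k < d \<and> ?u \<beta> k \<noteq> ?u \<beta>' k} \<le> card {i, j}" by (rule card_mono[rotated]) simp
    then have "quad_step ?R d (?u \<beta>) (?u \<beta>')"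
      using p' q' ij unfolding quad_step_def by (auto simp: sep_count_fun_upd Rv)
    moreover have "(quad_step ?R d)\<^sup>*\<^sup>* (?u \<beta>') (?u \<gamma>)"
    proof (rule less.hyps)
      have "{k. k < d \<and> \<beta>' k \<noteq> \<gamma> k} \<subset> {k. k < d \<and> \<beta> k \<noteq> \<gamma> k}"
        using i by (auto simp: \<beta>'_def)
      then show "card {k. k < d \<and> \<beta>' k \<noteq> \<gamma> k} < card {k. k < d \<and> \<beta> k \<noteq> \<gamma> k}"
        by (intro psubset_card_mono) auto
    qed (use p' q' less.prems in simp_all)
    ultimately show ?thesis
      by (rule converse_rtranclp_into_rtranclp[of "quad_step ?R d" "?u \<beta>" "?u \<beta>'" "?u \<gamma>"])
  qed
qed


text \<open>The chain for the smaller 2-tree is lifted step by step, with whatever column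
  \<open>v\<close> results. The remaining discrepancy lies in column \<open>v\<close> alone and is
  removed by \<open>column_steps\<close>.\<close>

lemma two_tree_connected:
  assumes "two_tree V R" "\<And>u v. (u, v) \<in> R \<Longrightarrow> sep_count d x u v = sep_count d y u v"
  shows "(quad_step R d)\<^sup>*\<^sup>* x y"
  using assms
proof (induction arbitrary: x y rule: two_tree.induct)
  case (root r)
  show ?case by (intro quad_steps_rowwise) auto
next
  case (attach V R p q v)
  let ?R = "R \<union> {(p, v), (q, v), (v, v)}"
  let ?u = "\<lambda>x \<beta> k. (x k)(v := \<beta> k)"
  have R: "R \<subseteq> V \<times> V" using attach.hyps two_tree_subset by blast
  have Rv: "a \<noteq> v" "b \<noteq> v" if "(a, b) \<in> R" for a b using that R attach.hyps by auto
  have pq: "p \<in> V" "q \<in> V" "v \<noteq> p" "v \<noteq> q" using R attach.hyps by auto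
  have lift: "\<exists>\<gamma>. (quad_step ?R d)\<^sup>*\<^sup>* (?u w \<beta>) (?u w' \<gamma>)"
    if "(quad_step R d)\<^sup>*\<^sup>* w w'" for w w' \<beta>
    using that
  proof (induction rule: rtranclp_induct)
    case base
    show ?case by blast
  next
    case (step w' w'')
    then obtain \<gamma> where \<gamma>: "(quad_step ?R d)\<^sup>*\<^sup>* (?u w \<beta>) (?u w' \<gamma>)" by blast
    have st: "sep_count d w' a b = sep_count d w'' a b" if "(a, b) \<in> R" for a b
      using that step.hyps unfolding quad_step_def by blast
    define x1 where "x1 = ?u w' \<gamma>"
    define x2 where "x2 = ?u w'' \<gamma>"
    have R12: "sep_count d x1 a b = sep_count d x2 a b" if "(a, b) \<in> R" for a b
      using st[OF that] Rv[OF that] by (simp add: x1_def x2_def sep_count_fun_upd)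
    obtain \<delta> where \<delta>: "\<And>k. k < d \<Longrightarrow> x1 k = x2 k \<Longrightarrow> \<delta> k = x1 k v"
      "sep_count d (?u x2 \<delta>) p v = sep_count d x1 p v"
      "sep_count d (?u x2 \<delta>) q v = sep_count d x1 q v"
      using lift_column[OF R12[OF attach.hyps(2)] pq(3,4)] by blast
    have "{k. k < d \<and> x1 k \<noteq> ?u x2 \<delta> k} \<subseteq> {k. k < d \<and> w' k \<noteq> w'' k}"
    proof safe
      fix k assume k: "k < d" "x1 k \<noteq> ?u x2 \<delta> k" "w' k = w'' k"
      then have "x1 k = x2 k" by (simp add: x1_def x2_def)
      with \<delta>(1)[OF k(1)] k(2) show False by simp
    qed
    then have "card {k. k < d \<and> x1 k \<noteq> ?u x2 \<delta> k} \<le> card {k. k < d \<and> w' k \<noteq> w'' k}"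
      by (rule card_mono[rotated]) simp
    also have "\<dots> \<le> 2" using step.hyps(2) unfolding quad_step_def by blast
    finally have "card {k. k < d \<and> x1 k \<noteq> ?u x2 \<delta> k} \<le> 2" .
    then have "quad_step ?R d x1 (?u x2 \<delta>)"
      using \<delta>(2,3) R12 unfolding quad_step_def by (auto simp: sep_count_fun_upd Rv)
    moreover have "?u x2 \<delta> = ?u w'' \<delta>" by (simp add: x2_def)
    ultimately have "(quad_step ?R d)\<^sup>*\<^sup>* (?u w \<beta>) (?u w'' \<delta>)"
      using \<gamma> by (simp add: x1_def rtranclp.rtrancl_into_rtrancl[of "quad_step ?R d" "?u w \<beta>" x1])
    then show ?case by blast
  qed
  have "(quad_step R d)\<^sup>*\<^sup>* x y" using attach.IH attach.prems by blast
  from lift[OF this, of "\<lambda>k. x k v"] obtain \<gamma> where \<gamma>: "(quad_step ?R d)\<^sup>*\<^sup>* x (?u y \<gamma>)" by auto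
  have inv: "sep_count d a u w = sep_count d b u w" if "(quad_step ?R d)\<^sup>*\<^sup>* a b" "(u, w) \<in> ?R" for a b u w
    using that by (induction rule: rtranclp_induct) (auto simp: quad_step_def)
  have "(quad_step ?R d)\<^sup>*\<^sup>* (?u y \<gamma>) (?u y (\<lambda>k. y k v))"
    by (rule column_steps[OF attach.hyps(3) R pq(1,2)])
       (use inv[OF \<gamma>, of p v] inv[OF \<gamma>, of q v] attach.prems[of p v] attach.prems[of q v] in simp_all)
  with \<gamma> show ?case by simp
qed

section \<open>Subgraphs of 2-trees\<close>

text \<open>The flag lets one argument cover both directions: for \<open>False\<close> this is the
  separation number, for \<open>True\<close> its complement in \<open>d\<close>. Flipping a row of
  status \<open>\<epsilon>\<close> raises it by one.\<close>

definition off_count :: "nat \<Rightarrow> bool \<Rightarrow> (nat \<Rightarrow> 'v \<Rightarrow> bool) \<Rightarrow> 'v \<Rightarrow> 'v \<Rightarrow> nat" where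
  "off_count d \<epsilon> x u v = (\<Sum>k<d. of_bool ((x k u \<noteq> x k v) \<noteq> \<epsilon>))"

lemma off_count_False: "off_count d False x u v = sep_count d x u v"
  by (simp add: off_count_def sep_count_def)

lemma off_count_True: "off_count d True x u v + sep_count d x u v = d"
proof -
  have "off_count d True x u v + sep_count d x u v
      = (\<Sum>k<d. of_bool ((x k u \<noteq> x k v) \<noteq> True) + of_bool (x k u \<noteq> x k v))"
    unfolding off_count_def sep_count_def by (rule sum.distrib[symmetric])
  also have "\<dots> = (\<Sum>k<d. 1)" by (intro sum.cong) simp_all
  finally show ?thesis by simp
qed

lemma off_count_le: "off_count d \<epsilon> x u v \<le> d"
  using off_count_True[of d x u v] by (cases \<epsilon>) (simp_all add: off_count_False)

lemma off_count_cong: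
  "sep_count d x u v = sep_count d y u v \<Longrightarrow> off_count d \<epsilon> x u v = off_count d \<epsilon> y u v"
  using off_count_True[of d x u v] off_count_True[of d y u v]
  by (cases \<epsilon>) (simp_all add: off_count_False)

text \<open>Equal parity passes to the complements in \<open>d\<close>, so a strict inequality
  leaves room for two flips.\<close>

lemma off_count_gap:
  assumes "even (sep_count d x u v + sep_count d y u v)" "off_count d \<epsilon> x u v < off_count d \<epsilon> y u v"
  shows "off_count d \<epsilon> x u v + 2 \<le> off_count d \<epsilon> y u v"
proof -
  have "even (off_count d \<epsilon> x u v + off_count d \<epsilon> y u v)"
  proof (cases \<epsilon>)
    case True
    have "off_count d True x u v + off_count d True y u v + (sep_count d x u v + sep_count d y u v) = 2 * d"
      using off_count_True[of d x u v] off_count_True[of d y u v] by linarith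
    then have "even (off_count d True x u v + off_count d True y u v + (sep_count d x u v + sep_count d y u v))"
      by simp
    then show ?thesis using True assms(1) by simp
  qed (use assms in \<open>simp add: off_count_False\<close>)
  then have "off_count d \<epsilon> y u v \<noteq> Suc (off_count d \<epsilon> x u v)" by auto
  with assms(2) show ?thesis by simp
qed

lemma two_rows_of_off_count:
  assumes "off_count d \<epsilon> x u v + 2 \<le> d"
  obtains i j where "i < d" "j < d" "i \<noteq> j" "(x i u \<noteq> x i v) = \<epsilon>" "(x j u \<noteq> x j v) = \<epsilon>"
proof -
  define A where "A = {k. k < d \<and> (x k u \<noteq> x k v) = \<epsilon>}"
  have "off_count d \<epsilon> x u v = card {k\<in>{..<d}. (x k u \<noteq> x k v) \<noteq> \<epsilon>}"
    unfolding off_count_def by (rule sum_of_bool_card) simp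
  also have "{k\<in>{..<d}. (x k u \<noteq> x k v) \<noteq> \<epsilon>} = {..<d} - A" by (auto simp: A_def)
  also have "card ({..<d} - A) = d - card A" by (subst card_Diff_subset) (auto simp: A_def)
  finally have "card A \<ge> 2" using assms by linarith
  then obtain B where "B \<subseteq> A" "card B = 2" by (meson obtain_subset_with_card_n)
  then obtain i j where "i \<noteq> j" "i \<in> A" "j \<in> A" by (auto simp: card_2_iff)
  then show thesis unfolding A_def by (intro that[of i j]) blast+
qed

text \<open>
  The first assumption says that the triangle inequality is tight for \<open>x\<close>, so that \<open>y\<close> cannot
  exceed \<open>x\<close> on the first side only.
\<close>

lemma triangle_push:
  fixes x y :: "nat \<Rightarrow> 'v \<Rightarrow> bool"
  assumes A: "\<And>k. k < d \<Longrightarrow> (x k a1 \<noteq> x k a2) = \<alpha> \<Longrightarrow> (x k b1 \<noteq> x k b2) = \<beta>"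
    and C: "\<And>x k. (x k c1 \<noteq> x k c2) = ((x k a1 \<noteq> x k a2) \<noteq> (x (k::nat) b1 \<noteq> (x k b2 :: bool)))"
    and lt: "off_count d \<alpha> x a1 a2 < off_count d \<alpha> y a1 a2"
  shows "off_count d \<beta> x b1 b2 < off_count d \<beta> y b1 b2 \<or>
    off_count d (\<alpha> \<noteq> \<beta>) x c1 c2 < off_count d (\<alpha> \<noteq> \<beta>) y c1 c2"
proof -
  \<comment> \<open>In each row the number of sides that deviate from \<open>\<alpha>\<close>,
    \<open>\<beta>\<close> and \<open>\<alpha> \<noteq> \<beta>\<close> is even. The only pattern
    that violates the equality, a deviation on exactly the last two sides, is excluded for
    \<open>x\<close> by assumption; for \<open>y\<close> the inequality remains.\<close>
  have "off_count d \<alpha> x a1 a2 = (\<Sum>k<d. of_bool ((x k b1 \<noteq> x k b2) \<noteq> \<beta>)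
      + of_bool ((x k c1 \<noteq> x k c2) \<noteq> (\<alpha> \<noteq> \<beta>)))"
    unfolding off_count_def
  proof (rule sum.cong[OF refl])
    fix k assume "k \<in> {..<d}"
    with A[of k] C[of x k] show "(of_bool ((x k a1 \<noteq> x k a2) \<noteq> \<alpha>) :: nat)
        = of_bool ((x k b1 \<noteq> x k b2) \<noteq> \<beta>) + of_bool ((x k c1 \<noteq> x k c2) \<noteq> (\<alpha> \<noteq> \<beta>))"
      by (cases "(x k a1 \<noteq> x k a2) = \<alpha>"; cases "(x k b1 \<noteq> x k b2) = \<beta>") auto
  qed
  then have "off_count d \<alpha> x a1 a2 = off_count d \<beta> x b1 b2 + off_count d (\<alpha> \<noteq> \<beta>) x c1 c2"
    unfolding off_count_def sum.distrib .
  moreover have "off_count d \<alpha> y a1 a2 \<le> (\<Sum>k<d. of_bool ((y k b1 \<noteq> y k b2) \<noteq> \<beta>)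
      + of_bool ((y k c1 \<noteq> y k c2) \<noteq> (\<alpha> \<noteq> \<beta>)))"
    unfolding off_count_def
  proof (rule sum_mono)
    fix k
    show "(of_bool ((y k a1 \<noteq> y k a2) \<noteq> \<alpha>) :: nat)
        \<le> of_bool ((y k b1 \<noteq> y k b2) \<noteq> \<beta>) + of_bool ((y k c1 \<noteq> y k c2) \<noteq> (\<alpha> \<noteq> \<beta>))"
      using C[of y k] by (cases "(y k a1 \<noteq> y k a2) = \<alpha>"; cases "(y k b1 \<noteq> y k b2) = \<beta>") auto
  qed
  then have "off_count d \<alpha> y a1 a2 \<le> off_count d \<beta> y b1 b2 + off_count d (\<alpha> \<noteq> \<beta>) y c1 c2"
    unfolding off_count_def sum.distrib .
  ultimately show ?thesis using lt by linarith
qed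

text \<open>
  The pair \<open>u, v\<close> is kept, or it is changed in both of the rows \<open>i\<close> and \<open>j\<close>, which brings its
  separation number closer to that of the target \<open>y\<close>.
\<close>

definition approaches ::
    "nat \<Rightarrow> (nat \<Rightarrow> 'v \<Rightarrow> bool) \<Rightarrow> nat \<Rightarrow> nat \<Rightarrow> (nat \<Rightarrow> 'v \<Rightarrow> bool) \<Rightarrow> (nat \<Rightarrow> 'v \<Rightarrow> bool) \<Rightarrow> 'v \<Rightarrow> 'v \<Rightarrow> bool"
  where
  "approaches d y i j z z' u v \<longleftrightarrow> sep_count d z' u v = sep_count d z u v \<or>
     (\<exists>\<epsilon>. (z i u \<noteq> z i v) = \<epsilon> \<and> (z j u \<noteq> z j v) = \<epsilon> \<and> (z' i u \<noteq> z' i v) \<noteq> \<epsilon> \<and> (z' j u \<noteq> z' j v) \<noteq> \<epsilon> \<and>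
       off_count d \<epsilon> z u v < off_count d \<epsilon> y u v)"

lemma approaches_self: "approaches d y i j z z' v v"
  by (simp add: approaches_def)

lemma approaches_fun_upd:
  assumes "u \<noteq> v" "w \<noteq> v"
  shows "approaches d y i j (\<lambda>k. (z k)(v := \<beta> k)) (\<lambda>k. (z' k)(v := \<gamma> k)) u w = approaches d y i j z z' u w"
  using assms by (simp add: approaches_def sep_count_def off_count_def)

lemma sum_split_two:
  fixes f :: "nat \<Rightarrow> nat"
  assumes "i < d" "j < d" "i \<noteq> j"
  shows "sum f {..<d} = f i + f j + sum f ({..<d} - {i, j})"
  using assms sum.subset_diff[of "{i, j}" "{..<d}" f] by simp

lemma sep_count_two_rows:
  assumes ij: "i < d" "j < d" "i \<noteq> j" and eq: "\<And>k. k < d \<Longrightarrow> k \<noteq> i \<Longrightarrow> k \<noteq> j \<Longrightarrow> z k = z' k"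
  obtains r where
    "sep_count d z u v = of_bool (z i u \<noteq> z i v) + of_bool (z j u \<noteq> z j v) + r"
    "sep_count d z' u v = of_bool (z' i u \<noteq> z' i v) + of_bool (z' j u \<noteq> z' j v) + r"
proof -
  have "(\<Sum>k\<in>{..<d} - {i, j}. of_bool (z k u \<noteq> z k v) :: nat)
      = (\<Sum>k\<in>{..<d} - {i, j}. of_bool (z' k u \<noteq> z' k v))"
    by (intro sum.cong) (auto simp: eq)
  then show thesis
    using that unfolding sep_count_def sum_split_two[OF ij] by metis
qed


section \<open>Extending a two-row step to an attached vertex\<close>

lemma card_rows_off_count: "card {k\<in>{..<d}. x k u \<noteq> x k v} = sep_count d x u v"
  unfolding sep_count_def by (rule sum_of_bool_card[symmetric]) simp

text \<open>Here the row permutation also sends \<open>i'\<close> to \<open>i\<close> and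
  \<open>j'\<close> to \<open>j\<close>. The rows about to be changed thus receive the pattern of
  two rows of \<open>x\<close> that may be chosen at will among those with the right status of
  \<open>p, q\<close>.\<close>

lemma extend_column:
  assumes eq: "sep_count d z p q = sep_count d x p q" and v: "v \<noteq> p" "v \<noteq> q"
    and ij: "i < d" "j < d" "i \<noteq> j" and ij': "i' < d" "j' < d" "i' \<noteq> j'"
    and i: "(z i p \<noteq> z i q) = (x i' p \<noteq> x i' q)" and j: "(z j p \<noteq> z j q) = (x j' p \<noteq> x j' q)"
  obtains \<beta> where "(\<beta> i \<noteq> z i p) = (x i' v \<noteq> x i' p)" "(\<beta> j \<noteq> z j p) = (x j' v \<noteq> x j' p)"
    "sep_count d (\<lambda>k. (z k)(v := \<beta> k)) p v = sep_count d x p v"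
    "sep_count d (\<lambda>k. (z k)(v := \<beta> k)) q v = sep_count d x q v"
proof -
  let ?A = "{..<d} - {i', j'}" and ?B = "{..<d} - {i, j}"
  have "(\<Sum>k\<in>?A. of_bool (x k p \<noteq> x k q) :: nat) = (\<Sum>k\<in>?B. of_bool (z k p \<noteq> z k q))"
    using eq sum_split_two[OF ij, of "\<lambda>k. of_bool (z k p \<noteq> z k q)"]
      sum_split_two[OF ij', of "\<lambda>k. of_bool (x k p \<noteq> x k q)"]
    unfolding sep_count_def i j by linarith
  then have "card {k\<in>?A. x k p \<noteq> x k q} = card {k\<in>?B. z k p \<noteq> z k q}"
    by (subst (asm) (1 2) sum_of_bool_card) simp_all
  moreover have "card ?A = card ?B" using ij ij' by (simp add: card_Diff_subset)
  ultimately obtain \<sigma> where \<sigma>: "bij_betw \<sigma> ?A ?B"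
    "\<And>k. k \<in> ?A \<Longrightarrow> (z (\<sigma> k) p \<noteq> z (\<sigma> k) q) = (x k p \<noteq> x k q)"
    using bij_betw_matching[of ?A ?B "\<lambda>k. x k p \<noteq> x k q" "\<lambda>k. z k p \<noteq> z k q"] by blast
  define \<tau> where "\<tau> k = (if k = i' then i else if k = j' then j else \<sigma> k)" for k
  have "bij_betw \<tau> (?A \<union> {i', j'}) (?B \<union> {i, j})"
  proof (rule bij_betw_combine)
    show "bij_betw \<tau> ?A ?B"
      using \<sigma>(1) by (rule bij_betw_cong[THEN iffD1, rotated]) (simp add: \<tau>_def)
    show "bij_betw \<tau> {i', j'} {i, j}"
      using ij(3) ij'(3) by (auto simp: bij_betw_def \<tau>_def)
  qed auto
  moreover have "?A \<union> {i', j'} = {..<d}" "?B \<union> {i, j} = {..<d}" using ij ij' by auto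
  ultimately have \<tau>: "bij_betw \<tau> {..<d} {..<d}" by simp
  have pq: "(z (\<tau> k) p \<noteq> z (\<tau> k) q) = (x k p \<noteq> x k q)" if k: "k < d" for k
  proof -
    consider "k = i'" | "k = j'" | "k \<in> ?A" using k by auto
    then show ?thesis
    proof cases
      case 1
      then have "\<tau> k = i" by (simp add: \<tau>_def)
      with 1 show ?thesis using i by (simp only:)
    next
      case 2
      then have "\<tau> k = j" using ij' by (simp add: \<tau>_def)
      with 2 show ?thesis using j by (simp only:)
    next
      case 3
      then have "\<tau> k = \<sigma> k" by (simp add: \<tau>_def)
      with \<sigma>(2)[OF 3] show ?thesis by (simp only:)
    qed
  qed
  obtain \<beta> where \<beta>: "\<And>k. k < d \<Longrightarrow> (\<beta> (\<tau> k) \<noteq> z (\<tau> k) p) = (x k v \<noteq> x k p)"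
    "sep_count d (\<lambda>k. (z k)(v := \<beta> k)) p v = sep_count d x p v"
    "sep_count d (\<lambda>k. (z k)(v := \<beta> k)) q v = sep_count d x q v"
    by (rule transport_column[where z = z and x = x, OF \<tau> pq v]) blast+
  have "\<tau> i' = i" "\<tau> j' = j" using ij'(3) by (simp_all add: \<tau>_def)
  then show thesis using that[OF _ _ \<beta>(2,3)] \<beta>(1)[OF ij'(1)] \<beta>(1)[OF ij'(2)] by (simp only:)
qed

lemma approachesI_kept: "sep_count d z' u v = sep_count d z u v \<Longrightarrow> approaches d y i j z z' u v"
  by (simp add: approaches_def)

lemma approachesI_moved:
  assumes "(z i u \<noteq> z i v) = \<epsilon>" "(z j u \<noteq> z j v) = \<epsilon>" "(z' i u \<noteq> z' i v) \<noteq> \<epsilon>" "(z' j u \<noteq> z' j v) \<noteq> \<epsilon>"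
    "off_count d \<epsilon> z u v < off_count d \<epsilon> y u v"
  shows "approaches d y i j z z' u v"
  using assms unfolding approaches_def by blast

text \<open>Since \<open>p, q\<close> flips in rows \<open>i\<close> and \<open>j\<close>, exactly
  one of the two sides at \<open>v\<close> flips in each of these rows, and it can be chosen which.
  The column \<open>\<beta>\<close> places two suitable rows of \<open>x\<close> there, and
  \<open>\<gamma>\<close> decides on the flips.\<close>

lemma approach_moved_side:
  fixes x y z z' :: "nat \<Rightarrow> 'v \<Rightarrow> bool"
  assumes ij: "i < d" "j < d" "i \<noteq> j" and off: "\<And>k. k < d \<Longrightarrow> k \<noteq> i \<Longrightarrow> k \<noteq> j \<Longrightarrow> z k = z' k"
    and v: "v \<noteq> p" "v \<noteq> q"
    and zx: "sep_count d z p q = sep_count d x p q"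
    and even: "even (sep_count d x p q + sep_count d y p q)"
    and \<epsilon>: "(z i p \<noteq> z i q) = \<epsilon>" "(z j p \<noteq> z j q) = \<epsilon>" "(z' i p \<noteq> z' i q) \<noteq> \<epsilon>" "(z' j p \<noteq> z' j q) \<noteq> \<epsilon>"
    and lt: "off_count d \<epsilon> z p q < off_count d \<epsilon> y p q"
  obtains \<beta> \<gamma> where "\<And>k. k < d \<Longrightarrow> k \<noteq> i \<Longrightarrow> k \<noteq> j \<Longrightarrow> \<beta> k = \<gamma> k"
    "sep_count d (\<lambda>k. (z k)(v := \<beta> k)) p v = sep_count d x p v"
    "sep_count d (\<lambda>k. (z k)(v := \<beta> k)) q v = sep_count d x q v"
    "approaches d y i j (\<lambda>k. (z k)(v := \<beta> k)) (\<lambda>k. (z' k)(v := \<gamma> k)) p v"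
    "approaches d y i j (\<lambda>k. (z k)(v := \<beta> k)) (\<lambda>k. (z' k)(v := \<gamma> k)) q v"
proof -
  have lt: "off_count d \<epsilon> x p q < off_count d \<epsilon> y p q"
    using lt off_count_cong[OF zx, of \<epsilon>] by simp
  then have "off_count d \<epsilon> x p q + 2 \<le> d"
    using off_count_gap[OF even lt] off_count_le[of d \<epsilon> y p q] by linarith
  then obtain i1 j1 where ij1: "i1 < d" "j1 < d" "i1 \<noteq> j1" "(x i1 p \<noteq> x i1 q) = \<epsilon>" "(x j1 p \<noteq> x j1 q) = \<epsilon>"
    by (rule two_rows_of_off_count)
  let ?ext = "\<lambda>z \<beta> k. (z k)(v := \<beta> k :: bool) :: 'v \<Rightarrow> bool"
  show thesis
  proof (cases "\<exists>i' j'. i' < d \<and> j' < d \<and> (x i' p \<noteq> x i' q) = \<epsilon> \<and> (x j' p \<noteq> x j' q) = \<epsilon> \<and>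
      (x i' p \<noteq> x i' v) \<and> \<not> (x j' p \<noteq> x j' v)")
    case True
    then obtain i' j' where ij': "i' < d" "j' < d" "(x i' p \<noteq> x i' q) = \<epsilon>" "(x j' p \<noteq> x j' q) = \<epsilon>"
      "x i' p \<noteq> x i' v" "\<not> (x j' p \<noteq> x j' v)" by blast
    have "i' \<noteq> j'" using ij'(5,6) by blast
    obtain \<beta> where \<beta>: "(\<beta> i \<noteq> z i p) = (x i' v \<noteq> x i' p)" "(\<beta> j \<noteq> z j p) = (x j' v \<noteq> x j' p)"
      "sep_count d (?ext z \<beta>) p v = sep_count d x p v"
      "sep_count d (?ext z \<beta>) q v = sep_count d x q v"
      by (rule extend_column[where z = z and x = x, OF zx v ij ij'(1,2) \<open>i' \<noteq> j'\<close>])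
        (use \<epsilon>(1,2) ij'(3,4) in blast)+
    \<comment> \<open>\<open>v\<close> keeps its colour relative to \<open>p\<close>. The status of
      \<open>q, v\<close> flips in both rows, but it differs between the two rows, so its count does
      not change either.\<close>
    define \<gamma> where "\<gamma> k = (if k = i \<or> k = j then (\<beta> k \<noteq> z k p) \<noteq> z' k p else \<beta> k)" for k
    have off': "?ext z \<beta> k = ?ext z' \<gamma> k" if "k < d" "k \<noteq> i" "k \<noteq> j" for k
      using that off[OF that] by (simp add: \<gamma>_def)
    have "sep_count d (?ext z' \<gamma>) p v = sep_count d (?ext z \<beta>) p v"
      by (rule sep_count_two_rows[OF ij off', where u = p and v = v]) (use v in \<open>auto simp: \<gamma>_def\<close>)
    moreover have "sep_count d (?ext z' \<gamma>) q v = sep_count d (?ext z \<beta>) q v"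
      by (rule sep_count_two_rows[OF ij off', where u = q and v = v])
         (use v \<epsilon> \<beta>(1,2) ij'(5,6) in \<open>auto simp: \<gamma>_def\<close>)
    ultimately show thesis
      by (intro that[of \<beta> \<gamma>] \<beta>(3,4) approachesI_kept) (simp_all add: \<gamma>_def)
  next
    case False
    \<comment> \<open>Now all rows of status \<open>\<epsilon>\<close> have the same status
      \<open>b\<close> of \<open>p, v\<close>. The triangle is tight for \<open>x\<close>, so one of
      the sides at \<open>v\<close> is off in the direction in which a flip would move it.\<close>
    define b where "b = (x i1 p \<noteq> x i1 v)"
    have b: "(x k p \<noteq> x k v) = b" if "k < d" "(x k p \<noteq> x k q) = \<epsilon>" for k
      using False that ij1(1,4) unfolding b_def by blast
    have "(off_count d b x p v < off_count d b y p v) \<or>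
        (off_count d (\<epsilon> \<noteq> b) x q v < off_count d (\<epsilon> \<noteq> b) y q v)"
      by (rule triangle_push[OF b _ lt]) blast+
    then consider (p) "off_count d b x p v < off_count d b y p v"
      | (q) "off_count d (\<epsilon> \<noteq> b) x q v < off_count d (\<epsilon> \<noteq> b) y q v" by blast
    moreover obtain \<beta> where \<beta>: "(\<beta> i \<noteq> z i p) = (x i1 v \<noteq> x i1 p)" "(\<beta> j \<noteq> z j p) = (x j1 v \<noteq> x j1 p)"
      "sep_count d (?ext z \<beta>) p v = sep_count d x p v"
      "sep_count d (?ext z \<beta>) q v = sep_count d x q v"
      by (rule extend_column[where z = z and x = x, OF zx v ij ij1(1,2,3)])
        (use \<epsilon>(1,2) ij1(4,5) in blast)+
    have bij: "(\<beta> i \<noteq> z i p) = b" "(\<beta> j \<noteq> z j p) = b"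
      using \<beta>(1,2) b[OF ij1(1,4)] b[OF ij1(2,5)] by blast+
    \<comment> \<open>The flag \<open>c\<close> says that \<open>p, v\<close> flips in the two rows;
      otherwise \<open>q, v\<close> does.\<close>
    define \<gamma> where "\<gamma> c k = (if k = i \<or> k = j then (c \<noteq> b) \<noteq> z' k p else \<beta> k)" for c k
    have off': "?ext z \<beta> k = ?ext z' (\<gamma> c) k" if "k < d" "k \<noteq> i" "k \<noteq> j" for k c
      using that off[OF that] by (simp add: \<gamma>_def)
    ultimately show thesis
    proof cases
      case p
      have "approaches d y i j (?ext z \<beta>) (?ext z' (\<gamma> True)) p v"
        by (rule approachesI_moved[where \<epsilon> = b])
           (use v bij p off_count_cong[OF \<beta>(3), of b] in \<open>auto simp: \<gamma>_def off_count_def\<close>)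
      moreover have "sep_count d (?ext z' (\<gamma> True)) q v = sep_count d (?ext z \<beta>) q v"
        by (rule sep_count_two_rows[OF ij off'[of _ True], where u = q and v = v]) (use v \<epsilon> bij in \<open>auto simp: \<gamma>_def\<close>)
      ultimately show thesis
        by (intro that[of \<beta> "\<gamma> True"] \<beta>(3,4) approachesI_kept[of d _ q v]) (simp_all add: \<gamma>_def)
    next
      case q
      have "sep_count d (?ext z' (\<gamma> False)) p v = sep_count d (?ext z \<beta>) p v"
        by (rule sep_count_two_rows[OF ij off'[of _ False], where u = p and v = v]) (use v bij in \<open>auto simp: \<gamma>_def\<close>)
      moreover have "approaches d y i j (?ext z \<beta>) (?ext z' (\<gamma> False)) q v"
        by (rule approachesI_moved[where \<epsilon> = "\<epsilon> \<noteq> b"])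
           (use v bij \<epsilon> q off_count_cong[OF \<beta>(4), of "\<epsilon> \<noteq> b"] in \<open>auto simp: \<gamma>_def off_count_def\<close>)
      ultimately show thesis
        by (intro that[of \<beta> "\<gamma> False"] \<beta>(3,4) approachesI_kept[of d _ p v]) (simp_all add: \<gamma>_def)
    qed
  qed
qed


text \<open>Flipping \<open>v\<close> in two rows with the same status of \<open>p, v\<close> brings
  this pair closer. If the two rows can be chosen with different status of \<open>p, q\<close>, the
  changes of \<open>q, v\<close> cancel. Otherwise the triangle is tight, and as \<open>p, q\<close>
  already has its target count, \<open>q, v\<close> has to move in the very direction in which the
  flips move it.\<close>

lemma approach_new_side:
  fixes x y :: "nat \<Rightarrow> 'v \<Rightarrow> bool"
  assumes pq: "sep_count d x p q = sep_count d y p q" and v: "v \<noteq> p" "v \<noteq> q"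
    and ev: "even (sep_count d x p v + sep_count d y p v)"
    and ne: "sep_count d x p v \<noteq> sep_count d y p v"
  obtains \<gamma> i j where "i < d" "j < d" "i \<noteq> j" "\<And>k. k \<noteq> i \<Longrightarrow> k \<noteq> j \<Longrightarrow> \<gamma> k = x k v"
    "approaches d y i j x (\<lambda>k. (x k)(v := \<gamma> k)) p v"
    "approaches d y i j x (\<lambda>k. (x k)(v := \<gamma> k)) q v"
    "sep_count d (\<lambda>k. (x k)(v := \<gamma> k)) p v \<noteq> sep_count d x p v"
proof -
  obtain b where lt: "off_count d b x p v < off_count d b y p v"
  proof (cases "sep_count d x p v < sep_count d y p v")
    case True
    then show ?thesis using that[of False] by (simp add: off_count_False)
  next
    case False
    then show ?thesis
      using that[of True] ne off_count_True[of d x p v] off_count_True[of d y p v] by linarith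
  qed
  have "off_count d b x p v + 2 \<le> d"
    using off_count_gap[OF ev lt] off_count_le[of d b y p v] by linarith
  then obtain i1 j1 where ij1: "i1 < d" "j1 < d" "i1 \<noteq> j1" "(x i1 p \<noteq> x i1 v) = b" "(x j1 p \<noteq> x j1 v) = b"
    by (rule two_rows_of_off_count)
  let ?flip = "\<lambda>i j k. if k = i \<or> k = j then \<not> x k v else x k v"
  let ?ext = "\<lambda>\<gamma> k. (x k)(v := \<gamma> k)"
  have off: "x k = ?ext (?flip i j) k" if "k < d" "k \<noteq> i" "k \<noteq> j" for i j k
    using that by simp
  have moved: "approaches d y i j x (?ext (?flip i j)) p v \<and>
      sep_count d (?ext (?flip i j)) p v \<noteq> sep_count d x p v"
    if ij: "i < d" "j < d" "i \<noteq> j" "(x i p \<noteq> x i v) = b" "(x j p \<noteq> x j v) = b" for i j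
  proof
    show "approaches d y i j x (?ext (?flip i j)) p v"
      by (rule approachesI_moved[where \<epsilon> = b, OF ij(4,5) _ _ lt]) (use v ij in auto)
    show "sep_count d (?ext (?flip i j)) p v \<noteq> sep_count d x p v"
      by (rule sep_count_two_rows[OF ij(1-3) off[of _ i j], where u = p and v = v]) (use v ij(3-5) in auto)
  qed
  show thesis
  proof (cases "\<exists>i j. i < d \<and> j < d \<and> (x i p \<noteq> x i v) = b \<and> (x j p \<noteq> x j v) = b \<and>
      (x i p \<noteq> x i q) \<and> \<not> (x j p \<noteq> x j q)")
    case True
    then obtain i j where ij: "i < d" "j < d" "(x i p \<noteq> x i v) = b" "(x j p \<noteq> x j v) = b"
      "x i p \<noteq> x i q" "\<not> (x j p \<noteq> x j q)" by blast
    have "i \<noteq> j" using ij(5,6) by blast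
    have "sep_count d (?ext (?flip i j)) q v = sep_count d x q v"
      by (rule sep_count_two_rows[OF ij(1,2) \<open>i \<noteq> j\<close> off[of _ i j], where u = q and v = v])
        (use v ij(3-6) \<open>i \<noteq> j\<close> in auto)
    then have "approaches d y i j x (?ext (?flip i j)) q v" by (rule approachesI_kept)
    with moved[OF ij(1,2) \<open>i \<noteq> j\<close> ij(3,4)] show thesis
      by (intro that[OF ij(1,2) \<open>i \<noteq> j\<close>, of "?flip i j"]) auto
  next
    case False
    define a where "a = (x i1 p \<noteq> x i1 q)"
    have a: "(x k p \<noteq> x k q) = a" if "k < d" "(x k p \<noteq> x k v) = b" for k
      using False that ij1(1,4) unfolding a_def by blast
    have "(off_count d a x p q < off_count d a y p q) \<or>
        (off_count d (b \<noteq> a) x q v < off_count d (b \<noteq> a) y q v)"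
      by (rule triangle_push[OF a _ lt]) blast+
    then have "off_count d (b \<noteq> a) x q v < off_count d (b \<noteq> a) y q v"
      using off_count_cong[OF pq, of a] by simp
    then have "approaches d y i1 j1 x (?ext (?flip i1 j1)) q v"
      by (rule approachesI_moved[where \<epsilon> = "b \<noteq> a", rotated 4])
         (use v ij1 a[OF ij1(1,4)] a[OF ij1(2,5)] in auto)
    with moved[OF ij1] show thesis
      by (intro that[OF ij1(1-3), of "?flip i1 j1"]) auto
  qed
qed

text \<open>Demanding the approach of all pairs of \<open>R\<close>, not only of one that is off, is
  what carries the induction through the attachments: the pair to which a vertex is attached may
  have been moved, and then the inequality in \<open>approaches\<close> is the input for the next
  triangle.\<close>

lemma two_tree_approach:
  fixes x y :: "nat \<Rightarrow> 'v \<Rightarrow> bool"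
  assumes "two_tree V R" "\<And>u v. (u, v) \<in> R \<Longrightarrow> even (sep_count d x u v + sep_count d y u v)"
    and "\<exists>(u, v)\<in>R. sep_count d x u v \<noteq> sep_count d y u v"
  shows "\<exists>z z' i j. i < d \<and> j < d \<and> i \<noteq> j \<and> (\<forall>k<d. k \<noteq> i \<longrightarrow> k \<noteq> j \<longrightarrow> z k = z' k) \<and>
    (\<forall>(u, v)\<in>R. sep_count d z u v = sep_count d x u v \<and> approaches d y i j z z' u v) \<and>
    (\<exists>(u, v)\<in>R. sep_count d z' u v \<noteq> sep_count d z u v)"
  using assms
proof (induction rule: two_tree.induct)
  case (root r)
  then show ?case by simp
next
  case (attach V R p q v)
  let ?R = "R \<union> {(p, v), (q, v), (v, v)}"
  let ?u = "\<lambda>x \<beta> k. (x k)(v := \<beta> k)"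
  have R: "R \<subseteq> V \<times> V" using attach.hyps two_tree_subset by blast
  have Rv: "a \<noteq> v" "b \<noteq> v" if "(a, b) \<in> R" for a b using that R attach.hyps by auto
  have v: "v \<noteq> p" "v \<noteq> q" using R attach.hyps by auto
  have qp: "sep_count d x q p = sep_count d y q p" if "sep_count d x p q = sep_count d y p q"
    using that by (simp add: sep_count_commute)
  show ?case
  proof (cases "\<exists>(u, w)\<in>R. sep_count d x u w \<noteq> sep_count d y u w")
    case True
    have "\<exists>z z' i j. i < d \<and> j < d \<and> i \<noteq> j \<and> (\<forall>k<d. k \<noteq> i \<longrightarrow> k \<noteq> j \<longrightarrow> z k = z' k) \<and>
        (\<forall>(u, v)\<in>R. sep_count d z u v = sep_count d x u v \<and> approaches d y i j z z' u v) \<and>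
        (\<exists>(u, v)\<in>R. sep_count d z' u v \<noteq> sep_count d z u v)"
      by (rule attach.IH[OF _ True]) (rule attach.prems(1), simp)
    then obtain z z' i j where ij: "i < d" "j < d" "i \<noteq> j"
      and off': "\<forall>k<d. k \<noteq> i \<longrightarrow> k \<noteq> j \<longrightarrow> z k = z' k"
      and all: "\<forall>(u, v)\<in>R. sep_count d z u v = sep_count d x u v \<and> approaches d y i j z z' u v"
      and ch: "\<exists>(a, b)\<in>R. sep_count d z' a b \<noteq> sep_count d z a b"
      by (elim exE conjE) (rule that)
    have off: "z k = z' k" if "k < d" "k \<noteq> i" "k \<noteq> j" for k using off' that by blast
    have zx: "sep_count d z a b = sep_count d x a b"
      and app: "approaches d y i j z z' a b" if "(a, b) \<in> R" for a b
      using all that by blast+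
    \<comment> \<open>If the count of \<open>p, q\<close> is kept, column \<open>v\<close> follows
      by \<open>lift_column\<close>. Otherwise \<open>p, q\<close> flips in both rows, from a common
      status \<open>\<epsilon>\<close>.\<close>
    have "\<exists>\<beta> \<gamma>. (\<forall>k<d. k \<noteq> i \<longrightarrow> k \<noteq> j \<longrightarrow> \<beta> k = \<gamma> k) \<and>
      sep_count d (?u z \<beta>) p v = sep_count d x p v \<and> sep_count d (?u z \<beta>) q v = sep_count d x q v \<and>
      approaches d y i j (?u z \<beta>) (?u z' \<gamma>) p v \<and> approaches d y i j (?u z \<beta>) (?u z' \<gamma>) q v"
    proof (cases "sep_count d z' p q = sep_count d z p q")
      case True
      have "card {k \<in> {..<d}. x k p \<noteq> x k q} = card {k \<in> {..<d}. z k p \<noteq> z k q}"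
        unfolding card_rows_off_count using zx[OF attach.hyps(2)] by simp
      then obtain \<tau> where \<tau>: "bij_betw \<tau> {..<d} {..<d}"
        "\<And>k. k \<in> {..<d} \<Longrightarrow> (z (\<tau> k) p \<noteq> z (\<tau> k) q) = (x k p \<noteq> x k q)"
        using bij_betw_matching[of "{..<d}" "{..<d}" "\<lambda>k. x k p \<noteq> x k q" "\<lambda>k. z k p \<noteq> z k q"] by blast
      obtain \<beta> where \<beta>: "sep_count d (?u z \<beta>) p v = sep_count d x p v"
        "sep_count d (?u z \<beta>) q v = sep_count d x q v"
        by (rule transport_column[where z = z and x = x, OF \<tau>(1) _ v]) (use \<tau>(2) in blast)+
      have "sep_count d (?u z \<beta>) p q = sep_count d (?u z' \<beta>) p q"
        using True v by (simp add: sep_count_fun_upd)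
      then obtain \<gamma> where \<gamma>: "\<And>k. k < d \<Longrightarrow> ?u z \<beta> k = ?u z' \<beta> k \<Longrightarrow> \<gamma> k = ?u z \<beta> k v"
        "sep_count d (?u (?u z' \<beta>) \<gamma>) p v = sep_count d (?u z \<beta>) p v"
        "sep_count d (?u (?u z' \<beta>) \<gamma>) q v = sep_count d (?u z \<beta>) q v"
        by (rule lift_column[OF _ v, where x = "?u z \<beta>" and x' = "?u z' \<beta>"]) blast
      show ?thesis
      proof (rule exI[of _ \<beta>], rule exI[of _ \<gamma>], intro conjI allI impI \<beta>)
        fix k assume "k < d" "k \<noteq> i" "k \<noteq> j"
        then show "\<beta> k = \<gamma> k" using \<gamma>(1)[of k] off[of k] by simp
      qed (use \<gamma>(2,3) in \<open>simp_all add: approachesI_kept\<close>)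
    next
      case False
      then obtain \<epsilon> where \<epsilon>: "(z i p \<noteq> z i q) = \<epsilon>" "(z j p \<noteq> z j q) = \<epsilon>"
        "(z' i p \<noteq> z' i q) \<noteq> \<epsilon>" "(z' j p \<noteq> z' j q) \<noteq> \<epsilon>" "off_count d \<epsilon> z p q < off_count d \<epsilon> y p q"
        using app[OF attach.hyps(2)] unfolding approaches_def by blast
      have ev: "even (sep_count d x p q + sep_count d y p q)"
        using attach.hyps(2) by (intro attach.prems(1)) simp
      show ?thesis
        by (rule approach_moved_side[OF ij off v zx[OF attach.hyps(2)] ev \<epsilon>]) blast+
    qed
    then obtain \<beta> \<gamma> where \<beta>\<gamma>: "\<And>k. k < d \<Longrightarrow> k \<noteq> i \<Longrightarrow> k \<noteq> j \<Longrightarrow> \<beta> k = \<gamma> k"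
      "sep_count d (?u z \<beta>) p v = sep_count d x p v" "sep_count d (?u z \<beta>) q v = sep_count d x q v"
      "approaches d y i j (?u z \<beta>) (?u z' \<gamma>) p v" "approaches d y i j (?u z \<beta>) (?u z' \<gamma>) q v"
      by blast
    have "\<forall>k<d. k \<noteq> i \<longrightarrow> k \<noteq> j \<longrightarrow> ?u z \<beta> k = ?u z' \<gamma> k" using off \<beta>\<gamma>(1) by simp
    moreover have "\<forall>(a, b)\<in>?R. sep_count d (?u z \<beta>) a b = sep_count d x a b \<and>
        approaches d y i j (?u z \<beta>) (?u z' \<gamma>) a b"
    proof -
      have "sep_count d (?u z \<beta>) a b = sep_count d x a b \<and>
          approaches d y i j (?u z \<beta>) (?u z' \<gamma>) a b" if "(a, b) \<in> R" for a b
        using zx[OF that] app[OF that] Rv[OF that] by (simp add: sep_count_fun_upd approaches_fun_upd)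
      then show ?thesis using \<beta>\<gamma>(2-5) by (auto simp: approaches_self)
    qed
    moreover have "\<exists>(a, b)\<in>?R. sep_count d (?u z' \<gamma>) a b \<noteq> sep_count d (?u z \<beta>) a b"
    proof -
      obtain a b where ab: "(a, b) \<in> R" "sep_count d z' a b \<noteq> sep_count d z a b" using ch by blast
      then have "sep_count d (?u z' \<gamma>) a b \<noteq> sep_count d (?u z \<beta>) a b"
        using Rv[OF ab(1)] by (simp add: sep_count_fun_upd)
      then show ?thesis using ab(1) by blast
    qed
    ultimately show ?thesis
      by (rule_tac x = "?u z \<beta>" in exI, rule_tac x = "?u z' \<gamma>" in exI, rule_tac x = i in exI,
          rule_tac x = j in exI) (intro conjI ij)
  next
    case False
    have pq: "sep_count d x p q = sep_count d y p q" using False attach.hyps(2) by blast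
    \<comment> \<open>All old pairs have their target counts, so a pair at \<open>v\<close> is off.
      If it is the one with \<open>q\<close>, the roles of \<open>p\<close> and \<open>q\<close> are
      exchanged.\<close>
    have "\<exists>\<gamma> i j. i < d \<and> j < d \<and> i \<noteq> j \<and> (\<forall>k. k \<noteq> i \<longrightarrow> k \<noteq> j \<longrightarrow> \<gamma> k = x k v) \<and>
        approaches d y i j x (?u x \<gamma>) p v \<and> approaches d y i j x (?u x \<gamma>) q v \<and>
        (sep_count d (?u x \<gamma>) p v \<noteq> sep_count d x p v \<or> sep_count d (?u x \<gamma>) q v \<noteq> sep_count d x q v)"
    proof (cases "sep_count d x p v = sep_count d y p v")
      case eq: True
      then have ne: "sep_count d x q v \<noteq> sep_count d y q v" proof -
        obtain a b where ab: "(a, b) \<in> ?R" "sep_count d x a b \<noteq> sep_count d y a b"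
          using attach.prems(2) by blast
        then have "(a, b) \<notin> R" using False by blast
        with ab have "(a, b) \<in> {(p, v), (q, v), (v, v)}" by blast
        with ab(2) eq show ?thesis by (auto simp only: insert_iff empty_iff prod.inject sep_count_self)
      qed
      have ev: "even (sep_count d x q v + sep_count d y q v)" by (rule attach.prems(1)) simp
      obtain \<gamma> i j where g: "i < d" "j < d" "i \<noteq> j" "\<And>k. k \<noteq> i \<Longrightarrow> k \<noteq> j \<Longrightarrow> \<gamma> k = x k v"
        "approaches d y i j x (?u x \<gamma>) q v" "approaches d y i j x (?u x \<gamma>) p v"
        "sep_count d (?u x \<gamma>) q v \<noteq> sep_count d x q v"
        by (rule approach_new_side[OF qp[OF pq] v(2,1) ev ne]) blast
      show ?thesis
        by (rule exI[of _ \<gamma>], rule exI[of _ i], rule exI[of _ j]) (use g in blast)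
    next
      case ne: False
      have ev: "even (sep_count d x p v + sep_count d y p v)" by (rule attach.prems(1)) simp
      obtain \<gamma> i j where g: "i < d" "j < d" "i \<noteq> j" "\<And>k. k \<noteq> i \<Longrightarrow> k \<noteq> j \<Longrightarrow> \<gamma> k = x k v"
        "approaches d y i j x (?u x \<gamma>) p v" "approaches d y i j x (?u x \<gamma>) q v"
        "sep_count d (?u x \<gamma>) p v \<noteq> sep_count d x p v"
        by (rule approach_new_side[OF pq v ev ne]) blast
      show ?thesis
        by (rule exI[of _ \<gamma>], rule exI[of _ i], rule exI[of _ j]) (use g in blast)
    qed
    then obtain \<gamma> i j where *: "i < d" "j < d" "i \<noteq> j" "\<forall>k. k \<noteq> i \<longrightarrow> k \<noteq> j \<longrightarrow> \<gamma> k = x k v"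
      "approaches d y i j x (?u x \<gamma>) p v" "approaches d y i j x (?u x \<gamma>) q v"
      "sep_count d (?u x \<gamma>) p v \<noteq> sep_count d x p v \<or> sep_count d (?u x \<gamma>) q v \<noteq> sep_count d x q v"
      by (elim exE conjE) (rule that)
    have "approaches d y i j x (?u x \<gamma>) a b" if "(a, b) \<in> R" for a b
      using Rv[OF that] by (intro approachesI_kept) (simp add: sep_count_fun_upd)
    then have "\<forall>(a, b)\<in>?R. sep_count d x a b = sep_count d x a b \<and> approaches d y i j x (?u x \<gamma>) a b"
      using *(5,6) by (auto simp: approaches_self)
    moreover have "\<forall>k<d. k \<noteq> i \<longrightarrow> k \<noteq> j \<longrightarrow> x k = ?u x \<gamma> k" using *(4) by (simp add: fun_upd_idem)
    moreover have "\<exists>(a, b)\<in>?R. sep_count d (?u x \<gamma>) a b \<noteq> sep_count d x a b" using *(7) by auto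
    ultimately show ?thesis
      by (rule_tac x = x in exI, rule_tac x = "?u x \<gamma>" in exI, rule_tac x = i in exI,
          rule_tac x = j in exI) (intro conjI *(1-3))
  qed
qed


section \<open>Parities and descent towards the target matrix\<close>

text \<open>Modulo two, the separation numbers come from a function on the vertices, the column
  sums. This is why a parity defect between two matrices is described by a cut.\<close>

lemma even_sep_count:
  "even (sep_count d x u v) \<longleftrightarrow> even ((\<Sum>k<d. of_bool (x k u)) + (\<Sum>k<d. of_bool (x k v)) :: nat)"
proof -
  have "sep_count d x u v + 2 * (\<Sum>k<d. of_bool (x k u \<and> x k v))
      = (\<Sum>k<d. of_bool (x k u)) + (\<Sum>k<d. of_bool (x k v))"
    unfolding sep_count_def sum_distrib_left sum.distrib[symmetric]
    by (intro sum.cong) (auto simp: of_bool_def)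
  from arg_cong[OF this, of even] show ?thesis by simp
qed

text \<open>
  The parities of all separation numbers of \<open>x\<close> and \<open>y\<close> differ by those of one cut that separates
  no pair in \<open>H\<close>; this cut is added to the first row of \<open>x\<close>.
\<close>

lemma parity_adjustment:
  fixes x y :: "nat \<Rightarrow> 'v \<Rightarrow> bool"
  assumes H: "\<And>u v. (u, v) \<in> H \<Longrightarrow> sep_count d x u v = sep_count d y u v" and d: "0 < d"
  obtains x' where "(quad_step H d)\<^sup>*\<^sup>* x x'" "\<And>u v. even (sep_count d x' u v + sep_count d y u v)"
proof -
  let ?N = "\<lambda>x u. (\<Sum>k<d. of_bool (x k u) :: nat)"
  define C where "C u = odd (?N x u + ?N y u)" for u
  define x' where "x' = x(0 := (\<lambda>u. x 0 u \<noteq> C u))"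
  have C: "C u = C v" if "(u, v) \<in> H" for u v
    using H[OF that] even_sep_count[of d x u v] even_sep_count[of d y u v] unfolding C_def by auto
  have "(quad_step H d)\<^sup>*\<^sup>* x x'"
    by (rule quad_steps_rowwise) (use C in \<open>auto simp: x'_def\<close>)
  moreover have "even (sep_count d x' u v + sep_count d y u v)" for u v
  proof -
    have N: "?N x w = of_bool (x 0 w) + (\<Sum>k\<in>{..<d} - {0}. of_bool (x k w))" for x :: "nat \<Rightarrow> 'v \<Rightarrow> bool" and w
      using d by (intro sum.remove) auto
    have "(\<Sum>k\<in>{..<d} - {0}. of_bool (x' k w) :: nat) = (\<Sum>k\<in>{..<d} - {0}. of_bool (x k w))" for w
      by (intro sum.cong) (auto simp: x'_def)
    then have "even (?N x' w + ?N y w)" for w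
      using N[of x w] N[of x' w] by (auto simp: x'_def C_def)
    from this[of u] this[of v] show ?thesis
      using even_sep_count[of d x' u v] even_sep_count[of d y u v] by auto
  qed
  ultimately show thesis by (rule that)
qed

text \<open>A moved pair changes by exactly two towards its target, and equal parity makes the gap
  at least two, so there is no overshooting. A pair at its target cannot satisfy the strict
  inequality that a move requires.\<close>

lemma approaches_dist:
  fixes x y z z' :: "nat \<Rightarrow> 'v \<Rightarrow> bool"
  assumes app: "approaches d y i j z z' u v" and zx: "sep_count d z u v = sep_count d x u v"
    and ij: "i < d" "j < d" "i \<noteq> j" and off: "\<And>k. k < d \<Longrightarrow> k \<noteq> i \<Longrightarrow> k \<noteq> j \<Longrightarrow> z k = z' k"
    and ev: "even (sep_count d x u v + sep_count d y u v)"
  shows "even (sep_count d z' u v + sep_count d y u v)" (is ?even)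
    "\<bar>int (sep_count d z' u v) - int (sep_count d y u v)\<bar> \<le> \<bar>int (sep_count d x u v) - int (sep_count d y u v)\<bar>"
      (is ?le)
    "sep_count d z' u v \<noteq> sep_count d z u v \<Longrightarrow>
      \<bar>int (sep_count d z' u v) - int (sep_count d y u v)\<bar> < \<bar>int (sep_count d x u v) - int (sep_count d y u v)\<bar>"
    "sep_count d x u v = sep_count d y u v \<Longrightarrow> sep_count d z' u v = sep_count d y u v"
proof -
  let ?D = "\<lambda>w. \<bar>int (sep_count d w u v) - int (sep_count d y u v)\<bar>"
  have *: "?even \<and> ?D z' < ?D x" if ne: "sep_count d z' u v \<noteq> sep_count d z u v"
  proof -
    from app ne obtain \<epsilon> where \<epsilon>: "(z i u \<noteq> z i v) = \<epsilon>" "(z j u \<noteq> z j v) = \<epsilon>"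
      "(z' i u \<noteq> z' i v) \<noteq> \<epsilon>" "(z' j u \<noteq> z' j v) \<noteq> \<epsilon>" "off_count d \<epsilon> z u v < off_count d \<epsilon> y u v"
      unfolding approaches_def by blast
    obtain r where r: "sep_count d z u v = of_bool (z i u \<noteq> z i v) + of_bool (z j u \<noteq> z j v) + r"
      "sep_count d z' u v = of_bool (z' i u \<noteq> z' i v) + of_bool (z' j u \<noteq> z' j v) + r"
      by (rule sep_count_two_rows[OF ij off, where u = u and v = v]) blast+
    have ev': "even (sep_count d z u v + sep_count d y u v)" using ev zx by simp
    note gap = off_count_gap[OF ev' \<epsilon>(5)]
    show ?thesis
    proof (cases \<epsilon>)
      case True
      then have "z i u \<noteq> z i v" "z j u \<noteq> z j v" "z' i u = z' i v" "z' j u = z' j v" using \<epsilon> by auto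
      then have "sep_count d z u v = sep_count d z' u v + 2" using r by simp
      moreover have "sep_count d y u v + 2 \<le> sep_count d z u v"
        using gap True off_count_True[of d z u v] off_count_True[of d y u v] by simp
      ultimately show ?thesis using zx ev by auto
    next
      case False
      then have "z i u = z i v" "z j u = z j v" "z' i u \<noteq> z' i v" "z' j u \<noteq> z' j v" using \<epsilon> by auto
      then have "sep_count d z' u v = sep_count d z u v + 2" using r by simp
      moreover have "sep_count d z u v + 2 \<le> sep_count d y u v"
        using gap False by (simp add: off_count_False)
      ultimately show ?thesis using zx ev by auto
    qed
  qed
  show ?even using * ev zx by (cases "sep_count d z' u v = sep_count d z u v") auto
  show ?le using * zx by (cases "sep_count d z' u v = sep_count d z u v") auto
  show "?D z' < ?D x" if "sep_count d z' u v \<noteq> sep_count d z u v" using * that by blast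
  show "sep_count d z' u v = sep_count d y u v" if "sep_count d x u v = sep_count d y u v"
    using * zx that by (cases "sep_count d z' u v = sep_count d z u v") auto
qed

text \<open>Descent on the total distance \<open>D\<close> over all pairs of \<open>R\<close>. One
  round rearranges \<open>w\<close> into \<open>z\<close> without changing any count on
  \<open>R\<close> and then changes two rows to reach \<open>z'\<close>; the second move respects
  \<open>H\<close> because pairs at their target stay there. At distance zero the 2-tree case
  applies.\<close>

lemma partial_two_tree_connected:
  fixes x y :: "nat \<Rightarrow> 'v \<Rightarrow> bool"
  assumes R: "two_tree V R" and HR: "H \<subseteq> R"
    and H: "\<And>u v. (u, v) \<in> H \<Longrightarrow> sep_count d x u v = sep_count d y u v"
  shows "(quad_step H d)\<^sup>*\<^sup>* x y"
proof (cases "d = 0")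
  case True
  then show ?thesis by (intro quad_steps_rowwise) simp
next
  case False
  define D where "D w = (\<Sum>(u, v)\<in>R. nat \<bar>int (sep_count d w u v) - int (sep_count d y u v)\<bar>)"
    for w :: "nat \<Rightarrow> 'v \<Rightarrow> bool"
  have inv: "sep_count d w u v = sep_count d w' u v"
    if "(quad_step H d)\<^sup>*\<^sup>* w w'" "(u, v) \<in> H" for w w' u v
    using that by (induction rule: rtranclp_induct) (auto simp: quad_step_def)
  have main: "(quad_step H d)\<^sup>*\<^sup>* w y"
    if "\<And>u v. (u, v) \<in> R \<Longrightarrow> even (sep_count d w u v + sep_count d y u v)"
      "\<And>u v. (u, v) \<in> H \<Longrightarrow> sep_count d w u v = sep_count d y u v" for w
    using that
  proof (induction "D w" arbitrary: w rule: less_induct)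
    case less
    show ?case
    proof (cases "\<exists>(u, v)\<in>R. sep_count d w u v \<noteq> sep_count d y u v")
      case False
      then have "(quad_step R d)\<^sup>*\<^sup>* w y" by (intro two_tree_connected[OF R]) blast
      then show ?thesis using HR by (rule quad_steps_mono)
    next
      case True
      have "\<exists>z z' i j. i < d \<and> j < d \<and> i \<noteq> j \<and> (\<forall>k<d. k \<noteq> i \<longrightarrow> k \<noteq> j \<longrightarrow> z k = z' k) \<and>
          (\<forall>(u, v)\<in>R. sep_count d z u v = sep_count d w u v \<and> approaches d y i j z z' u v) \<and>
          (\<exists>(u, v)\<in>R. sep_count d z' u v \<noteq> sep_count d z u v)"
        by (rule two_tree_approach[OF R _ True]) (rule less.prems(1))
      then obtain z z' i j where ij: "i < d" "j < d" "i \<noteq> j"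
        and off': "\<forall>k<d. k \<noteq> i \<longrightarrow> k \<noteq> j \<longrightarrow> z k = z' k"
        and all: "\<forall>(u, v)\<in>R. sep_count d z u v = sep_count d w u v \<and> approaches d y i j z z' u v"
        and ch: "\<exists>(a, b)\<in>R. sep_count d z' a b \<noteq> sep_count d z a b"
        by (elim exE conjE) (rule that)
      have off: "z k = z' k" if "k < d" "k \<noteq> i" "k \<noteq> j" for k using off' that by blast
      have zw: "sep_count d z a b = sep_count d w a b"
        and app: "approaches d y i j z z' a b" if "(a, b) \<in> R" for a b
        using all that by blast+
      note dist = approaches_dist[OF app zw ij off less.prems(1)]
      have "(quad_step R d)\<^sup>*\<^sup>* w z" using zw by (intro two_tree_connected[OF R]) simp
      then have wz: "(quad_step H d)\<^sup>*\<^sup>* w z" using HR by (rule quad_steps_mono)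
      have z'H: "sep_count d z' u v = sep_count d y u v" if "(u, v) \<in> H" for u v
        using dist(4)[of u v] that HR less.prems(2)[OF that] by blast
      have "{k. k < d \<and> z k \<noteq> z' k} \<subseteq> {i, j}" using off by blast
      then have "card {k. k < d \<and> z k \<noteq> z' k} \<le> card {i, j}" by (rule card_mono[rotated]) simp
      then have "card {k. k < d \<and> z k \<noteq> z' k} \<le> 2" using ij by simp
      moreover have "\<forall>(u, v)\<in>H. sep_count d z u v = sep_count d z' u v"
        using z'H less.prems(2) zw HR by fastforce
      ultimately have zz': "quad_step H d z z'" unfolding quad_step_def by blast
      have "D z' < D w"
        unfolding D_def
      proof (rule sum_strict_mono_ex1)
        show "finite R" using R by (rule two_tree_finite)
        show "\<forall>a\<in>R. (case a of (u, v) \<Rightarrow> nat \<bar>int (sep_count d z' u v) - int (sep_count d y u v)\<bar>)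
            \<le> (case a of (u, v) \<Rightarrow> nat \<bar>int (sep_count d w u v) - int (sep_count d y u v)\<bar>)"
          using dist(2) by (auto intro!: nat_mono)
        obtain a b where ab: "(a, b) \<in> R" "sep_count d z' a b \<noteq> sep_count d z a b" using ch by blast
        then show "\<exists>a\<in>R. (case a of (u, v) \<Rightarrow> nat \<bar>int (sep_count d z' u v) - int (sep_count d y u v)\<bar>)
            < (case a of (u, v) \<Rightarrow> nat \<bar>int (sep_count d w u v) - int (sep_count d y u v)\<bar>)"
          using dist(3)[OF ab(1) ab(1) _ _ _ ab(1) ab(2)] by (intro bexI[of _ "(a, b)"]) simp_all
      qed
      then have "(quad_step H d)\<^sup>*\<^sup>* z' y"
        by (rule less.hyps) (use dist(1) z'H in blast)+
      then have "(quad_step H d)\<^sup>*\<^sup>* z y"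
        by (rule converse_rtranclp_into_rtranclp[of "quad_step H d" z z' y, OF zz'])
      with wz show ?thesis by (rule rtranclp_trans)
    qed
  qed
  obtain x' where x': "(quad_step H d)\<^sup>*\<^sup>* x x'" "\<And>u v. even (sep_count d x' u v + sep_count d y u v)"
    using parity_adjustment[OF H] False by blast
  have "(quad_step H d)\<^sup>*\<^sup>* x' y"
    by (rule main) (use x'(2) inv[OF x'(1)] H in simp_all)
  with x'(1) show ?thesis by (rule rtranclp_trans)
qed

section \<open>Models of the complete graph on four vertices\<close>

text \<open>Connectedness is phrased with two-colourings because it is applied to differences of cuts.\<close>

definition connected_in :: "'v set set \<Rightarrow> 'v set \<Rightarrow> bool" where
  "connected_in E A \<longleftrightarrow> (\<forall>h :: 'v \<Rightarrow> bool. (\<forall>u\<in>A. \<forall>v\<in>A. {u, v} \<in> E \<longrightarrow> h u = h v) \<longrightarrow>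
     (\<forall>u\<in>A. \<forall>v\<in>A. h u = h v))"

definition K4_model :: "'v set \<Rightarrow> 'v set set \<Rightarrow> (nat \<Rightarrow> 'v set) \<Rightarrow> bool" where
  "K4_model V E B \<longleftrightarrow> (\<forall>i<4. B i \<noteq> {} \<and> B i \<subseteq> V \<and> connected_in E (B i)) \<and>
     (\<forall>i<4. \<forall>j<4. i \<noteq> j \<longrightarrow> B i \<inter> B j = {} \<and> (\<exists>u\<in>B i. \<exists>v\<in>B j. {u, v} \<in> E))"

lemma connected_inI:
  assumes "\<And>h u v. (\<And>u v. u \<in> A \<Longrightarrow> v \<in> A \<Longrightarrow> {u, v} \<in> E \<Longrightarrow> h u = h v) \<Longrightarrow> u \<in> A \<Longrightarrow> v \<in> A \<Longrightarrow> h u = (h v :: bool)"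
  shows "connected_in E A"
  unfolding connected_in_def
proof (intro allI impI ballI)
  fix h :: "'a \<Rightarrow> bool" and u v
  assume *: "\<forall>u\<in>A. \<forall>v\<in>A. {u, v} \<in> E \<longrightarrow> h u = h v" and uv: "u \<in> A" "v \<in> A"
  show "h u = h v" by (rule assms[OF _ uv]) (use * in blast)
qed

lemma connected_inD:
  assumes "connected_in E A" "u \<in> A" "v \<in> A"
    and "\<And>u v. u \<in> A \<Longrightarrow> v \<in> A \<Longrightarrow> {u, v} \<in> E \<Longrightarrow> h u = (h v :: bool)"
  shows "h u = h v"
  using assms unfolding connected_in_def by blast

lemma connected_in_singleton: "connected_in E {a}"
  by (rule connected_inI) simp

lemma connected_in_mono:
  assumes "connected_in E A" "E \<subseteq> E'"
  shows "connected_in E' A"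
  by (rule connected_inI) (rule connected_inD[OF assms(1)], use assms(2) in auto)

lemma K4_model_mono:
  assumes "K4_model V E B" "V \<subseteq> V'" "E \<subseteq> E'"
  shows "K4_model V' E' B"
proof -
  have "connected_in E' (B i)" if "connected_in E (B i)" for i
    using that assms(3) by (rule connected_in_mono)
  with assms show ?thesis unfolding K4_model_def by (meson subset_trans subsetD)
qed

lemma connected_in_insert:
  assumes "connected_in E A" "a \<in> A" "{a, v} \<in> E"
  shows "connected_in E (insert v A)"
proof (rule connected_inI)
  fix h :: "'a \<Rightarrow> bool" and x y
  assume h: "\<And>u w. u \<in> insert v A \<Longrightarrow> w \<in> insert v A \<Longrightarrow> {u, w} \<in> E \<Longrightarrow> h u = h w"
    and xy: "x \<in> insert v A" "y \<in> insert v A"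
  have "h w = h a" if "w \<in> insert v A" for w
  proof (cases "w \<in> A")
    case True
    show ?thesis by (rule connected_inD[OF assms(1) True assms(2)]) (use h in auto)
  next
    case False
    with that show ?thesis using h[of a v] assms(2,3) by auto
  qed
  with xy show "h x = h y" by metis
qed

lemma connected_in_path:
  assumes "\<And>k. a \<le> k \<Longrightarrow> k < b \<Longrightarrow> {f k, f (Suc k)} \<in> E"
  shows "connected_in E (f ` {a..b})"
proof (cases "a \<le> b")
  case True
  then show ?thesis using assms
  proof (induction b rule: dec_induct)
    case base
    show ?case by (simp add: connected_in_singleton)
  next
    case (step b)
    have "f ` {a..Suc b} = insert (f (Suc b)) (f ` {a..b})"
      using step.hyps by (simp add: atLeastAtMostSuc_conv)
    with step show ?case by (auto intro!: connected_in_insert[where a = "f b"])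
  qed
next
  case False
  then show ?thesis by (auto intro: connected_inI)
qed

section \<open>Branch sets and minor operations\<close>

lemma nsets_2_iff: "e \<in> [V]\<^bsup>2\<^esup> \<longleftrightarrow> (\<exists>u v. u \<noteq> v \<and> u \<in> V \<and> v \<in> V \<and> e = {u, v})"
  unfolding nsets_def card_2_iff by auto

lemma simple_graph_edge:
  assumes "simple_graph V E" "e \<in> E"
  obtains u v where "e = {u, v}" "u \<noteq> v" "u \<in> V" "v \<in> V"
  using assms nsets_2_iff[of e V] unfolding simple_graph_def by blast

lemma simple_graph_pair: "simple_graph V E \<Longrightarrow> {u, v} \<in> E \<Longrightarrow> u \<noteq> v \<and> u \<in> V \<and> v \<in> V"
  by (erule simple_graph_edge) (auto simp: doubleton_eq_iff)

lemma minor_step_simple: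
  assumes "minor_step G G'" "simple_graph (fst G) (snd G)"
  shows "simple_graph (fst G') (snd G')"
  using assms
proof (induction rule: minor_step.induct)
  case (delete_vertex v V E)
  then show ?case unfolding simple_graph_def by (auto simp: nsets_def)
next
  case (delete_edge e E V)
  then show ?case unfolding simple_graph_def by auto
next
  case (contract_edge u v E V)
  let ?\<phi> = "\<lambda>x. if x = v then u else x"
  have s: "simple_graph V E" using contract_edge by simp
  have uv: "u \<in> V" "v \<in> V" using simple_graph_pair[OF s contract_edge(1)] by auto
  have "?\<phi> ` e \<in> [V - {v}]\<^bsup>2\<^esup>" if e: "e \<in> E - {{u, v}}" for e
  proof -
    obtain x y where xy: "e = {x, y}" "x \<noteq> y" "x \<in> V" "y \<in> V"
      using simple_graph_edge[OF s] e by blast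
    have "?\<phi> x \<noteq> ?\<phi> y" using xy e by (auto simp: insert_commute)
    moreover have "?\<phi> ` e = {?\<phi> x, ?\<phi> y}" by (simp only: xy(1) image_insert image_empty)
    moreover have "?\<phi> x \<in> V - {v}" "?\<phi> y \<in> V - {v}" using xy uv contract_edge(2) by auto
    ultimately show ?thesis unfolding nsets_2_iff by blast
  qed
  then show ?case using s unfolding simple_graph_def by auto
qed

lemma delete_vertices:
  assumes "finite X" "X \<subseteq> V"
  shows "minor_step\<^sup>*\<^sup>* (V, E) (V - X, {e \<in> E. e \<inter> X = {}})"
  using assms
proof (induction X rule: finite_induct)
  case empty
  show ?case by simp
next
  case (insert v X)
  have "minor_step (V - X, {e \<in> E. e \<inter> X = {}}) (V - X - {v}, {e \<in> {e \<in> E. e \<inter> X = {}}. v \<notin> e})"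
    using insert by (intro minor_step.delete_vertex) auto
  moreover have "V - X - {v} = V - insert v X"
    "{e \<in> {e \<in> E. e \<inter> X = {}}. v \<notin> e} = {e \<in> E. e \<inter> insert v X = {}}" by auto
  ultimately show ?case using insert by (auto intro: rtranclp.rtrancl_into_rtrancl)
qed

text \<open>Colourings of the contracted set are pulled back along the contraction map, so the
  two-colouring form of connectedness transfers directly. The contracted edge joins two vertices
  with equal pulled-back colour.\<close>

lemma connected_in_contract:
  assumes conn: "connected_in E A" and av: "a \<noteq> v" "v \<in> A \<Longrightarrow> a \<in> A"
  shows "connected_in ((\<lambda>e. (\<lambda>x. if x = v then a else x) ` e) ` (E - {{a, v}})) (A - {v})"
    (is "connected_in ?E' _")
proof (rule connected_inI)
  let ?\<phi> = "\<lambda>x. if x = v then a else x"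
  fix h :: "'a \<Rightarrow> bool" and x y
  assume h: "\<And>u w. u \<in> A - {v} \<Longrightarrow> w \<in> A - {v} \<Longrightarrow> {u, w} \<in> ?E' \<Longrightarrow> h u = h w"
    and xy: "x \<in> A - {v}" "y \<in> A - {v}"
  have "h (?\<phi> x) = h (?\<phi> y)"
  proof (rule connected_inD[OF conn, of x y "\<lambda>x. h (?\<phi> x)"])
    fix p q assume pq: "p \<in> A" "q \<in> A" "{p, q} \<in> E"
    show "h (?\<phi> p) = h (?\<phi> q)"
    proof (cases "{p, q} = {a, v}")
      case True
      then show ?thesis by (auto simp: doubleton_eq_iff)
    next
      case False
      with pq(3) have "?\<phi> ` {p, q} \<in> ?E'" by blast
      then have "{?\<phi> p, ?\<phi> q} \<in> ?E'" by (simp only: image_insert image_empty)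
      then show ?thesis by (rule h[rotated 2]) (use pq av in auto)
    qed
  qed (use xy in auto)
  then show "h x = h y" using xy by auto
qed

text \<open>As long as some branch set has two vertices, an edge inside it is contracted, which
  leaves a model on fewer vertices. Once all are singletons, deleting the other vertices leaves
  exactly the complete graph, because all six edges are present.\<close>

lemma K4_model_imp_minor:
  assumes "simple_graph V E" "K4_model V E B"
  shows "has_K4_minor V E"
  using assms
proof (induction "card V" arbitrary: V E B rule: less_induct)
  case less
  note s = less.prems(1) and m = less.prems(2)
  have fin: "finite V" using s by (simp add: simple_graph_def)
  have B: "B i \<noteq> {}" "B i \<subseteq> V" "connected_in E (B i)" if "i < 4" for i
    using m that unfolding K4_model_def by blast+
  have BB: "B i \<inter> B j = {}" "\<exists>u\<in>B i. \<exists>v\<in>B j. {u, v} \<in> E" if "i < 4" "j < 4" "i \<noteq> j" for i j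
    using m that unfolding K4_model_def by blast+
  show ?case
  proof (cases "\<exists>i<4. \<exists>a\<in>B i. \<exists>b\<in>B i. a \<noteq> b")
    case True
    then obtain i a b where i: "i < 4" "a \<in> B i" "b \<in> B i" "a \<noteq> b" by blast
    have "\<exists>v\<in>B i. v \<noteq> a \<and> {a, v} \<in> E"
    proof (rule ccontr)
      assume *: "\<not> ?thesis"
      \<comment> \<open>If \<open>a\<close> had no neighbour in \<open>B i\<close>, the colouring
        that singles out \<open>a\<close> would be constant along all edges inside
        \<open>B i\<close>.\<close>
      have "(a = a) = (b = a)"
        by (rule connected_inD[OF B(3)[OF i(1)] i(2,3), where h = "\<lambda>x. x = a"])
           (use * in \<open>auto simp: insert_commute\<close>)
      with i(4) show False by simp
    qed
    then obtain v where v: "v \<in> B i" "a \<noteq> v" "{a, v} \<in> E" by auto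
    have vnot: "v \<notin> B j" "a \<notin> B j" if "j < 4" "j \<noteq> i" for j
      using BB(1)[OF that(1) i(1) that(2)] v(1) i(2) by auto
    let ?\<phi> = "\<lambda>x. if x = v then a else x"
    let ?V' = "V - {v}" and ?E' = "(\<lambda>e. ?\<phi> ` e) ` (E - {{a, v}})"
    have step: "minor_step (V, E) (?V', ?E')" using v by (intro minor_step.contract_edge)
    have s': "simple_graph ?V' ?E'" using minor_step_simple[OF step] s by simp
    have "K4_model ?V' ?E' (\<lambda>j. B j - {v})"
      unfolding K4_model_def
    proof (intro conjI allI impI)
      fix j :: nat assume j: "j < 4"
      show "B j - {v} \<noteq> {}" using vnot[of j] j B(1)[OF j] i(2) v(2) by (cases "j = i") auto
      show "B j - {v} \<subseteq> ?V'" using B(2)[OF j] by auto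
      show "connected_in ?E' (B j - {v})"
        by (rule connected_in_contract[OF B(3)[OF j] v(2)]) (use vnot[of j] j i(2) in auto)
      fix k :: nat assume k: "k < 4" "j \<noteq> k"
      show "(B j - {v}) \<inter> (B k - {v}) = {}" using BB(1)[OF j k] by auto
      obtain p q where pq: "p \<in> B j" "q \<in> B k" "{p, q} \<in> E" using BB(2)[OF j k] by blast
      have "{p, q} \<noteq> {a, v}"
        using pq vnot[of j] vnot[of k] j k by (auto simp: doubleton_eq_iff)
      with pq(3) have "?\<phi> ` {p, q} \<in> ?E'" by blast
      then have "{?\<phi> p, ?\<phi> q} \<in> ?E'" by (simp only: image_insert image_empty)
      moreover have "?\<phi> w \<in> B l - {v}" if "w \<in> B l" "l < 4" for w l
        using that vnot[of l] i(2) v(2) by (cases "l = i") auto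
      ultimately show "\<exists>u\<in>B j - {v}. \<exists>w\<in>B k - {v}. {u, w} \<in> ?E'" using pq j k by blast
    qed
    moreover have "card ?V' < card V"
      using v(1) B(2)[OF i(1)] fin by (intro psubset_card_mono) auto
    ultimately have "has_K4_minor ?V' ?E'" using less.hyps s' by blast
    then obtain W where "card W = 4" "minor_step\<^sup>*\<^sup>* (?V', ?E') (W, [W]\<^bsup>2\<^esup>)"
      unfolding has_K4_minor_def by blast
    with converse_rtranclp_into_rtranclp[where r = minor_step, OF step] show ?thesis unfolding has_K4_minor_def by blast
  next
    case False
    define b where "b i = (SOME x. x \<in> B i)" for i
    have b: "B i = {b i}" if "i < 4" for i
    proof -
      have "b i \<in> B i" unfolding b_def using B(1)[OF that] by (simp add: some_in_eq)
      then show ?thesis using False that by blast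
    qed
    define W where "W = b ` {..<4}"
    have inj: "inj_on b {..<4}"
      using BB(1) b by (intro inj_onI) (metis Int_insert_left_if1 insert_not_empty lessThan_iff singletonI)
    then have card: "card W = 4" by (simp add: W_def card_image)
    have WV: "W \<subseteq> V" using B(2) b by (auto simp: W_def)
    have "minor_step\<^sup>*\<^sup>* (V, E) (V - (V - W), {e \<in> E. e \<inter> (V - W) = {}})"
      using fin by (intro delete_vertices) auto
    moreover have "V - (V - W) = W" using WV by auto
    moreover have "{e \<in> E. e \<inter> (V - W) = {}} = [W]\<^bsup>2\<^esup>"
    proof (intro equalityI subsetI)
      fix e assume "e \<in> {e \<in> E. e \<inter> (V - W) = {}}"
      then have e: "e \<in> E" "e \<inter> (V - W) = {}" by auto
      obtain x y where "e = {x, y}" "x \<noteq> y" "x \<in> V" "y \<in> V" using simple_graph_edge[OF s e(1)] .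
      with e(2) show "e \<in> [W]\<^bsup>2\<^esup>" unfolding nsets_2_iff by blast
    next
      fix e assume "e \<in> [W]\<^bsup>2\<^esup>"
      then obtain x y where xy: "e = {x, y}" "x \<noteq> y" "x \<in> W" "y \<in> W" unfolding nsets_2_iff by blast
      then obtain i j where ij: "i < 4" "j < 4" "x = b i" "y = b j" by (auto simp: W_def)
      then have "{x, y} \<in> E" using BB(2)[of i j] b xy by auto
      then show "e \<in> {e \<in> E. e \<inter> (V - W) = {}}" using xy by auto
    qed
    ultimately show ?thesis using card unfolding has_K4_minor_def by auto
  qed
qed

text \<open>The operations are undone one at a time. Undoing a deletion keeps the branch sets;
  undoing a contraction adds \<open>v\<close> to the branch set that contains \<open>u\<close>, if
  there is one.\<close>

lemma minor_imp_K4_model: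
  assumes "simple_graph V E" "has_K4_minor V E"
  shows "\<exists>B. K4_model V E B"
proof -
  obtain W where W: "card W = 4" "minor_step\<^sup>*\<^sup>* (V, E) (W, [W]\<^bsup>2\<^esup>)"
    using assms(2) unfolding has_K4_minor_def by blast
  have "\<exists>B. K4_model (fst G) (snd G) B"
    if "minor_step\<^sup>*\<^sup>* G (W, [W]\<^bsup>2\<^esup>)" "simple_graph (fst G) (snd G)" for G
    using that
  proof (induction rule: converse_rtranclp_induct)
    case base
    have "finite W" using W(1) card.infinite by force
    then obtain b where b: "bij_betw b {..<4::nat} W"
      using W(1) finite_same_card_bij[of "{..<4::nat}" W] by auto
    then have "K4_model W ([W]\<^bsup>2\<^esup>) (\<lambda>i. {b i})"
      unfolding K4_model_def nsets_2_iff bij_betw_def inj_on_def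
      by (auto simp: connected_in_singleton doubleton_eq_iff)
    then show ?case by auto
  next
    case (step G G')
    have "simple_graph (fst G') (snd G')" using minor_step_simple step by blast
    with step.IH obtain B where m: "K4_model (fst G') (snd G') B" by blast
    from step.hyps(1) m step.prems show ?case
    proof (induction rule: minor_step.induct)
      case (delete_vertex v V E)
      have "K4_model V E B"
        by (rule K4_model_mono[OF delete_vertex(2)[unfolded fst_conv snd_conv]]) auto
      then show ?case by auto
    next
      case (delete_edge e E V)
      have "K4_model V E B"
        by (rule K4_model_mono[OF delete_edge(2)[unfolded fst_conv snd_conv]]) auto
      then show ?case by auto
    next
      case (contract_edge u v E V)
      let ?\<phi> = "\<lambda>x. if x = v then u else x"
      let ?E' = "(\<lambda>e. ?\<phi> ` e) ` (E - {{u, v}})"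
      have s: "simple_graph V E" using contract_edge by simp
      have uv: "u \<in> V" "v \<in> V" using simple_graph_pair[OF s contract_edge(1)] by auto
      have B: "B i \<noteq> {}" "B i \<subseteq> V - {v}" "connected_in ?E' (B i)" if "i < 4" for i
        using contract_edge(3) that unfolding K4_model_def by auto
      have BB: "B i \<inter> B j = {}" "\<exists>u\<in>B i. \<exists>v\<in>B j. {u, v} \<in> ?E'" if "i < 4" "j < 4" "i \<noteq> j" for i j
        using contract_edge(3) that unfolding K4_model_def by auto
      have edge: "\<exists>p q. {p, q} \<in> E \<and> ?\<phi> p = x \<and> ?\<phi> q = y" if xyE: "{x, y} \<in> ?E'" for x y
      proof -
        obtain e where e: "e \<in> E" "{x, y} = ?\<phi> ` e" using xyE by blast
        obtain p q where pq: "e = {p, q}" using simple_graph_edge[OF s e(1)] .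
        then have "{?\<phi> p, ?\<phi> q} = {x, y}" using e(2) by (simp only: image_insert image_empty)
        then have "(?\<phi> p = x \<and> ?\<phi> q = y) \<or> (?\<phi> q = x \<and> ?\<phi> p = y)"
          unfolding doubleton_eq_iff by blast
        moreover have "{p, q} \<in> E" "{q, p} \<in> E" using e(1) pq by (auto simp: insert_commute)
        ultimately show ?thesis by blast
      qed
      define C where "C i = (if u \<in> B i then insert v (B i) else B i)" for i
      have C: "p \<in> C i" if "?\<phi> p \<in> B i" for p i
        using that by (auto simp: C_def split: if_splits)
      have "K4_model V E C"
        unfolding K4_model_def
      proof (intro conjI allI impI)
        fix i :: nat assume i: "i < 4"
        show "C i \<noteq> {}" using B(1)[OF i] by (auto simp: C_def)
        show "C i \<subseteq> V" using B(2)[OF i] uv by (auto simp: C_def)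
        show "connected_in E (C i)"
        proof (rule connected_inI)
          fix h :: "'a \<Rightarrow> bool" and x y
          assume h: "\<And>a b. a \<in> C i \<Longrightarrow> b \<in> C i \<Longrightarrow> {a, b} \<in> E \<Longrightarrow> h a = h b"
            and xy: "x \<in> C i" "y \<in> C i"
          have \<phi>: "?\<phi> w \<in> B i \<and> h (?\<phi> w) = h w" if "w \<in> C i" for w
          proof (cases "w = v")
            case True
            then have "u \<in> B i" using that B(2)[OF i] by (auto simp: C_def split: if_splits)
            then show ?thesis using h[of u v] contract_edge(1) True by (auto simp: C_def)
          next
            case False
            then show ?thesis using that by (auto simp: C_def split: if_splits)
          qed
          have "h (?\<phi> x) = h (?\<phi> y)"
          proof (rule connected_inD[OF B(3)[OF i]])
            show "?\<phi> x \<in> B i" "?\<phi> y \<in> B i" using \<phi> xy by blast+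
            fix a b assume ab: "a \<in> B i" "b \<in> B i" "{a, b} \<in> ?E'"
            obtain p q where pq: "{p, q} \<in> E" "?\<phi> p = a" "?\<phi> q = b" using edge[OF ab(3)] by blast
            have "p \<in> C i" "q \<in> C i" using C pq ab by blast+
            then show "h a = h b" using h[OF _ _ pq(1)] \<phi> pq(2,3) by metis
          qed
          then show "h x = h y" using \<phi> xy by metis
        qed
        fix j :: nat assume j: "j < 4" "i \<noteq> j"
        show "C i \<inter> C j = {}"
          using BB(1)[OF i j] B(2)[OF i] B(2)[OF j(1)] by (auto simp: C_def split: if_splits)
        obtain a b where ab: "a \<in> B i" "b \<in> B j" "{a, b} \<in> ?E'" using BB(2)[OF i j] by blast
        obtain p q where pq: "{p, q} \<in> E" "?\<phi> p = a" "?\<phi> q = b" using edge[OF ab(3)] by blast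
        have "p \<in> C i" "q \<in> C j" using C pq ab by blast+
        with pq(1) show "\<exists>u\<in>C i. \<exists>v\<in>C j. {u, v} \<in> E" by blast
      qed
      then show ?case by auto
    qed
  qed
  from this[OF W(2)] assms(1) show ?thesis by simp
qed

text \<open>An outside vertex adjacent to the model is absorbed into the branch set of its neighbour
  until none is left. Afterwards no edge joins the model to the outside, so the outside can be
  coloured without affecting edges of the model.\<close>

lemma K4_model_closed:
  assumes s: "simple_graph V E" and m: "K4_model V E B"
  shows "\<exists>B. K4_model V E B \<and> (\<forall>u v. {u, v} \<in> E \<longrightarrow> u \<in> (\<Union>i<4. B i) \<longrightarrow> v \<in> (\<Union>i<4. B i))"
  using m
proof (induction "card (V - (\<Union>i<4. B i))" arbitrary: B rule: less_induct)
  case less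
  note m = less.prems
  show ?case
  proof (cases "\<forall>u v. {u, v} \<in> E \<longrightarrow> u \<in> (\<Union>i<4. B i) \<longrightarrow> v \<in> (\<Union>i<4. B i)")
    case True
    with m show ?thesis by blast
  next
    case False
    then obtain u v i where uv: "{u, v} \<in> E" "v \<notin> (\<Union>i<4. B i)" and i: "i < 4" "u \<in> B i" by blast
    have vV: "v \<in> V" using simple_graph_pair[OF s uv(1)] by simp
    let ?B = "B(i := insert v (B i))"
    have "K4_model V E ?B"
      unfolding K4_model_def
    proof (intro conjI allI impI)
      fix j :: nat assume j: "j < 4"
      have B: "B j \<noteq> {}" "B j \<subseteq> V" "connected_in E (B j)" using m j unfolding K4_model_def by blast+
      show "?B j \<noteq> {}" "?B j \<subseteq> V" using B vV by auto
      show "connected_in E (?B j)" using B(3) connected_in_insert[OF _ i(2) uv(1)] by auto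
      fix k :: nat assume k: "k < 4" "j \<noteq> k"
      have BB: "B j \<inter> B k = {}" "\<exists>u\<in>B j. \<exists>v\<in>B k. {u, v} \<in> E"
        using m j k unfolding K4_model_def by blast+
      show "?B j \<inter> ?B k = {}" using BB(1) uv(2) j k by auto
      show "\<exists>u\<in>?B j. \<exists>v\<in>?B k. {u, v} \<in> E" using BB(2) by auto
    qed
    moreover have "card (V - (\<Union>j<4. ?B j)) < card (V - (\<Union>j<4. B j))"
    proof (rule psubset_card_mono)
      show "finite (V - (\<Union>j<4. B j))" using s by (simp add: simple_graph_def)
      have "v \<in> (\<Union>j<4. ?B j)" using i by auto
      moreover have "(\<Union>j<4. B j) \<subseteq> (\<Union>j<4. ?B j)" by auto
      ultimately show "V - (\<Union>j<4. ?B j) \<subset> V - (\<Union>j<4. B j)" using vV uv(2) by blast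
    qed
    ultimately show ?thesis using less.hyps by blast
  qed
qed


section \<open>Longest paths and minimum degree three\<close>

definition is_path :: "'v set \<Rightarrow> 'v set set \<Rightarrow> 'v list \<Rightarrow> bool" where
  "is_path V E xs \<longleftrightarrow> distinct xs \<and> set xs \<subseteq> V \<and> (\<forall>k. Suc k < length xs \<longrightarrow> {xs ! k, xs ! Suc k} \<in> E)"

text \<open>
  Among all longest paths with a chord from their first vertex choose one whose chord has minimal
  span \<open>i\<close>. Turning around the first \<open>i\<close> vertices gives another longest path, whose first vertex
  has a chord that ends beyond \<open>i\<close> as well.
\<close>

lemma min_degree_3_imp_K4_model:
  assumes s: "simple_graph V E" and ne: "V \<noteq> {}" and deg: "\<And>v. v \<in> V \<Longrightarrow> 3 \<le> card {u. {u, v} \<in> E}"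
  shows "\<exists>B. K4_model V E B"
proof -
  have fin: "finite V" using s by (simp add: simple_graph_def)
  obtain r where r: "r \<in> V" using ne by blast
  have "\<forall>ys. is_path V E ys \<longrightarrow> length ys < Suc (card V)"
    using fin by (auto simp: is_path_def less_Suc_eq_le distinct_card[symmetric] intro: card_mono)
  moreover have "is_path V E [r]" using r by (simp add: is_path_def)
  ultimately obtain xs0 where xs0: "is_path V E xs0" "\<And>ys. is_path V E ys \<Longrightarrow> length ys \<le> length xs0"
    using ex_has_greatest_nat[of "is_path V E" "[r]" length "Suc (card V)"] by blast
  define n where "n = length xs0"
  have max: "length ys \<le> n" if "is_path V E ys" for ys using xs0(2)[OF that] by (simp add: n_def)
  have n: "1 \<le> n" using max[OF \<open>is_path V E [r]\<close>] by simp
  \<comment> \<open>By maximality all neighbours of the first vertex lie on the path. Of at least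
    three neighbours at most two are excluded: the successor \<open>xs ! 1\<close>, and the vertex
    at a position \<open>j0\<close> that is to be avoided.\<close>
  have chord: "\<exists>j. 2 \<le> j \<and> j < n \<and> j \<noteq> j0 \<and> {xs ! 0, xs ! j} \<in> E"
    if xs: "is_path V E xs" "length xs = n" for xs j0
  proof -
    let ?N = "{u. {u, xs ! 0} \<in> E}"
    have x0: "xs ! 0 \<in> V" 
    proof -
      have "0 < length xs" using xs(2) n by simp
      then have "xs ! 0 \<in> set xs" by (rule nth_mem)
      then show ?thesis using xs(1) unfolding is_path_def by blast
    qed
    have "?N \<subseteq> V" using simple_graph_pair[OF s] by blast
    then have finN: "finite ?N" using fin by (rule finite_subset)
    have "card {xs ! 1, xs ! j0} \<le> 2" by (simp add: card_insert_if)
    then have "1 \<le> card (?N - {xs ! 1, xs ! j0})"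
      using diff_card_le_card_Diff[OF finite.insertI[OF finite.insertI[OF finite.emptyI]], of ?N "xs ! 1" "xs ! j0"]
        deg[OF x0] by linarith
    then have "?N - {xs ! 1, xs ! j0} \<noteq> {}" by (metis card.empty not_one_le_zero)
    then obtain u where u: "{u, xs ! 0} \<in> E" "u \<noteq> xs ! 1" "u \<noteq> xs ! j0" by blast
    have "u \<in> set xs"
    proof (rule ccontr)
      assume "u \<notin> set xs"
      then have "is_path V E (u # xs)"
        using xs(1) u(1) simple_graph_pair[OF s u(1)]
        unfolding is_path_def by (auto simp: nth_Cons split: nat.split)
      with max[of "u # xs"] xs(2) show False by simp
    qed
    then obtain j where j: "j < n" "u = xs ! j" using xs(2) by (auto simp: in_set_conv_nth)
    have "j \<noteq> 0" using simple_graph_pair[OF s u(1)] j(2) by (cases j) auto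
    moreover have "j \<noteq> 1" "j \<noteq> j0" using u j by auto
    moreover have "{xs ! 0, xs ! j} \<in> E" using u(1) j(2) by (simp add: insert_commute)
    ultimately show ?thesis using j(1) by (intro exI[of _ j]) auto
  qed
  define good where "good i \<longleftrightarrow> (\<exists>xs. is_path V E xs \<and> length xs = n \<and> 2 \<le> i \<and> i < n \<and> {xs ! 0, xs ! i} \<in> E)" for i
  have "\<exists>i. good i" using chord[OF xs0(1), of 0] xs0(1) unfolding good_def n_def by blast
  then have "good (LEAST i. good i)" by (rule LeastI_ex)
  then obtain i where i: "good i" and min: "\<And>i'. good i' \<Longrightarrow> i \<le> i'" by (metis Least_le)
  from i obtain xs where xs: "is_path V E xs" "length xs = n" "2 \<le> i" "i < n" "{xs ! 0, xs ! i} \<in> E"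
    unfolding good_def by blast
  have dist: "distinct xs" and inV: "set xs \<subseteq> V" and edge: "\<And>k. Suc k < n \<Longrightarrow> {xs ! k, xs ! Suc k} \<in> E"
    using xs(1,2) unfolding is_path_def by auto
  \<comment> \<open>The seam of \<open>w\<close> joins \<open>xs ! 0\<close> to
    \<open>xs ! i\<close>, the ends of the chosen chord; the new first vertex is
    \<open>xs ! (i - 1)\<close>.\<close>
  define w where "w = rev (take i xs) @ drop i xs"
  have wlen: "length w = n" using xs by (simp add: w_def)
  have w1: "w ! k = xs ! (i - Suc k)" if "k < i" for k
    using that xs by (simp add: w_def nth_append rev_nth)
  have w2: "w ! k = xs ! k" if "i \<le> k" "k < n" for k
    using that xs by (simp add: w_def nth_append)
  have "is_path V E w"
    unfolding is_path_def
  proof (intro conjI allI impI)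
    show "distinct w" using dist by (auto simp: w_def dest: in_set_takeD in_set_dropD set_take_disj_set_drop_if_distinct)
    show "set w \<subseteq> V" using inV by (auto simp: w_def dest: in_set_takeD in_set_dropD)
    fix k assume k: "Suc k < length w"
    consider "Suc k < i" | "Suc k = i" | "i \<le> k" by linarith
    then show "{w ! k, w ! Suc k} \<in> E"
    proof cases
      case 1
      then have "Suc (i - Suc (Suc k)) = i - Suc k" by simp
      with 1 edge[of "i - Suc (Suc k)"] xs(4) show ?thesis by (simp add: w1 insert_commute)
    next
      case 2
      with xs(4,5) show ?thesis by (simp add: w1 w2)
    next
      case 3
      with k wlen edge[of k] show ?thesis by (simp add: w2)
    qed
  qed
  then obtain l where l: "2 \<le> l" "l < n" "l \<noteq> i" "{w ! 0, w ! l} \<in> E"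
    using chord[of w i] wlen by blast
  have "i \<le> l" using min[of l] l \<open>is_path V E w\<close> wlen unfolding good_def by blast
  with l have l': "i < l" "{xs ! (i - 1), xs ! l} \<in> E" using w1[of 0] w2[of l] xs(3) by auto
  obtain j where j: "2 \<le> j" "j < n" "j \<noteq> i" "{xs ! 0, xs ! j} \<in> E"
    using chord[OF xs(1,2)] by blast
  have "i \<le> j" using min[of j] j xs(1,2) unfolding good_def by blast
  with j have j': "i < j" by simp
  define m where "m = min j l"
  define M where "M = max j l"
  have mM: "i < m" "m \<le> M" "M < n" "m \<le> j" "m \<le> l" "j \<le> M" "l \<le> M"
    using l' l j j' by (auto simp: m_def M_def)
  \<comment> \<open>The branch sets are the intervals \<open>0..i-2\<close>, \<open>i-1\<close>,
    \<open>i..m-1\<close> and \<open>m..M\<close> of the path. Three of the six adjacencies are path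
    edges; the others are the chords from \<open>0\<close> to \<open>i\<close>, from
    \<open>0\<close> to \<open>j\<close> and from \<open>i-1\<close> to \<open>l\<close>, where
    \<open>j\<close> and \<open>l\<close> both lie in the last interval.\<close>
  define a where "a k = [0, i - 1, i, m] ! k" for k
  define b where "b k = [i - 2, i - 1, m - 1, M] ! k" for k
  define B where "B k = (!) xs ` {a k..b k}" for k
  have four: "k = 0 \<or> k = 1 \<or> k = 2 \<or> k = 3" if "k < 4" for k :: nat using that by linarith
  have ab: "a k \<le> b k" "b k < n" if "k < 4" for k
    using four[OF that] mM xs(3,4) by (auto simp: a_def b_def)
  have ltab: "b k < a k'" if "k < k'" "k' < 4" for k k'
  proof -
    have "k < 4" using that by simp
    from four[OF this] four[OF that(2)] that mM xs(3,4) show ?thesis by (auto simp: a_def b_def)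
  qed
  have adj: "\<exists>u\<in>B k. \<exists>v\<in>B k'. {u, v} \<in> E" if kk: "k < k'" "k' < 4" for k k'
  proof -
    have I: "\<exists>u\<in>B k. \<exists>v\<in>B k'. {u, v} \<in> E"
      if "{xs ! p, xs ! q} \<in> E" "a k \<le> p" "p \<le> b k" "a k' \<le> q" "q \<le> b k'" for p q
      using that unfolding B_def by (intro bexI[of _ "xs ! p"] bexI[of _ "xs ! q"]) auto
    have "k < 4" using kk by simp
    then consider "k = 0" "k' = 1" | "k = 0" "k' = 2" | "k = 0" "k' = 3" | "k = 1" "k' = 2"
      | "k = 1" "k' = 3" | "k = 2" "k' = 3"
      using four[OF \<open>k < 4\<close>] four[OF kk(2)] kk(1) by auto
    then show ?thesis
    proof cases
      case 1
      have "Suc (i - 2) = i - 1" using xs(3) by simp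
      with 1 edge[of "i - 2"] xs(3,4) show ?thesis
        by (intro I[of "i - 2" "i - 1"]) (auto simp: a_def b_def)
    next
      case 2
      with xs mM show ?thesis by (intro I[of 0 i]) (auto simp: a_def b_def)
    next
      case 3
      with j mM show ?thesis by (intro I[of 0 j]) (auto simp: a_def b_def)
    next
      case 4
      have "Suc (i - 1) = i" using xs(3) by simp
      with 4 edge[of "i - 1"] xs(3,4) mM show ?thesis
        by (intro I[of "i - 1" i]) (auto simp: a_def b_def)
    next
      case 5
      with l' mM show ?thesis by (intro I[of "i - 1" l]) (auto simp: a_def b_def)
    next
      case 6
      have "Suc (m - 1) = m" using mM by simp
      with 6 edge[of "m - 1"] mM show ?thesis
        by (intro I[of "m - 1" m]) (auto simp: a_def b_def)
    qed
  qed
  have disj: "B k \<inter> B k' = {}" if "k < k'" "k' < 4" for k k'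
  proof -
    have "xs ! p \<noteq> xs ! q" if "p \<le> b k" "a k' \<le> q" "q \<le> b k'" for p q
      using that ltab[OF \<open>k < k'\<close> \<open>k' < 4\<close>] ab(2)[OF \<open>k' < 4\<close>] dist xs(2)
      by (simp add: nth_eq_iff_index_eq)
    then show ?thesis unfolding B_def by auto
  qed
  have "K4_model V E B"
    unfolding K4_model_def
  proof (intro conjI allI impI)
    fix k :: nat assume k: "k < 4"
    show "B k \<noteq> {}" using ab[OF k] by (simp add: B_def)
    have "xs ! p \<in> V" if "p \<le> b k" for p
      using nth_mem[of p xs] that ab(2)[OF k] inV xs(2) by auto
    then show "B k \<subseteq> V" by (auto simp: B_def)
    show "connected_in E (B k)"
      unfolding B_def by (rule connected_in_path) (use edge ab[OF k] in auto)
    fix k' :: nat assume k': "k' < 4" "k \<noteq> k'"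
    then have less: "k < k' \<or> k' < k" by linarith
    then show "B k \<inter> B k' = {}" using disj[of k k'] disj[of k' k] k k' by auto
    from less show "\<exists>u\<in>B k. \<exists>v\<in>B k'. {u, v} \<in> E"
    proof
      assume "k' < k"
      from adj[OF this k] obtain u v where "u \<in> B k'" "v \<in> B k" "{v, u} \<in> E"
        by (auto simp: insert_commute)
      then show ?thesis by blast
    qed (rule adj[OF _ k'(1)])
  qed
  then show ?thesis by blast
qed

text \<open>By \<open>min_degree_3_imp_K4_model\<close> there is a vertex with at most two
  neighbours. If it has two, contracting one of its edges instead of deleting it creates the edge
  between them, so that the 2-tree of the smaller graph offers a pair to attach to.\<close>

lemma K4_minor_free_imp_two_tree:
  assumes "simple_graph V E" "\<not> has_K4_minor V E" "V \<noteq> {}"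
  shows "\<exists>R. two_tree V R \<and> (\<forall>u v. {u, v} \<in> E \<longrightarrow> (u, v) \<in> R \<or> (v, u) \<in> R)"
  using assms
proof (induction "card V" arbitrary: V E rule: less_induct)
  case less
  note s = less.prems(1) and noK4 = less.prems(2)
  have fin: "finite V" using s by (simp add: simple_graph_def)
  obtain v where v: "v \<in> V" "card {u. {u, v} \<in> E} < 3"
  proof (cases "\<exists>v\<in>V. card {u. {u, v} \<in> E} < 3")
    case False
    then have "\<exists>B. K4_model V E B" by (intro min_degree_3_imp_K4_model[OF s less.prems(3)]) auto
    then show ?thesis using K4_model_imp_minor[OF s] noK4 by blast
  qed (use that in blast)
  show ?case
  proof (cases "V = {v}")
    case True
    have "{u, w} \<notin> E" for u w using simple_graph_pair[OF s, of u w] True by auto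
    moreover have "two_tree V {(v, v)}" using two_tree.root[of v] True by simp
    ultimately show ?thesis by (intro exI[of _ "{(v, v)}"]) simp
  next
    case False
    let ?N = "{u. {u, v} \<in> E}" and ?V = "V - {v}" and ?E = "{e \<in> E. v \<notin> e}"
    have N: "?N \<subseteq> ?V" using simple_graph_pair[OF s] by blast
    have ne: "?V \<noteq> {}" using False v(1) by auto
    have card: "card ?V < card V" using fin v(1) by (intro psubset_card_mono) auto
    have minor: "\<not> has_K4_minor V' E'" if "minor_step (V, E) (V', E')" for V' E'
      using noK4 converse_rtranclp_into_rtranclp[where r = minor_step, OF that] unfolding has_K4_minor_def by blast
    have *: ?thesis if N: "?N \<subseteq> {p, q}" and pq: "two_tree ?V R" "(p, q) \<in> R"
        "\<And>u w. {u, w} \<in> ?E \<Longrightarrow> (u, w) \<in> R \<or> (w, u) \<in> R" for p q R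
    proof -
      let ?R = "R \<union> {(p, v), (q, v), (v, v)}"
      have "two_tree (insert v ?V) ?R" using pq(1,2) by (intro two_tree.attach) auto
      moreover have "insert v ?V = V" using v(1) by auto
      moreover have "(u, w) \<in> ?R \<or> (w, u) \<in> ?R" if uw: "{u, w} \<in> E" for u w
      proof -
        have "{w, u} \<in> E" using uw by (simp add: insert_commute)
        then show ?thesis using uw N pq(3)[of u w] by (cases "u = v"; cases "w = v") auto
      qed
      ultimately show ?thesis by auto
    qed
    have finN: "finite ?N" using N fin by (meson finite_Diff finite_subset)
    show ?thesis
    proof (cases "\<exists>p q. p \<noteq> q \<and> ?N = {p, q}")
      case True
      then obtain p q where pq: "p \<noteq> q" "?N = {p, q}" by blast
      have pv: "{p, v} \<in> E" "p \<noteq> v" "q \<noteq> v" "p \<in> ?V" "q \<in> ?V" using pq(2) N by auto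
      let ?\<phi> = "\<lambda>x. if x = v then p else x"
      let ?E' = "(\<lambda>e. ?\<phi> ` e) ` (E - {{p, v}})"
      have step: "minor_step (V, E) (?V, ?E')" using pv by (intro minor_step.contract_edge)
      have "simple_graph ?V ?E'" using minor_step_simple[OF step] s by simp
      from less.hyps[OF card this minor[OF step] ne] obtain R where
        R: "two_tree ?V R" "\<And>u w. {u, w} \<in> ?E' \<Longrightarrow> (u, w) \<in> R \<or> (w, u) \<in> R" by blast
      have "{q, v} \<in> E - {{p, v}}" using pq by (auto simp: doubleton_eq_iff)
      then have "?\<phi> ` {q, v} \<in> ?E'" by (rule imageI)
      then have "{q, p} \<in> ?E'" using pv by (simp only: image_insert image_empty if_True if_False simp_thms)
      then consider "(q, p) \<in> R" | "(p, q) \<in> R" using R(2) by blast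
      moreover have E: "(u, w) \<in> R \<or> (w, u) \<in> R" if uw: "{u, w} \<in> ?E" for u w
      proof -
        have "?\<phi> ` {u, w} \<in> ?E'" using uw by (intro imageI) (auto simp: doubleton_eq_iff)
        moreover have "?\<phi> u = u" "?\<phi> w = w" using uw by auto
        ultimately show ?thesis using R(2) by (simp only: image_insert image_empty)
      qed
      ultimately show ?thesis
      proof cases
        case 1
        show ?thesis by (rule *[OF _ R(1) 1 E]) (use pq(2) in auto)
      next
        case 2
        show ?thesis by (rule *[OF _ R(1) 2 E]) (use pq(2) in auto)
      qed
    next
      case False
      \<comment> \<open>A vertex of degree at most one is attached to a loop \<open>(p, p)\<close>;
        if it has no neighbour, any old vertex serves as \<open>p\<close>.\<close>
      have "\<exists>p\<in>?V. ?N \<subseteq> {p, p}"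
      proof (cases "?N = {}")
        case True
        then show ?thesis using ne by auto
      next
        case nonempty: False
        then obtain p where p: "p \<in> ?N" by blast
        have "?N \<subseteq> {p}"
        proof
          fix q assume q: "q \<in> ?N"
          show "q \<in> {p}"
          proof (rule ccontr)
            assume "q \<notin> {p}"
            then have "card {p, q} = 2" by auto
            moreover have "{p, q} \<subseteq> ?N" using p q by auto
            ultimately have "{p, q} = ?N" using v(2) card_mono[OF finN, of "{p, q}"]
              by (intro card_subset_eq finN) auto
            with False \<open>q \<notin> {p}\<close> show False by auto
          qed
        qed
        then show ?thesis using p N by auto
      qed
      then obtain p where p: "p \<in> ?V" "?N \<subseteq> {p, p}" by blast
      have step: "minor_step (V, E) (?V, ?E)" using v(1) by (intro minor_step.delete_vertex)
      have "simple_graph ?V ?E" using minor_step_simple[OF step] s by simp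
      from less.hyps[OF card this minor[OF step] ne] obtain R where
        R: "two_tree ?V R" "\<And>u w. {u, w} \<in> ?E \<Longrightarrow> (u, w) \<in> R \<or> (w, u) \<in> R" by blast
      show ?thesis by (rule *[OF p(2) R(1) two_tree_refl[OF R(1) p(1)] R(2)])
    qed
  qed
qed

section \<open>Toric ideals of cuts\<close>

lemma poly_ring_simps [simp]:
  "\<zero>\<^bsub>poly_ring X\<^esub> = 0" "\<one>\<^bsub>poly_ring X\<^esub> = 1" "x \<oplus>\<^bsub>poly_ring X\<^esub> y = x + y" "x \<otimes>\<^bsub>poly_ring X\<^esub> y = x * y"
  by (simp_all add: poly_ring_def)

lemma poly_ring_carrier_iff:
  "p \<in> carrier (poly_ring X) \<longleftrightarrow> (\<forall>m\<in>Poly_Mapping.keys p. Poly_Mapping.keys m \<subseteq> X)"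
  by (simp add: poly_ring_def)

lemma single_in_poly_ring: "Poly_Mapping.keys m \<subseteq> X \<Longrightarrow> Poly_Mapping.single m c \<in> carrier (poly_ring X)"
  by (simp add: poly_ring_carrier_iff)

lemma ideal_poly_ringI:
  fixes J :: "('x, 'k::field) mpoly set"
  assumes "J \<subseteq> carrier (poly_ring X)" "0 \<in> J" "\<And>p q. p \<in> J \<Longrightarrow> q \<in> J \<Longrightarrow> p + q \<in> J"
    and mult: "\<And>p q. p \<in> J \<Longrightarrow> q \<in> carrier (poly_ring X) \<Longrightarrow> q * p \<in> J"
  shows "ideal J (poly_ring X)"
proof -
  interpret cring "poly_ring X :: ('x, 'k) mpoly ring" by (rule cring_poly_ring)
  show ?thesis
  proof (rule idealI)
    show "ring (poly_ring X :: ('x, 'k) mpoly ring)" ..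
    show "subgroup J (add_monoid (poly_ring X))"
    proof (rule add.subgroupI)
      fix p assume p: "p \<in> J"
      have "- 1 \<in> carrier (poly_ring X :: ('x, 'k) mpoly ring)"
        by (simp add: poly_ring_carrier_iff)
      from mult[OF p this] have m: "- p \<in> J" by simp
      have "\<ominus>\<^bsub>poly_ring X\<^esub> p = - p"
        by (rule minus_equality) (use p m assms(1) in auto)
      then show "\<ominus>\<^bsub>poly_ring X\<^esub> p \<in> J" using m by simp
    qed (use assms in auto)
  qed (use mult in \<open>auto simp: mult.commute\<close>)
qed

lemma ideal_poly_ringD:
  assumes "ideal J (poly_ring X)"
  shows "J \<subseteq> carrier (poly_ring X)" "0 \<in> J" "p \<in> J \<Longrightarrow> q \<in> J \<Longrightarrow> p + q \<in> J"
    "p \<in> J \<Longrightarrow> q \<in> carrier (poly_ring X) \<Longrightarrow> q * p \<in> J"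
    "p \<in> J \<Longrightarrow> q \<in> J \<Longrightarrow> p - q \<in> J"
proof -
  interpret ideal J "poly_ring X" by (rule assms)
  show "J \<subseteq> carrier (poly_ring X)" by (rule a_subset)
  show "0 \<in> J" using additive_subgroup.zero_closed[OF ideal.axioms(1)[OF assms]] by simp
  show add: "p + q \<in> J" if "p \<in> J" "q \<in> J" for p q
    using additive_subgroup.a_closed[OF ideal.axioms(1)[OF assms] that] by simp
  show mult: "q * p \<in> J" if "p \<in> J" "q \<in> carrier (poly_ring X)" for p q
    using I_l_closed[OF that] by simp
  have "- q \<in> J" if "q \<in> J"
    using mult[OF that, of "- 1"] by (simp add: poly_ring_carrier_iff)
  then show "p - q \<in> J" if "p \<in> J" "q \<in> J" using add[of p "- q"] that by simp
qed

lemma ideal_poly_ring_sum: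
  assumes "ideal J (poly_ring X)" "\<And>a. a \<in> A \<Longrightarrow> f a \<in> J"
  shows "sum f A \<in> J"
  using assms(2) ideal_poly_ringD(2,3)[OF assms(1)]
  by (induction A rule: infinite_finite_induct) auto

section \<open>Exponents and the monomial map\<close>

definition monom_degree :: "('x \<Rightarrow>\<^sub>0 nat) \<Rightarrow> nat" where
  "monom_degree m = (\<Sum>x\<in>Poly_Mapping.keys m. Poly_Mapping.lookup m x)"

lemma monom_degree_superset:
  assumes "finite A" "Poly_Mapping.keys m \<subseteq> A"
  shows "monom_degree m = (\<Sum>x\<in>A. Poly_Mapping.lookup m x)"
  unfolding monom_degree_def using assms by (intro sum.mono_neutral_left) (auto simp: in_keys_iff)

lemma keys_plus_nat: "Poly_Mapping.keys (m + n) = Poly_Mapping.keys m \<union> Poly_Mapping.keys n"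
  for m n :: "'x \<Rightarrow>\<^sub>0 nat"
  by (auto simp: in_keys_iff lookup_add)

lemma monom_degree_add: "monom_degree (m + n) = monom_degree m + monom_degree n"
proof -
  let ?A = "Poly_Mapping.keys m \<union> Poly_Mapping.keys n"
  show ?thesis
    by (simp add: monom_degree_superset[of ?A] keys_plus_nat lookup_add sum.distrib)
qed

lemma monom_degree_zero [simp]: "monom_degree 0 = 0"
  by (simp add: monom_degree_def)

lemma monom_degree_single [simp]: "monom_degree (Poly_Mapping.single x n) = n"
  by (simp add: monom_degree_def)

lemma monom_degree_sum: "monom_degree (sum f A) = (\<Sum>a\<in>A. monom_degree (f a))"
  by (induction A rule: infinite_finite_induct) (simp_all add: monom_degree_add)

lemma total_degree_le_iff:
  "total_degree p \<le> d \<longleftrightarrow> (\<forall>m\<in>Poly_Mapping.keys p. monom_degree m \<le> d)"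
  unfolding total_degree_def monom_degree_def by (subst Max_le_iff) auto

text \<open>Listing the variables with multiplicity is what turns a monomial into the rows of a
  matrix.\<close>

lemma monom_decompose:
  assumes "Poly_Mapping.keys m \<subseteq> X"
  shows "\<exists>c. (\<forall>k<monom_degree m. c k \<in> X) \<and> m = (\<Sum>k<monom_degree m. Poly_Mapping.single (c k) 1)"
  using assms
proof (induction "monom_degree m" arbitrary: m)
  case 0
  then have "m = 0" by (intro poly_mapping_eqI) (auto simp: monom_degree_def in_keys_iff)
  then show ?case by simp
next
  case (Suc d)
  then have "Poly_Mapping.keys m \<noteq> {}" by (auto simp: monom_degree_def)
  then obtain x where x: "x \<in> Poly_Mapping.keys m" by blast
  define m' where "m' = m - Poly_Mapping.single x 1"
  have m: "m = m' + Poly_Mapping.single x 1"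
    using x by (intro poly_mapping_eqI)
      (auto simp: m'_def lookup_add lookup_minus lookup_single when_def in_keys_iff)
  then have d: "d = monom_degree m'" using Suc.hyps(2) by (simp add: monom_degree_add)
  have "Poly_Mapping.keys m' \<subseteq> X" using Suc.prems m by (auto simp: keys_plus_nat)
  from Suc.hyps(1)[OF d this] obtain c where
    c: "\<forall>k<d. c k \<in> X" "m' = (\<Sum>k<d. Poly_Mapping.single (c k) 1)" unfolding d by blast
  let ?c = "c(d := x)"
  have "(\<Sum>k<Suc d. Poly_Mapping.single (?c k) 1) = (\<Sum>k<d. Poly_Mapping.single (c k) 1) + Poly_Mapping.single x (1::nat)"
    by simp
  then have "m = (\<Sum>k<Suc d. Poly_Mapping.single (?c k) 1)" using m c(2) by simp
  moreover have "\<forall>k<Suc d. ?c k \<in> X" using c(1) x Suc.prems by (auto simp: less_Suc_eq)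
  ultimately show ?case unfolding Suc.hyps(2)[symmetric] by blast
qed

definition cut_monom :: "'v set set \<Rightarrow> 'v set set \<Rightarrow> 'v edge_var \<Rightarrow>\<^sub>0 nat" where
  "cut_monom E c = (\<Sum>e\<in>{e \<in> E. edge_in_cut e c}. Poly_Mapping.single (S e) 1) +
     (\<Sum>e\<in>{e \<in> E. \<not> edge_in_cut e c}. Poly_Mapping.single (T e) 1)"

text \<open>The cut homomorphism on exponents. The inner sum is \<open>cut_monom E c\<close> taken
  \<open>Poly_Mapping.lookup m c\<close> times.\<close>

definition monom_image :: "'v set set \<Rightarrow> ('v set set \<Rightarrow>\<^sub>0 nat) \<Rightarrow> 'v edge_var \<Rightarrow>\<^sub>0 nat" where
  "monom_image E m = (\<Sum>c\<in>Poly_Mapping.keys m. \<Sum>i<Poly_Mapping.lookup m c. cut_monom E c)"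

lemma monom_image_superset:
  assumes "finite A" "Poly_Mapping.keys m \<subseteq> A"
  shows "monom_image E m = (\<Sum>c\<in>A. \<Sum>i<Poly_Mapping.lookup m c. cut_monom E c)"
  unfolding monom_image_def using assms
  by (intro sum.mono_neutral_left) (auto simp: in_keys_iff)

lemma monom_image_add: "monom_image E (m + n) = monom_image E m + monom_image E n"
proof -
  let ?A = "Poly_Mapping.keys m \<union> Poly_Mapping.keys n"
  have "(\<Sum>i<a + b. w) = (\<Sum>i<a. w) + (\<Sum>i<b. w)" for a b :: nat and w :: "'a edge_var \<Rightarrow>\<^sub>0 nat"
    by (induction b) (simp_all add: add.assoc)
  then show ?thesis
    by (simp add: monom_image_superset[of ?A] keys_plus_nat lookup_add sum.distrib)
qed

lemma monom_image_zero [simp]: "monom_image E 0 = 0"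
  by (simp add: monom_image_def)

lemma monom_image_single [simp]: "monom_image E (Poly_Mapping.single c (Suc 0)) = cut_monom E c"
  by (simp add: monom_image_def)

lemma monom_image_sum: "monom_image E (sum f A) = (\<Sum>a\<in>A. monom_image E (f a))"
  by (induction A rule: infinite_finite_induct) (simp_all add: monom_image_add)

lemma cut_map_single:
  fixes E :: "'v set set"
  shows "cut_map E (Poly_Mapping.single m a) = Poly_Mapping.single (monom_image E m) (a::'k::field)"
proof -
  have prod_single: "(\<Prod>a\<in>A. Poly_Mapping.single (g a) (1::'k)) = Poly_Mapping.single (sum g A) 1"
    for A :: "'b set" and g :: "'b \<Rightarrow> 'v edge_var \<Rightarrow>\<^sub>0 nat"
    by (induction A rule: infinite_finite_induct) (simp_all add: mult_single)
  have pow: "Poly_Mapping.single w (1::'k) ^ n = Poly_Mapping.single (\<Sum>i<n. w) 1"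
    for w :: "'v edge_var \<Rightarrow>\<^sub>0 nat" and n :: nat
    by (induction n) (simp_all add: mult_single add.commute)
  have "(\<Prod>e\<in>{e \<in> E. edge_in_cut e c}. Var (S e)) * (\<Prod>e\<in>{e \<in> E. \<not> edge_in_cut e c}. Var (T e))
      = Poly_Mapping.single (cut_monom E c) (1::'k)" for c
    unfolding Var_def prod_single by (simp add: mult_single cut_monom_def)
  then show ?thesis
    unfolding cut_map_def subst_hom_single
    by (simp add: pow prod_single Const_def mult_single monom_image_def)
qed

lemma cut_map_add: "cut_map E (p + q) = cut_map E p + cut_map E q"
  unfolding cut_map_def by (rule subst_hom_add)

lemma cut_map_mult: "cut_map E (p * q) = cut_map E p * cut_map E q"
  unfolding cut_map_def by (rule subst_hom_mult)

lemma poly_eq_sum_single: "p = (\<Sum>m\<in>Poly_Mapping.keys p. Poly_Mapping.single m (Poly_Mapping.lookup p m))"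
  by (intro poly_mapping_eqI) (simp add: lookup_sum lookup_single when_def in_keys_iff)

lemma cut_map_sum: "cut_map E (sum f A) = (\<Sum>a\<in>A. cut_map E (f a))"
  by (induction A rule: infinite_finite_induct) (simp_all add: cut_map_add, simp_all add: cut_map_def subst_hom_def)

lemma lookup_cut_map:
  "Poly_Mapping.lookup (cut_map E p) w
     = (\<Sum>m | m \<in> Poly_Mapping.keys p \<and> monom_image E m = w. Poly_Mapping.lookup p m)"
proof -
  have "cut_map E p = (\<Sum>m\<in>Poly_Mapping.keys p. Poly_Mapping.single (monom_image E m) (Poly_Mapping.lookup p m))"
    by (subst poly_eq_sum_single) (simp add: cut_map_sum cut_map_single)
  then have "Poly_Mapping.lookup (cut_map E p) w
      = (\<Sum>m\<in>Poly_Mapping.keys p. if monom_image E m = w then Poly_Mapping.lookup p m else 0)"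
    by (simp add: lookup_sum lookup_single when_def)
  also have "\<dots> = (\<Sum>m\<in>{m \<in> Poly_Mapping.keys p. monom_image E m = w}. Poly_Mapping.lookup p m)"
    by (rule sum.inter_filter[symmetric]) simp
  finally show ?thesis by simp
qed

lemma cut_ideal_iff: "p \<in> cut_ideal V E \<longleftrightarrow> p \<in> carrier (poly_ring (cuts V)) \<and> cut_map E p = 0"
  by (simp add: cut_ideal_def a_kernel_def')

lemma ideal_cut_ideal: "ideal (cut_ideal V E :: ('v set set, 'k::field) mpoly set) (poly_ring (cuts V))"
proof -
  interpret cring "poly_ring (cuts V) :: ('v set set, 'k) mpoly ring" by (rule cring_poly_ring)
  have "cut_map E 0 = (0 :: ('v edge_var, 'k) mpoly)" by (simp add: cut_map_def subst_hom_def)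
  then show ?thesis
    using a_closed m_closed zero_closed
    by (intro ideal_poly_ringI) (auto simp: cut_ideal_iff cut_map_add cut_map_mult)
qed

lemma binomial_in_cut_ideal:
  assumes "Poly_Mapping.keys m \<subseteq> cuts V" "Poly_Mapping.keys n \<subseteq> cuts V" "monom_image E m = monom_image E n"
  shows "Poly_Mapping.single m (1::'k::field) - Poly_Mapping.single n 1 \<in> cut_ideal V E"
proof -
  have "cut_map E (Poly_Mapping.single m (1::'k) - Poly_Mapping.single n 1)
      = cut_map E (Poly_Mapping.single m 1 + Poly_Mapping.single n (-1))"
    by (simp add: single_uminus)
  also have "\<dots> = 0" unfolding cut_map_add cut_map_single assms(3)
    by (simp add: single_add[symmetric])
  finally show ?thesis
    using keys_diff[of "Poly_Mapping.single m (1::'k)" "Poly_Mapping.single n 1"] assms(1,2)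
    by (auto simp: cut_ideal_iff poly_ring_carrier_iff)
qed

text \<open>The usual argument for toric ideals: each monomial of \<open>p\<close> is replaced by a
  representative \<open>\<rho> m\<close> of its fibre, at the cost of a binomial. What remains is
  zero, because the coefficients over a fibre add up to a coefficient of
  \<open>cut_map E p\<close>.\<close>

lemma cut_ideal_subset_ideal:
  fixes J :: "('v set set, 'k::field) mpoly set"
  assumes J: "ideal J (poly_ring (cuts V))"
    and bin: "\<And>m n. Poly_Mapping.keys m \<subseteq> cuts V \<Longrightarrow> Poly_Mapping.keys n \<subseteq> cuts V \<Longrightarrow>
      monom_image E m = monom_image E n \<Longrightarrow> Poly_Mapping.single m 1 - Poly_Mapping.single n 1 \<in> J"
  shows "cut_ideal V E \<subseteq> J"
proof
  fix p :: "('v set set, 'k) mpoly" assume p: "p \<in> cut_ideal V E"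
  let ?K = "Poly_Mapping.keys p" and ?W = "monom_image E"
  let ?s = "\<lambda>m a. Poly_Mapping.single m (a :: 'k)"
  let ?c = "Poly_Mapping.lookup p"
  have keys: "Poly_Mapping.keys m \<subseteq> cuts V" if "m \<in> ?K" for m
    using p that by (simp add: cut_ideal_iff poly_ring_carrier_iff)
  define \<rho> where "\<rho> m = (SOME n. n \<in> ?K \<and> ?W n = ?W m)" for m
  have \<rho>: "\<rho> m \<in> ?K \<and> ?W (\<rho> m) = ?W m" if "m \<in> ?K" for m
    unfolding \<rho>_def by (rule someI[of _ m]) (simp add: that)
  have \<rho>_eq: "\<rho> m = \<rho> n" if "?W m = ?W n" for m n unfolding \<rho>_def that ..
  have diff: "(\<Sum>m\<in>?K. ?s 0 (?c m) * (?s m 1 - ?s (\<rho> m) 1)) \<in> J"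
  proof (rule ideal_poly_ring_sum[OF J])
    fix m assume m: "m \<in> ?K"
    have "?s m 1 - ?s (\<rho> m) 1 \<in> J" using \<rho>[OF m] keys m by (intro bin) auto
    then show "?s 0 (?c m) * (?s m 1 - ?s (\<rho> m) 1) \<in> J"
      by (rule ideal_poly_ringD(4)[OF J]) (simp add: single_in_poly_ring)
  qed
  have "(\<Sum>m\<in>?K. ?s (\<rho> m) (?c m)) = (\<Sum>n\<in>\<rho> ` ?K. \<Sum>m | m \<in> ?K \<and> \<rho> m = n. ?s (\<rho> m) (?c m))"
    by (rule sum.image_gen) simp
  also have "\<dots> = (\<Sum>n\<in>\<rho> ` ?K. ?s n (\<Sum>m | m \<in> ?K \<and> \<rho> m = n. ?c m))"
  proof (intro sum.cong refl)
    fix n :: "'v set set \<Rightarrow>\<^sub>0 nat"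
    have "(\<Sum>m\<in>A. ?s n (?c m)) = ?s n (\<Sum>m\<in>A. ?c m)" for A
      by (induction A rule: infinite_finite_induct) (simp_all add: single_add)
    then show "(\<Sum>m | m \<in> ?K \<and> \<rho> m = n. ?s (\<rho> m) (?c m)) = ?s n (\<Sum>m | m \<in> ?K \<and> \<rho> m = n. ?c m)"
      by simp
  qed
  also have "\<dots> = 0"
  proof (intro sum.neutral ballI)
    fix n assume "n \<in> \<rho> ` ?K"
    then obtain m0 where m0: "m0 \<in> ?K" "n = \<rho> m0" by blast
    have "{m. m \<in> ?K \<and> \<rho> m = n} = {m. m \<in> ?K \<and> ?W m = ?W m0}"
      using \<rho> \<rho>_eq m0 by (metis (no_types, lifting))
    then have "(\<Sum>m | m \<in> ?K \<and> \<rho> m = n. ?c m) = Poly_Mapping.lookup (cut_map E p) (?W m0)"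
      by (simp add: lookup_cut_map)
    also have "\<dots> = 0" using p by (simp add: cut_ideal_iff)
    finally show "?s n (\<Sum>m | m \<in> ?K \<and> \<rho> m = n. ?c m) = 0" by simp
  qed
  finally have zero: "(\<Sum>m\<in>?K. ?s (\<rho> m) (?c m)) = 0" .
  have "p = (\<Sum>m\<in>?K. ?s m (?c m)) - (\<Sum>m\<in>?K. ?s (\<rho> m) (?c m))"
    unfolding zero using poly_eq_sum_single[of p] by simp
  also have "\<dots> = (\<Sum>m\<in>?K. ?s 0 (?c m) * (?s m 1 - ?s (\<rho> m) 1))"
    by (simp add: sum_subtractf[symmetric] right_diff_distrib mult_single)
  finally show "p \<in> J" using diff by simp
qed


lemma lookup_cut_monom:
  assumes "finite E"
  shows "Poly_Mapping.lookup (cut_monom E c) (S e) = of_bool (e \<in> E \<and> edge_in_cut e c)"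
    "Poly_Mapping.lookup (cut_monom E c) (T e) = of_bool (e \<in> E \<and> \<not> edge_in_cut e c)"
  using assms by (simp_all add: cut_monom_def lookup_add lookup_sum lookup_single when_def)

text \<open>Each cut contributes exactly one of \<open>S e\<close> and \<open>T e\<close>. So a
  single edge suffices to read off the degree from the image, and the degree and the
  \<open>S\<close>-exponents determine the \<open>T\<close>-exponents.\<close>

lemma monom_image_degree:
  assumes "finite E" "e \<in> E"
  shows "Poly_Mapping.lookup (monom_image E m) (S e) + Poly_Mapping.lookup (monom_image E m) (T e)
    = monom_degree m"
  using assms
  by (simp add: monom_image_def monom_degree_def lookup_sum lookup_cut_monom of_bool_def
      flip: sum.distrib cong: sum.cong) (auto intro!: sum.cong)

section \<open>Cuts as two-colourings, monomials as matrices\<close>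

definition row_cut :: "'v set \<Rightarrow> ('v \<Rightarrow> bool) \<Rightarrow> 'v set set" where
  "row_cut V x = {{u \<in> V. x u}, {u \<in> V. \<not> x u}}"

lemma row_cut_in_cuts: "row_cut V x \<in> cuts V"
  unfolding cuts_def row_cut_def by blast

lemma cuts_row_cut:
  assumes "c \<in> cuts V"
  obtains x where "c = row_cut V x"
proof -
  obtain A B where AB: "c = {A, B}" "A \<union> B = V" "A \<inter> B = {}" using assms unfolding cuts_def by blast
  then have "{u \<in> V. u \<in> A} = A" "{u \<in> V. u \<notin> A} = B" by auto
  with AB(1) have "c = row_cut V (\<lambda>u. u \<in> A)" by (simp add: row_cut_def)
  then show thesis by (rule that)
qed

lemma edge_in_row_cut:
  assumes "u \<in> V" "v \<in> V"
  shows "edge_in_cut {u, v} (row_cut V x) \<longleftrightarrow> x u \<noteq> x v"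
proof
  assume "edge_in_cut {u, v} (row_cut V x)"
  then obtain i j A B where "A \<in> row_cut V x" "B \<in> row_cut V x" "{u, v} = {i, j}" "A \<noteq> B" "i \<in> A" "j \<in> B"
    unfolding edge_in_cut_def by blast
  then show "x u \<noteq> x v" by (auto simp: row_cut_def doubleton_eq_iff)
next
  assume ne: "x u \<noteq> x v"
  let ?A = "{w \<in> V. x w}" and ?B = "{w \<in> V. \<not> x w}"
  have AB: "?A \<in> row_cut V x" "?B \<in> row_cut V x" by (simp_all add: row_cut_def)
  show "edge_in_cut {u, v} (row_cut V x)"
  proof (cases "x u")
    case True
    then have "u \<in> ?A" "v \<in> ?B" "?A \<noteq> ?B" using ne assms by auto
    then show ?thesis unfolding edge_in_cut_def
      by (intro exI[of _ u] exI[of _ v] bexI[OF _ AB(1)] bexI[OF _ AB(2)] conjI refl)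
  next
    case False
    then have "u \<in> ?B" "v \<in> ?A" "?B \<noteq> ?A" using ne assms by auto
    then show ?thesis unfolding edge_in_cut_def
      by (intro exI[of _ u] exI[of _ v] bexI[OF _ AB(2)] bexI[OF _ AB(1)] conjI refl)
  qed
qed

definition config_monom :: "'v set \<Rightarrow> nat set \<Rightarrow> (nat \<Rightarrow> 'v \<Rightarrow> bool) \<Rightarrow> 'v set set \<Rightarrow>\<^sub>0 nat" where
  "config_monom V K x = (\<Sum>k\<in>K. Poly_Mapping.single (row_cut V (x k)) 1)"

lemma keys_sum_nat:
  fixes f :: "'a \<Rightarrow> 'x \<Rightarrow>\<^sub>0 nat"
  shows "finite A \<Longrightarrow> Poly_Mapping.keys (sum f A) = (\<Union>a\<in>A. Poly_Mapping.keys (f a))"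
  by (induction A rule: finite_induct) (simp_all add: keys_plus_nat)

lemma keys_config_monom: "finite K \<Longrightarrow> Poly_Mapping.keys (config_monom V K x) = (\<lambda>k. row_cut V (x k)) ` K"
  by (auto simp: config_monom_def keys_sum_nat)

lemma keys_config_monom_subset: "Poly_Mapping.keys (config_monom V K x) \<subseteq> cuts V"
  by (cases "finite K") (auto simp: keys_config_monom row_cut_in_cuts, simp add: config_monom_def)

lemma monom_degree_config: "monom_degree (config_monom V K x) = card K"
  by (simp add: config_monom_def monom_degree_sum)

lemma monom_config:
  assumes "Poly_Mapping.keys m \<subseteq> cuts V" "monom_degree m = d"
  obtains x where "m = config_monom V {..<d} x"
proof -
  obtain c where c: "\<forall>k<monom_degree m. c k \<in> cuts V"
    "m = (\<Sum>k<monom_degree m. Poly_Mapping.single (c k) 1)"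
    using monom_decompose[OF assms(1)] by (elim exE conjE) (rule that)
  define x where "x k = (SOME x. c k = row_cut V x)" for k
  have x: "c k = row_cut V (x k)" if "k < monom_degree m" for k
  proof -
    have "c k \<in> cuts V" using c(1) that by blast
    then obtain z where "c k = row_cut V z" by (rule cuts_row_cut)
    then show ?thesis unfolding x_def by (rule someI[of "\<lambda>z. c k = row_cut V z"])
  qed
  have "(\<Sum>k<monom_degree m. Poly_Mapping.single (c k) (1::nat))
      = (\<Sum>k<monom_degree m. Poly_Mapping.single (row_cut V (x k)) 1)"
    by (intro sum.cong) (auto simp: x)
  with c(2) have "m = config_monom V {..<monom_degree m} x" unfolding config_monom_def by (rule trans)
  then show thesis unfolding assms(2) by (rule that)
qed

lemma monom_image_config:
  "monom_image E (config_monom V K x) = (\<Sum>k\<in>K. cut_monom E (row_cut V (x k)))"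
  by (simp add: config_monom_def monom_image_sum)

lemma simple_graph_finite_edges: "simple_graph V E \<Longrightarrow> finite E"
  unfolding simple_graph_def using finite_imp_finite_nsets finite_subset by blast

lemma lookup_monom_image_config:
  assumes s: "simple_graph V E" and e: "{u, v} \<in> E"
  shows "Poly_Mapping.lookup (monom_image E (config_monom V {..<d} x)) (S {u, v}) = sep_count d x u v"
proof -
  note fin = simple_graph_finite_edges[OF s]
  have "u \<in> V" "v \<in> V" using simple_graph_pair[OF s e] by auto
  then show ?thesis
    by (simp add: monom_image_config lookup_sum lookup_cut_monom fin e edge_in_row_cut sep_count_def)
qed

lemma monom_image_config_eq:
  assumes s: "simple_graph V E" and sep: "\<And>u v. {u, v} \<in> E \<Longrightarrow> sep_count d x u v = sep_count d y u v"
  shows "monom_image E (config_monom V {..<d} x) = monom_image E (config_monom V {..<d} y)"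
    (is "?x = ?y")
proof (rule poly_mapping_eqI)
  note fin = simple_graph_finite_edges[OF s]
  fix a
  have eq_S: "Poly_Mapping.lookup ?x (S e) = Poly_Mapping.lookup ?y (S e)" if e: "e \<in> E" for e
  proof -
    obtain u v where uv: "e = {u, v}" using simple_graph_edge[OF s e] .
    with e sep[of u v] show ?thesis by (simp only: lookup_monom_image_config[OF s])
  qed
  have eq_T: "Poly_Mapping.lookup ?x (T e) = Poly_Mapping.lookup ?y (T e)" if e: "e \<in> E" for e
    using eq_S[OF e] monom_image_degree[OF fin e, of "config_monom V {..<d} x"]
      monom_image_degree[OF fin e, of "config_monom V {..<d} y"]
    by (simp add: monom_degree_config)
  have out: "Poly_Mapping.lookup (monom_image E (config_monom V {..<d} z)) (S e) = 0"
    "Poly_Mapping.lookup (monom_image E (config_monom V {..<d} z)) (T e) = 0" if "e \<notin> E" for e z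
    using that by (simp_all add: monom_image_config lookup_sum lookup_cut_monom fin)
  show "Poly_Mapping.lookup ?x a = Poly_Mapping.lookup ?y a"
  proof (cases a)
    case (S e)
    then show ?thesis using eq_S[of e] out(1)[of e] by (cases "e \<in> E") auto
  next
    case (T e)
    then show ?thesis using eq_T[of e] out(2)[of e] by (cases "e \<in> E") auto
  qed
qed

text \<open>The unchanged rows form a common factor \<open>r\<close>. Cancelling its image shows
  that the changed rows alone give a binomial of degree at most two in the cut ideal.\<close>

lemma quad_step_binomial:
  fixes J :: "('v set set, 'k::field) mpoly set"
  assumes s: "simple_graph V E" and J: "ideal J (poly_ring (cuts V))"
    and quad: "\<And>p. p \<in> cut_ideal V E \<Longrightarrow> total_degree p \<le> 2 \<Longrightarrow> p \<in> J"
    and card: "card {k. k < d \<and> x k \<noteq> y k} \<le> 2"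
    and sep: "\<And>u v. {u, v} \<in> E \<Longrightarrow> sep_count d x u v = sep_count d y u v"
  shows "Poly_Mapping.single (config_monom V {..<d} x) 1 - Poly_Mapping.single (config_monom V {..<d} y) 1 \<in> J"
proof -
  let ?s = "\<lambda>m. Poly_Mapping.single m (1 :: 'k)"
  define K where "K = {k. k < d \<and> x k \<noteq> y k}"
  define r where "r = config_monom V ({..<d} - K) x"
  have r': "r = config_monom V ({..<d} - K) y"
    unfolding r_def config_monom_def by (intro sum.cong) (auto simp: K_def)
  have split: "config_monom V {..<d} z = config_monom V ({..<d} - K) z + config_monom V K z" for z
    unfolding config_monom_def by (rule sum.subset_diff) (auto simp: K_def)
  have x: "config_monom V {..<d} x = r + config_monom V K x" using split[of x] by (simp add: r_def)
  have y: "config_monom V {..<d} y = r + config_monom V K y" using split[of y] by (simp add: r')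
  have "monom_image E (config_monom V K x) = monom_image E (config_monom V K y)"
    using monom_image_config_eq[OF s sep] unfolding x y monom_image_add by simp
  then have "?s (config_monom V K x) - ?s (config_monom V K y) \<in> cut_ideal V E"
    by (intro binomial_in_cut_ideal keys_config_monom_subset)
  moreover have "total_degree (?s (config_monom V K x) - ?s (config_monom V K y)) \<le> 2"
    using keys_diff[of "?s (config_monom V K x)" "?s (config_monom V K y)"] card
    unfolding total_degree_le_iff K_def by (auto simp: monom_degree_config)
  ultimately have "?s (config_monom V K x) - ?s (config_monom V K y) \<in> J" by (rule quad)
  then have "?s r * (?s (config_monom V K x) - ?s (config_monom V K y)) \<in> J"
    by (rule ideal_poly_ringD(4)[OF J]) (simp add: single_in_poly_ring r_def keys_config_monom_subset)
  then show ?thesis by (simp add: x y right_diff_distrib mult_single)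
qed

text \<open>
  Without edges, monomials of different degrees have the same image; they are all congruent to
  the constant monomial because of the linear binomials.
\<close>

lemma generated_by_quadrics:
  fixes V :: "'v set"
  assumes s: "simple_graph V E" and noK4: "\<not> has_K4_minor V E"
  shows "generated_in_degree (cuts V) (cut_ideal V E :: ('v set set, 'k::field) mpoly set) 2"
proof -
  let ?R = "poly_ring (cuts V) :: ('v set set, 'k) mpoly ring"
  let ?I = "cut_ideal V E :: ('v set set, 'k) mpoly set"
  let ?s = "\<lambda>m. Poly_Mapping.single m (1 :: 'k)"
  interpret cring ?R by (rule cring_poly_ring)
  note fin = simple_graph_finite_edges[OF s]
  define F where "F = {p \<in> ?I. total_degree p \<le> 2}"
  have FI: "F \<subseteq> ?I" by (auto simp: F_def)
  have F: "F \<subseteq> carrier ?R" using FI ideal_poly_ringD(1)[OF ideal_cut_ideal] by blast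
  have J: "ideal (Idl\<^bsub>?R\<^esub> F) ?R" by (rule genideal_ideal[OF F])
  have quad: "p \<in> Idl\<^bsub>?R\<^esub> F" if "p \<in> ?I" "total_degree p \<le> 2" for p
    using genideal_self[OF F] that by (auto simp: F_def)
  have trans: "?s a - ?s c \<in> Idl\<^bsub>?R\<^esub> F" if "?s a - ?s b \<in> Idl\<^bsub>?R\<^esub> F" "?s b - ?s c \<in> Idl\<^bsub>?R\<^esub> F" for a b c
    using ideal_poly_ringD(3)[OF J that] by simp
  have "?I \<subseteq> Idl\<^bsub>?R\<^esub> F"
  proof (rule cut_ideal_subset_ideal[OF J])
    fix m n :: "'v set set \<Rightarrow>\<^sub>0 nat"
    assume m: "Poly_Mapping.keys m \<subseteq> cuts V" and n: "Poly_Mapping.keys n \<subseteq> cuts V"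
      and im: "monom_image E m = monom_image E n"
    show "?s m - ?s n \<in> Idl\<^bsub>?R\<^esub> F"
    proof (cases "E = {}")
      case True
      have one: "?s (config_monom V {..<d} x) - ?s 0 \<in> Idl\<^bsub>?R\<^esub> F" for d x
      proof (induction d)
        case 0
        show ?case using ideal_poly_ringD(2)[OF J] by (simp add: config_monom_def)
      next
        case (Suc d)
        let ?c = "Poly_Mapping.single (row_cut V (x d)) (1::nat)"
        have c: "Poly_Mapping.keys ?c \<subseteq> cuts V" by (simp add: row_cut_in_cuts)
        have "monom_image E ?c = monom_image E 0" using True by (simp add: cut_monom_def)
        then have "?s ?c - ?s 0 \<in> ?I" using c by (intro binomial_in_cut_ideal) auto
        moreover have "total_degree (?s ?c - ?s 0) \<le> 2"
          using keys_diff[of "?s ?c" "?s 0"] unfolding total_degree_le_iff by auto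
        ultimately have "?s ?c - ?s 0 \<in> Idl\<^bsub>?R\<^esub> F" by (rule quad)
        then have "?s (config_monom V {..<d} x) * (?s ?c - ?s 0) \<in> Idl\<^bsub>?R\<^esub> F"
          by (rule ideal_poly_ringD(4)[OF J]) (simp add: single_in_poly_ring keys_config_monom_subset)
        then have "?s (config_monom V {..<Suc d} x) - ?s (config_monom V {..<d} x) \<in> Idl\<^bsub>?R\<^esub> F"
          by (simp add: right_diff_distrib mult_single config_monom_def)
        then show ?case using Suc.IH by (rule trans)
      qed
      obtain x where x: "m = config_monom V {..<monom_degree m} x" by (rule monom_config[OF m refl])
      obtain y where y: "n = config_monom V {..<monom_degree n} y" by (rule monom_config[OF n refl])
      have "?s m - ?s 0 \<in> Idl\<^bsub>?R\<^esub> F" by (subst x) (rule one)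
      moreover have "?s n - ?s 0 \<in> Idl\<^bsub>?R\<^esub> F" by (subst y) (rule one)
      ultimately have "(?s m - ?s 0) - (?s n - ?s 0) \<in> Idl\<^bsub>?R\<^esub> F" by (rule ideal_poly_ringD(5)[OF J])
      then show ?thesis by simp
    next
      case False
      then obtain e where e: "e \<in> E" by blast
      define d where "d = monom_degree m"
      have d': "monom_degree n = d"
        using monom_image_degree[OF fin e, of m] monom_image_degree[OF fin e, of n] im by (simp add: d_def)
      obtain x where x: "m = config_monom V {..<d} x" by (rule monom_config[OF m d_def[symmetric]])
      obtain y where y: "n = config_monom V {..<d} y" by (rule monom_config[OF n d'])
      have sep: "sep_count d x u v = sep_count d y u v" if "{u, v} \<in> E" for u v
        using lookup_monom_image_config[OF s that, of d x] lookup_monom_image_config[OF s that, of d y] im x y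
        by simp
      have "V \<noteq> {}" using simple_graph_edge[OF s e] by blast
      then obtain R where R: "two_tree V R" "\<And>u v. {u, v} \<in> E \<Longrightarrow> (u, v) \<in> R \<or> (v, u) \<in> R"
        using K4_minor_free_imp_two_tree[OF s noK4] by blast
      \<comment> \<open>\<open>R\<close> contains each edge in at least one orientation.
        \<open>H\<close> collects these, and the symmetry of \<open>sep_count\<close> accounts for
        the other orientation.\<close>
      define H where "H = {(u, v) \<in> R. {u, v} \<in> E}"
      have "(quad_step H d)\<^sup>*\<^sup>* x y"
        by (rule partial_two_tree_connected[OF R(1)]) (auto simp: H_def sep)
      then have "?s (config_monom V {..<d} x) - ?s (config_monom V {..<d} y) \<in> Idl\<^bsub>?R\<^esub> F"
      proof (induction rule: rtranclp_induct)
        case base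
        show ?case using ideal_poly_ringD(2)[OF J] by simp
      next
        case (step y z)
        have "sep_count d y u v = sep_count d z u v" if uv: "{u, v} \<in> E" for u v
        proof -
          have "{v, u} \<in> E" using uv by (simp add: insert_commute)
          then have "(u, v) \<in> H \<or> (v, u) \<in> H" using R(2)[OF uv] uv by (auto simp: H_def)
          then show ?thesis
            using step.hyps(2) sep_count_commute[of d y u v] sep_count_commute[of d z u v]
            unfolding quad_step_def by auto
        qed
        then have "?s (config_monom V {..<d} y) - ?s (config_monom V {..<d} z) \<in> Idl\<^bsub>?R\<^esub> F"
          using step.hyps(2) unfolding quad_step_def
          by (intro quad_step_binomial[OF s J quad]) blast+
        with step.IH show ?case by (rule trans)
      qed
      then show ?thesis using x y by simp
    qed
  qed
  moreover have "Idl\<^bsub>?R\<^esub> F \<subseteq> ?I" by (rule genideal_minimal[OF ideal_cut_ideal FI])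
  ultimately have "?I = Idl\<^bsub>?R\<^esub> F" by blast
  then show ?thesis unfolding generated_in_degree_def using F by (intro exI[of _ F]) (auto simp: F_def)
qed

section \<open>The quartic relation\<close>

text \<open>
  Two of the four parts on the same side of \<open>s\<close> are adjacent, so that \<open>s\<close> splits the model into two
  connected pieces, and \<open>t\<close>, \<open>t'\<close> can only separate these pieces from each other.
\<close>

lemma K4_model_rigid:
  fixes s t t' :: "'v \<Rightarrow> bool"
  assumes m: "K4_model V E B"
    and closed: "\<And>u v. {u, v} \<in> E \<Longrightarrow> u \<in> (\<Union>i<4. B i) \<Longrightarrow> v \<in> (\<Union>i<4. B i)"
    and inside: "\<And>i u v. {u, v} \<in> E \<Longrightarrow> i < 4 \<Longrightarrow> u \<in> B i \<Longrightarrow> v \<in> B i \<Longrightarrow> s u = s v"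
    and outside: "\<And>u v. {u, v} \<in> E \<Longrightarrow> u \<notin> (\<Union>i<4. B i) \<Longrightarrow> s u = s v"
    and sum: "\<And>u v. {u, v} \<in> E \<Longrightarrow>
      of_bool (t u \<noteq> t v) + of_bool (t' u \<noteq> t' v) = (of_bool (s u \<noteq> s v) :: nat)"
  shows "(\<forall>u v. {u, v} \<in> E \<longrightarrow> t u = t v) \<or> (\<forall>u v. {u, v} \<in> E \<longrightarrow> t' u = t' v)"
proof (rule ccontr)
  let ?U = "\<Union>i<4. B i"
  have conn: "connected_in E (B i)" if "i < 4" for i using m that unfolding K4_model_def by blast
  have adj: "\<exists>u\<in>B i. \<exists>v\<in>B j. {u, v} \<in> E" if "i < 4" "j < 4" "i \<noteq> j" for i j
    using m that unfolding K4_model_def by blast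
  have st: "t u = t v \<and> t' u = t' v" if "{u, v} \<in> E" "s u = s v" for u v
    using sum[OF that(1)] that(2) by (auto split: if_splits simp: of_bool_def)
  have st': "t u = t v \<or> t' u = t' v" if "{u, v} \<in> E" for u v
    using sum[OF that] by (cases "s u = s v") (auto simp: of_bool_def split: if_splits)
  have const: "s u = s v" "t u = t v" if "i < 4" "u \<in> B i" "v \<in> B i" for i u v
  proof -
    show "s u = s v" by (rule connected_inD[where h = s, OF conn[OF that(1)] that(2,3)]) (use inside that(1) in blast)
    show "t u = t v" by (rule connected_inD[where h = t, OF conn[OF that(1)] that(2,3)]) (use inside that(1) st in blast)
  qed
  have side: "t u = t w" if u: "u \<in> ?U" and w: "w \<in> ?U" and eq: "s u = s w" for u w
  proof -
    obtain i where i: "i < 4" "u \<in> B i" using u by auto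
    obtain j where j: "j < 4" "w \<in> B j" using w by auto
    show ?thesis
    proof (cases "i = j")
      case True
      then show ?thesis using const(2)[OF i] j by simp
    next
      case False
      obtain p q where pq: "p \<in> B i" "q \<in> B j" "{p, q} \<in> E" using adj[OF i(1) j(1) False] by blast
      have "s p = s q" using const(1)[OF i pq(1)] const(1)[OF j pq(2)] eq by simp
      then have "t p = t q" using st[OF pq(3)] by simp
      then show ?thesis using const(2)[OF i pq(1)] const(2)[OF j pq(2)] by simp
    qed
  qed
  assume "\<not> ?thesis"
  then obtain u v u' v' where uv: "{u, v} \<in> E" "t u \<noteq> t v" and uv': "{u', v'} \<in> E" "t' u' \<noteq> t' v'"
    by blast
  have "s u \<noteq> s v" using st uv by blast
  have "s u' \<noteq> s v'" using st uv' by blast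
  have U: "u \<in> ?U" using outside[OF uv(1)] \<open>s u \<noteq> s v\<close> by blast
  have V: "v \<in> ?U" using closed[OF uv(1) U] .
  have U': "u' \<in> ?U" using outside[OF uv'(1)] \<open>s u' \<noteq> s v'\<close> by blast
  have V': "v' \<in> ?U" using closed[OF uv'(1) U'] .
  \<comment> \<open>An edge cut by \<open>t'\<close> is not cut by \<open>t\<close>. Its ends
    nevertheless lie on the two sides of \<open>s\<close>, on which \<open>t\<close> takes the
    different values \<open>t u\<close> and \<open>t v\<close>.\<close>
  have "t u' = t v'" using st'[OF uv'(1)] uv'(2) by blast
  moreover have "(s u' = s u \<and> s v' = s v) \<or> (s u' = s v \<and> s v' = s u)"
    using \<open>s u \<noteq> s v\<close> \<open>s u' \<noteq> s v'\<close> by blast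
  ultimately show False
    using side[OF U' U] side[OF V' V] side[OF U' V] side[OF V' U] uv(2) by auto
qed

section \<open>Linear functionals and fibres of the monomial map\<close>

definition linear_ext :: "(('x \<Rightarrow>\<^sub>0 nat) \<Rightarrow> 'k::field) \<Rightarrow> ('x, 'k) mpoly \<Rightarrow> 'k" where
  "linear_ext h p = (\<Sum>m\<in>Poly_Mapping.keys p. Poly_Mapping.lookup p m * h m)"

lemma linear_ext_superset:
  assumes "finite A" "Poly_Mapping.keys p \<subseteq> A"
  shows "linear_ext h p = (\<Sum>m\<in>A. Poly_Mapping.lookup p m * h m)"
  unfolding linear_ext_def using assms
  by (intro sum.mono_neutral_left) (auto simp: in_keys_iff)

lemma linear_ext_zero [simp]: "linear_ext h 0 = 0"
  by (simp add: linear_ext_def)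

lemma linear_ext_add: "linear_ext h (p + q) = linear_ext h p + linear_ext h q"
proof -
  let ?A = "Poly_Mapping.keys p \<union> Poly_Mapping.keys q"
  have "Poly_Mapping.keys (p + q) \<subseteq> ?A" by (rule Poly_Mapping.keys_add)
  then show ?thesis
    by (simp add: linear_ext_superset[of ?A] lookup_add distrib_right sum.distrib)
qed

lemma linear_ext_single [simp]: "linear_ext h (Poly_Mapping.single m c) = c * h m"
  by (simp add: linear_ext_superset[of "{m}"])

lemma linear_ext_sum: "linear_ext h (sum f A) = (\<Sum>a\<in>A. linear_ext h (f a))"
  by (induction A rule: infinite_finite_induct) (simp_all add: linear_ext_add)

text \<open>Multiplication by a monomial shifts the weight \<open>h\<close>. Hence the polynomials
  annihilated by all shifts of a functional form an ideal.\<close>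

lemma linear_ext_mult:
  "linear_ext h (q * p)
     = (\<Sum>s\<in>Poly_Mapping.keys q. Poly_Mapping.lookup q s * linear_ext (\<lambda>m. h (s + m)) p)"
proof -
  let ?s = Poly_Mapping.single
  have "q * p = (\<Sum>s\<in>Poly_Mapping.keys q. ?s s (Poly_Mapping.lookup q s)) *
      (\<Sum>m\<in>Poly_Mapping.keys p. ?s m (Poly_Mapping.lookup p m))"
    using poly_eq_sum_single[of q] poly_eq_sum_single[of p] by simp
  then have eq: "q * p = (\<Sum>s\<in>Poly_Mapping.keys q. \<Sum>m\<in>Poly_Mapping.keys p.
      ?s (s + m) (Poly_Mapping.lookup q s * Poly_Mapping.lookup p m))"
    by (simp add: sum_product mult_single)
  show ?thesis
    unfolding eq linear_ext_sum linear_ext_single by (simp add: linear_ext_def sum_distrib_left mult.assoc)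
qed

text \<open>On each fibre \<open>h\<close> is constant, and the coefficients of \<open>p\<close>
  over the fibre sum to a coefficient of \<open>cut_map E p\<close>, which is zero.\<close>

lemma linear_ext_cut_ideal:
  assumes p: "p \<in> cut_ideal V E"
    and h: "\<And>m n. m \<in> Poly_Mapping.keys p \<Longrightarrow> n \<in> Poly_Mapping.keys p \<Longrightarrow>
      monom_image E m = monom_image E n \<Longrightarrow> h m = h n"
  shows "linear_ext h p = 0"
proof -
  let ?K = "Poly_Mapping.keys p"
  have "linear_ext h p = (\<Sum>w\<in>monom_image E ` ?K. \<Sum>m | m \<in> ?K \<and> monom_image E m = w. Poly_Mapping.lookup p m * h m)"
    unfolding linear_ext_def by (rule sum.image_gen) simp
  also have "\<dots> = 0"
  proof (rule sum.neutral, rule ballI)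
    fix w assume "w \<in> monom_image E ` ?K"
    then obtain n where n: "n \<in> ?K" "w = monom_image E n" by blast
    have "(\<Sum>m | m \<in> ?K \<and> monom_image E m = w. Poly_Mapping.lookup p m * h m)
        = (\<Sum>m | m \<in> ?K \<and> monom_image E m = w. Poly_Mapping.lookup p m) * h n"
      unfolding sum_distrib_right
    proof (rule sum.cong[OF refl])
      fix m assume "m \<in> {m. m \<in> ?K \<and> monom_image E m = w}"
      then have "h m = h n" using h n by blast
      then show "Poly_Mapping.lookup p m * h m = Poly_Mapping.lookup p m * h n" by simp
    qed
    also have "\<dots> = 0"
      using p by (simp add: cut_ideal_iff flip: lookup_cut_map)
    finally show "(\<Sum>m | m \<in> ?K \<and> monom_image E m = w. Poly_Mapping.lookup p m * h m) = 0" .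
  qed
  finally show ?thesis .
qed

lemma monom_degree_1:
  assumes "monom_degree m = 1"
  obtains c where "m = Poly_Mapping.single c 1"
proof -
  obtain c where "m = (\<Sum>k<monom_degree m. Poly_Mapping.single (c k) 1)"
    using monom_decompose[of m UNIV] by blast
  then show thesis using that assms by simp
qed

lemma monom_remove:
  assumes "c \<in> Poly_Mapping.keys m"
  obtains n where "m = n + Poly_Mapping.single c (1::nat)" "monom_degree m = Suc (monom_degree n)"
proof -
  have "m = (m - Poly_Mapping.single c 1) + Poly_Mapping.single c 1"
    using assms by (intro poly_mapping_eqI)
      (auto simp: lookup_add lookup_minus lookup_single when_def in_keys_iff)
  moreover from arg_cong[OF this, of monom_degree]
  have "monom_degree m = Suc (monom_degree (m - Poly_Mapping.single c 1))"
    unfolding monom_degree_add by simp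
  ultimately show thesis by (rule that)
qed

text \<open>On a disconnected graph several cuts contain no edge, all with the same image. The
  invariant below refers to any of them, not just to the cut with an empty part.\<close>

definition trivial_cut :: "'v set set \<Rightarrow> 'v set set \<Rightarrow> bool" where
  "trivial_cut E c \<longleftrightarrow> (\<forall>e\<in>E. \<not> edge_in_cut e c)"

lemma trivial_cut_cong: "finite E \<Longrightarrow> cut_monom E c = cut_monom E c' \<Longrightarrow> trivial_cut E c = trivial_cut E c'"
  unfolding trivial_cut_def
  by (intro ball_cong refl) (metis lookup_cut_monom(1) of_bool_eq_iff)

lemma trivial_row_cut:
  assumes "simple_graph V E"
  shows "trivial_cut E (row_cut V x) \<longleftrightarrow> (\<forall>u v. {u, v} \<in> E \<longrightarrow> x u = x v)"
proof -
  have "edge_in_cut {u, v} (row_cut V x) \<longleftrightarrow> x u \<noteq> x v" if "{u, v} \<in> E" for u v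
    using simple_graph_pair[OF assms that] by (intro edge_in_row_cut) auto
  moreover have "\<exists>u v. e = {u, v}" if "e \<in> E" for e using simple_graph_edge[OF assms that] by metis
  ultimately show ?thesis unfolding trivial_cut_def by metis
qed

text \<open>
  The monomials of the four cuts \<open>\<emptyset>\<close>, \<open>01\<close>, \<open>02\<close>, \<open>03\<close> and of the four cuts \<open>0\<close>, \<open>1\<close>, \<open>2\<close>, \<open>3\<close>
  of \<open>K\<^sub>4\<close> have the same image. Only the first one contains a trivial cut, a property that is
  preserved when at most two variables are exchanged.
\<close>

lemma K4_model_not_generated:
  fixes V :: "'v set"
  assumes s: "simple_graph V E" and m: "K4_model V E B"
    and closed: "\<And>u v. {u, v} \<in> E \<Longrightarrow> u \<in> (\<Union>i<4. B i) \<Longrightarrow> v \<in> (\<Union>i<4. B i)"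
  shows "\<not> generated_in_degree (cuts V) (cut_ideal V E :: ('v set set, 'k::field) mpoly set) 2"
proof
  let ?R = "poly_ring (cuts V) :: ('v set set, 'k) mpoly ring"
  let ?I = "cut_ideal V E :: ('v set set, 'k) mpoly set"
  assume "generated_in_degree (cuts V) ?I 2"
  then obtain F where F: "F \<subseteq> carrier ?R" "\<And>p. p \<in> F \<Longrightarrow> total_degree p \<le> 2" "?I = Idl\<^bsub>?R\<^esub> F"
    unfolding generated_in_degree_def by blast
  interpret cring ?R by (rule cring_poly_ring)
  have FI: "F \<subseteq> ?I" unfolding F(3) by (rule genideal_self[OF F(1)])
  note fin = simple_graph_finite_edges[OF s]
  have disj: "B i \<inter> B j = {}" "\<exists>u\<in>B i. \<exists>v\<in>B j. {u, v} \<in> E" if "i < 4" "j < 4" "i \<noteq> j" for i j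
    using m that unfolding K4_model_def by blast+
  have four: "{..<4::nat} = {0, 1, 2, 3}" by auto
  \<comment> \<open>Vertices outside the model share the label \<open>0\<close>; by closedness no
    edge joins them to the model.\<close>
  define lab :: "'v \<Rightarrow> nat" where
    "lab w = (if w \<in> B 1 then 1 else if w \<in> B 2 then 2 else if w \<in> B 3 then 3 else 0)" for w
  have lab4: "lab w \<in> {0, 1, 2, 3}" for w by (simp add: lab_def)
  have lab: "lab w = i" if "i < 4" "w \<in> B i" for i w
    using that disj(1)[of i 1] disj(1)[of i 2] disj(1)[of i 3]
    by (cases "i = 1"; cases "i = 2"; cases "i = 3") (auto simp: lab_def)
  have lab_out: "lab w = 0" if "w \<notin> (\<Union>i<4. B i)" for w
    using that by (auto simp: lab_def four)
  \<comment> \<open>\<open>P 0\<close> is constantly false and gives the trivial cut. In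
    \<open>P\<close> as in \<open>Q\<close>, two different labels are separated in exactly two of
    the four rows.\<close>
  define P where "P k w \<longleftrightarrow> k \<noteq> 0 \<and> (lab w = 0 \<or> lab w = k)" for k :: nat and w
  define Q where "Q k w \<longleftrightarrow> lab w = k" for k w
  have PQ: "sep_count 4 P u v = sep_count 4 Q u v" "lab u = lab v \<Longrightarrow> sep_count 4 P u v = 0" for u v
    using lab4[of u] lab4[of v] unfolding sep_count_def four P_def Q_def by auto
  let ?M = "\<lambda>x. config_monom V {..<4} x"
  have image: "monom_image E (?M P) = monom_image E (?M Q)"
    by (rule monom_image_config_eq[OF s PQ(1)])
  \<comment> \<open>The image is part of the invariant because it guarantees that no cut in the
    monomial separates adjacent vertices with equal labels.\<close>
  define K where "K n \<longleftrightarrow> monom_image E n = monom_image E (?M P) \<and> (\<exists>c\<in>Poly_Mapping.keys n. trivial_cut E c)" for n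
  have "trivial_cut E (row_cut V (P 0))" unfolding trivial_row_cut[OF s] by (simp add: P_def)
  then have KP: "K (?M P)" unfolding K_def by (auto simp: keys_config_monom four)
  have KQ: "\<not> K (?M Q)"
  proof
    assume "K (?M Q)"
    then obtain k where k: "k < 4" "trivial_cut E (row_cut V (Q k))"
      unfolding K_def by (auto simp: keys_config_monom)
    define j where "j = (if k = 0 then 1 else 0 :: nat)"
    have j: "j < 4" "k \<noteq> j" by (auto simp: j_def)
    obtain u v where uv: "u \<in> B k" "v \<in> B j" "{u, v} \<in> E" using disj(2)[OF k(1) j] by blast
    then have "Q k u = Q k v" using k(2) unfolding trivial_row_cut[OF s] by blast
    then show False using lab[OF k(1) uv(1)] lab[OF j(1) uv(2)] j(2) by (simp add: Q_def)
  qed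
  obtain e where e: "e \<in> E" using disj(2)[of 0 1] by auto
  have step: "K (r + n')"
    if K: "K (r + n)" and keys: "Poly_Mapping.keys n \<subseteq> cuts V" "Poly_Mapping.keys n' \<subseteq> cuts V"
      and im: "monom_image E n = monom_image E n'" and deg: "monom_degree n \<le> 2" for r n n'
  proof -
    have deg': "monom_degree n' = monom_degree n"
      using monom_image_degree[OF fin e, of n] monom_image_degree[OF fin e, of n'] im by simp
    have im': "monom_image E (r + n') = monom_image E (?M P)"
      using K im by (simp add: K_def monom_image_add)
    from K obtain c where c: "c \<in> Poly_Mapping.keys (r + n)" "trivial_cut E c" unfolding K_def by blast
    have "\<exists>c\<in>Poly_Mapping.keys (r + n'). trivial_cut E c"
    proof (cases "c \<in> Poly_Mapping.keys r")
      case True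
      with c(2) show ?thesis by (auto simp: keys_plus_nat)
    next
      case False
      then have cn: "c \<in> Poly_Mapping.keys n" using c(1) by (simp add: keys_plus_nat)
      obtain n1 where n1: "n = n1 + Poly_Mapping.single c 1" "monom_degree n = Suc (monom_degree n1)"
        by (rule monom_remove[OF cn])
      consider "monom_degree n1 = 0" | "monom_degree n1 = 1" using n1(2) deg by linarith
      then show ?thesis
      proof cases
        case 1
        then have "monom_degree n = 1" "monom_degree n' = 1" using n1(2) deg' by simp_all
        then obtain a a' where a: "n = Poly_Mapping.single a 1" "n' = Poly_Mapping.single a' 1"
          using monom_degree_1 by metis
        then have "cut_monom E c = cut_monom E a'" using im cn by simp
        then have "trivial_cut E a'" using trivial_cut_cong[OF fin] c(2) by blast
        then show ?thesis using a by (auto simp: keys_plus_nat)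
      next
        case 2
        then have "monom_degree n' = 2" using n1(2) deg' by simp
        then obtain a where a: "n' = config_monom V {..<2} a" by (rule monom_config[OF keys(2)])
        have "Poly_Mapping.keys n1 \<subseteq> cuts V" using keys(1) n1(1) by (auto simp: keys_plus_nat)
        then obtain b where b: "n1 = config_monom V {..<1} b" by (rule monom_config[OF _ 2])
        have c_edge: "Poly_Mapping.lookup (cut_monom E c) (S e) = 0" if "e \<in> E" for e
          using c(2) that by (simp add: lookup_cut_monom fin trivial_cut_def)
        \<comment> \<open>The trivial cut \<open>c\<close> adds nothing to the
          \<open>S\<close>-exponents, so the two rows of \<open>a\<close> together have the counts
          of the single row \<open>b 0\<close>.\<close>
        have sum: "of_bool (a 0 u \<noteq> a 0 v) + of_bool (a 1 u \<noteq> a 1 v) = (of_bool (b 0 u \<noteq> b 0 v) :: nat)"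
          if uv: "{u, v} \<in> E" for u v
        proof -
          have "Poly_Mapping.lookup (monom_image E n') (S {u, v}) = Poly_Mapping.lookup (monom_image E n1) (S {u, v})"
            unfolding im[symmetric] n1(1) monom_image_add using c_edge[OF uv] by (simp add: lookup_add)
          then have "sep_count 2 a u v = sep_count 1 b u v"
            unfolding a b lookup_monom_image_config[OF s uv] .
          then show ?thesis by (simp add: sep_count_def numeral_2_eq_2)
        qed
        have same: "b 0 u = b 0 v" if uv: "{u, v} \<in> E" "lab u = lab v" for u v
        proof -
          have "Poly_Mapping.lookup (monom_image E (r + n)) (S {u, v}) = 0"
            using K PQ(2)[OF uv(2)] by (simp add: K_def lookup_monom_image_config[OF s uv(1)])
          then have "Poly_Mapping.lookup (monom_image E n1) (S {u, v}) = 0"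
            unfolding n1(1) monom_image_add by (simp add: lookup_add)
          then have "sep_count 1 b u v = 0" unfolding b lookup_monom_image_config[OF s uv(1)] .
          then show ?thesis by (simp add: sep_count_def)
        qed
        have "(\<forall>u v. {u, v} \<in> E \<longrightarrow> a 0 u = a 0 v) \<or> (\<forall>u v. {u, v} \<in> E \<longrightarrow> a 1 u = a 1 v)"
        proof (rule K4_model_rigid[OF m closed _ _ sum])
          fix i u v assume "{u, v} \<in> E" "i < 4" "u \<in> B i" "v \<in> B i"
          then show "b 0 u = b 0 v" using same lab by simp
        next
          fix u v assume uv: "{u, v} \<in> E" "u \<notin> (\<Union>i<4. B i)"
          have "{v, u} \<in> E" using uv(1) by (simp add: insert_commute)
          then have "v \<notin> (\<Union>i<4. B i)" using closed[of v u] uv(2) by blast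
          then show "b 0 u = b 0 v" using same[OF uv(1)] lab_out uv(2) by simp
        qed
        then have "trivial_cut E (row_cut V (a 0)) \<or> trivial_cut E (row_cut V (a 1))"
          unfolding trivial_row_cut[OF s] .
        then show ?thesis unfolding a by (auto simp: keys_plus_nat keys_config_monom)
      qed
    qed
    with im' show ?thesis unfolding K_def by blast
  qed
  \<comment> \<open>All cofactors \<open>r\<close> are tested so that \<open>Z\<close> is closed
    under multiplication. The case \<open>r = 0\<close> then excludes the quartic binomial, on which
    the functional takes the value \<open>1\<close>.\<close>
  define Z where "Z = {p \<in> carrier ?R. \<forall>r. linear_ext (\<lambda>n. of_bool (K (r + n))) p = 0}"
  have "F \<subseteq> Z"
  proof
    fix p assume p: "p \<in> F"
    have keys: "Poly_Mapping.keys n \<subseteq> cuts V" "monom_degree n \<le> 2" if "n \<in> Poly_Mapping.keys p" for n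
      using subsetD[OF F(1) p] F(2)[OF p] that by (simp_all add: poly_ring_carrier_iff total_degree_le_iff)
    have "linear_ext (\<lambda>n. of_bool (K (r + n))) p = 0" for r
    proof (rule linear_ext_cut_ideal)
      show "p \<in> ?I" using p FI by blast
      fix n n' assume "n \<in> Poly_Mapping.keys p" "n' \<in> Poly_Mapping.keys p" "monom_image E n = monom_image E n'"
      then have "K (r + n) = K (r + n')" using step[of r n n'] step[of r n' n] keys by auto
      then show "(of_bool (K (r + n)) :: 'k) = of_bool (K (r + n'))" by simp
    qed
    then show "p \<in> Z" using p F(1) by (auto simp: Z_def)
  qed
  moreover have "ideal Z ?R"
  proof (rule ideal_poly_ringI)
    show "q * p \<in> Z" if "p \<in> Z" "q \<in> carrier ?R" for p q
    proof -
      have "q * p \<in> carrier ?R" using m_closed[of q p] that by (simp add: Z_def)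
      moreover have "linear_ext (\<lambda>n. of_bool (K (r + (t + n)))) p = (0 :: 'k)" for r t
        using that(1) by (simp add: Z_def add.assoc[symmetric])
      ultimately show ?thesis by (simp add: Z_def linear_ext_mult)
    qed
    show "p + q \<in> Z" if "p \<in> Z" "q \<in> Z" for p q
      using a_closed[of p q] that by (simp add: Z_def linear_ext_add)
  qed (use zero_closed in \<open>auto simp: Z_def\<close>)
  ultimately have "?I \<subseteq> Z" unfolding F(3) by (intro genideal_minimal)
  moreover have "Poly_Mapping.single (?M P) 1 - Poly_Mapping.single (?M Q) 1 \<in> ?I"
    by (rule binomial_in_cut_ideal[OF keys_config_monom_subset keys_config_monom_subset image])
  ultimately have "linear_ext (\<lambda>n. of_bool (K (0 + n))) (Poly_Mapping.single (?M P) 1 - Poly_Mapping.single (?M Q) 1) = (0::'k)"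
    unfolding Z_def by blast
  moreover have "Poly_Mapping.single (?M P) 1 - Poly_Mapping.single (?M Q) 1
      = Poly_Mapping.single (?M P) 1 + Poly_Mapping.single (?M Q) (- 1 :: 'k)"
    by (simp add: single_uminus)
  ultimately show False using KP KQ by (simp add: linear_ext_add)
qed

text \<open>The infimum of a set of naturals in \<open>enat\<close> is attained unless the set is
  empty, when it is infinite; and generators of degree at most \<open>d'\<close> also serve for
  every larger bound.\<close>

lemma mu_le_iff: "mu TYPE('k::field) V E \<le> enat d \<longleftrightarrow>
  generated_in_degree (cuts V) (cut_ideal V E :: ('v set set, 'k) mpoly set) d"
proof
  let ?D = "{d. generated_in_degree (cuts V) (cut_ideal V E :: ('v set set, 'k) mpoly set) d}"
  assume "mu TYPE('k) V E \<le> enat d"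
  then have le: "Inf (enat ` ?D) \<le> enat d" by (simp add: mu_def)
  have "enat ` ?D \<noteq> {}"
  proof
    assume "enat ` ?D = {}"
    then have "Inf {} \<le> enat d" using le by (simp only:)
    then show False by (simp add: Inf_enat_def)
  qed
  then have "Inf (enat ` ?D) \<in> enat ` ?D"
    unfolding Inf_enat_def by (simp only: if_False) (metis (mono_tags, lifting) LeastI ex_in_conv)
  then obtain d' where d': "d' \<in> ?D" "d' \<le> d" using le by auto
  then show "generated_in_degree (cuts V) (cut_ideal V E :: ('v set set, 'k) mpoly set) d"
    unfolding generated_in_degree_def using order_trans[OF _ d'(2)] by blast
next
  assume "generated_in_degree (cuts V) (cut_ideal V E :: ('v set set, 'k) mpoly set) d"
  then show "mu TYPE('k) V E \<le> enat d" by (auto simp: mu_def intro: Inf_lower)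
qed

theorem corollary2p8:
  fixes V :: "'v set" and E :: "'v set set"
  assumes "simple_graph V E"
  shows "(generated_in_degree (cuts V) (cut_ideal V E :: ('v set set, 'k::field) mpoly set) 2
            \<longleftrightarrow> \<not> has_K4_minor V E)
         \<and> (mu TYPE('k) V E \<le> 2 \<longleftrightarrow> \<not> has_K4_minor V E)"
proof -
  have "\<not> generated_in_degree (cuts V) (cut_ideal V E :: ('v set set, 'k) mpoly set) 2"
    if minor: "has_K4_minor V E"
  proof -
    obtain B0 where "K4_model V E B0" using minor_imp_K4_model[OF assms minor] by blast
    then obtain B where "K4_model V E B"
      "\<forall>u v. {u, v} \<in> E \<longrightarrow> u \<in> (\<Union>i<4. B i) \<longrightarrow> v \<in> (\<Union>i<4. B i)"
      using K4_model_closed[OF assms] by blast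
    then show ?thesis by (intro K4_model_not_generated[OF assms]) blast+
  qed
  then have "generated_in_degree (cuts V) (cut_ideal V E :: ('v set set, 'k) mpoly set) 2
      \<longleftrightarrow> \<not> has_K4_minor V E"
    using generated_by_quadrics[OF assms] by blast
  then show ?thesis using mu_le_iff[of V E 2, where 'k = 'k] by (simp add: numeral_eq_enat)
qed

end
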